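(* Let $p\ge3$ be a fixed integer, $0<\beta<\beta_f$, and $h=h_N=\rho N^{-\alpha}$ with $\rho>0$ and $\alpha\ge\tfrac14$. Put $$X_N=\log Z_N(\beta,h)-\binom Np\,\mathbb E\log\cosh\big(\beta J/N^{(p-1)/2}\big)-N\log(2\cosh h),$$ $v_1^2=\dfrac{\beta^4\,\mathrm{Var}(J^2)}{4\,p!}$ and $v_{1,p}(\beta,\rho)^2=\dfrac{\beta^2\rho^{2p}}{p!^{3/2}}\,\mathbb E\Big(\dfrac{H_p(\eta)}{\sqrt{p!}}H_p(\eta)\Big)$ with $\eta\sim\mathrm N(0,1)$. Then, in distribution as $N\to\infty$: (a) if $\alpha>\frac{p-1}{2p}$, then $N^{(p-2)/2}X_N\to\mathrm N(0,v_1^2)$; (b) if $\alpha=\frac{p-1}{2p}$, then $N^{(p-2)/2}X_N\to\mathrm N(0,v_2^2)$ with $v_2^2=v_{1,p}(\beta,\rho)^2+v_1^2$; (c) if $\frac14\le\alpha<\frac{p-1}{2p}$, then $N^{(2\alpha p-1)/2}X_N\to\mathrm N(0,v_3^2)$ with $v_3^2=v_{1,p}(\beta,\rho)^2$.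
   Context: Pure $p$-spin model. $\mathcal E_{N,p}$ is the set of $p$-tuples $\boldsymbol i=(i_1,\dots,i_p)$ with $1\le i_1<\cdots<i_p\le N$; for $\sigma\in\{-1,+1\}^N$, $\sigma_{\boldsymbol i}=\prod_{j=1}^p\sigma_{i_j}$. The variables $(J_{\boldsymbol i})_{\boldsymbol i\in\mathcal E_{N,p}}$ are i.i.d. copies of $J$, which is symmetrically distributed with mean zero, variance one and finite fourth moment. The partition function is $Z_N(\beta,h)=\sum_{\sigma\in\{-1,+1\}^N}\exp\big(\beta N^{-(p-1)/2}\sum_{\boldsymbol i\in\mathcal E_{N,p}}J_{\boldsymbol i}\sigma_{\boldsymbol i}+h\sum_{i=1}^N\sigma_i\big)$. $\beta_f=\inf_{x\in(0,1)}\sqrt{p!\,I(x)/x^p}$ with $I(x)=\frac12(1+x)\log(1+x)+\frac12(1-x)\log(1-x)$. $H_p$ denotes the (probabilists', monic) Hermite polynomial of degree $p$. *)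

theory Defs
  imports "HOL-Probability.Probability" "HOL-Computational_Algebra.Polynomial"
begin

definition index_tuples :: "nat \<Rightarrow> nat \<Rightarrow> nat list set" where
  "index_tuples N p = {is. length is = p \<and> sorted_wrt (<) is \<and> set is \<subseteq> {1..N}}"

(* Functions in a PiE set are undefined outside {1..N}, so this set has exactly 2^N elements. *)
definition spin_configs :: "nat \<Rightarrow> (nat \<Rightarrow> real) set" where
  "spin_configs N = {1..N} \<rightarrow>\<^sub>E {-1, 1}"

definition spin_product :: "(nat \<Rightarrow> real) \<Rightarrow> nat list \<Rightarrow> real" where
  "spin_product \<sigma> is = (\<Prod>j<length is. \<sigma> (is ! j))"

(* g is one realisation of the disorder. *)
definition partition_function ::
  "nat \<Rightarrow> nat \<Rightarrow> (nat list \<Rightarrow> real) \<Rightarrow> real \<Rightarrow> real \<Rightarrow> real" where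
  "partition_function p N g \<beta> h =
     (\<Sum>\<sigma>\<in>spin_configs N.
        exp (\<beta> * real N powr (- ((real p - 1) / 2)) *
               (\<Sum>is\<in>index_tuples N p. g is * spin_product \<sigma> is)
             + h * (\<Sum>i=1..N. \<sigma> i)))"

definition entropy_I :: "real \<Rightarrow> real" where
  "entropy_I x = 1/2 * (1 + x) * ln (1 + x) + 1/2 * (1 - x) * ln (1 - x)"

definition beta_f :: "nat \<Rightarrow> real" where
  "beta_f p = (INF x\<in>{0<..<1}. sqrt (fact p * entropy_I x / x ^ p))"

(* Probabilists' normalisation: H_0 = 1, H_1 = X, H_2 = X^2 - 1, ... *)
fun hermite :: "nat \<Rightarrow> real poly" where
  "hermite 0 = 1"
| "hermite (Suc 0) = [:0, 1:]"
| "hermite (Suc (Suc n)) = [:0, 1:] * hermite (Suc n) - smult (real (Suc n)) (hermite n)"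

(* N(0, v) parametrised by its variance v >= 0.  It is defined by scaling because v = 0 (a point
   mass at 0) must be allowed, e.g. Var(J^2) = 0 for Rademacher disorder. *)
definition centered_normal :: "real \<Rightarrow> real measure" where
  "centered_normal v = distr std_normal_distribution borel (\<lambda>x. sqrt v * x)"

lemma centered_normal_pos:
  assumes "v > 0"
  shows "centered_normal v = density lborel (normal_density 0 (sqrt v))"
proof -
  interpret real_distribution std_normal_distribution by (rule real_dist_normal_dist)
  have "distributed std_normal_distribution lborel (\<lambda>x. x) std_normal_density"
    by (auto simp: distributed_def intro!: distr_id2)
  from normal_density_affine[OF this, of "sqrt v" 0] assms
  have "distributed std_normal_distribution lborel (\<lambda>x. sqrt v * x) (normal_density 0 (sqrt v))"
    by simp
  then show ?thesis
    by (auto simp: distributed_def centered_normal_def cong: distr_cong)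
qed

lemma centered_normal_0: "centered_normal 0 = return borel 0"
proof -
  interpret real_distribution std_normal_distribution by (rule real_dist_normal_dist)
  show ?thesis
    by (simp add: centered_normal_def distr_const)
qed

(* The disorder variable J is given on the probability space P. *)
definition X_N ::
  "'b measure \<Rightarrow> ('b \<Rightarrow> real) \<Rightarrow> nat \<Rightarrow> real \<Rightarrow> real \<Rightarrow> nat \<Rightarrow> (nat list \<Rightarrow> real) \<Rightarrow> real" where
  "X_N P J p \<beta> h N g =
     ln (partition_function p N g \<beta> h)
     - real (N choose p) *
         prob_space.expectation P (\<lambda>\<omega>. ln (cosh (\<beta> * J \<omega> / real N powr ((real p - 1) / 2))))
     - real N * ln (2 * cosh h)"

definition v1_sq :: "'b measure \<Rightarrow> ('b \<Rightarrow> real) \<Rightarrow> nat \<Rightarrow> real \<Rightarrow> real" where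
  "v1_sq P J p \<beta> = \<beta> ^ 4 * prob_space.variance P (\<lambda>\<omega>. (J \<omega>)\<^sup>2) / (4 * fact p)"

definition v1p_sq :: "nat \<Rightarrow> real \<Rightarrow> real \<Rightarrow> real" where
  "v1p_sq p \<beta> \<rho> =
     \<beta>\<^sup>2 * \<rho> ^ (2 * p) / (fact p powr (3/2)) *
     prob_space.expectation std_normal_distribution
       (\<lambda>\<eta>. poly (hermite p) \<eta> / sqrt (fact p) * poly (hermite p) \<eta>)"

end

theory Submission
  imports Defs "HOL-Real_Asymp.Real_Asymp"
begin

text \<open>
  Write \<open>b = \<beta> N^(-(p-1)/2)\<close>, \<open>t\<^sub>i = tanh (b J\<^sub>i)\<close>, \<open>s = E (t\<^sub>i\<^sup>2)\<close> and \<open>m = tanh h\<close>. A product of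
  spins is a sign, so \<open>exp (b J\<^sub>i \<sigma>\<^sub>i) = cosh (b J\<^sub>i) (1 + t\<^sub>i \<sigma>\<^sub>i)\<close>, and the partition function
  factors into \<open>(2 cosh h)^N\<close>, the product of the \<open>cosh (b J\<^sub>i)\<close>, and the reduced partition function
  \<open>R\<close>, the mean of \<open>\<Prod>\<^sub>i (1 + t\<^sub>i \<sigma>\<^sub>i)\<close> over independent spins of mean \<open>m\<close>. Hence
  \<open>X\<^sub>N = \<Sum>\<^sub>i (ln cosh (b J\<^sub>i) - E ln cosh (b J)) + ln R\<close>.

  Expand the product in the \<open>t\<^sub>i\<close>: \<open>R = 1 + m^p \<Sum>\<^sub>i t\<^sub>i + W\<close>, where \<open>W\<close> collects the terms with at least
  two distinct factors. If \<open>W\<close> is negligible then \<open>X\<^sub>N\<close> is, up to errors that vanish after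
  rescaling, the i.i.d. sum of \<open>b\<^sup>2 (J\<^sub>i\<^sup>2 - 1) / 2 + m^p b J\<^sub>i\<close>. Its two parts have variances of order
  \<open>N^(2-p)\<close> and \<open>N^(1 - 2 \<alpha> p)\<close>, they are uncorrelated because \<open>J\<close> is symmetric, and the three regimes of
  \<open>\<alpha>\<close> say which of the two dominates. The Hermite factor in the limit variance is only a way to
  write \<open>p!\<close>, since \<open>E (H\<^sub>p(\<eta>)\<^sup>2) = p!\<close>.

  The work is in the bound on \<open>W\<close>. Introducing two replicas and averaging over the disorder gives
  \<open>E W\<^sup>2 = E (\<Prod>\<^sub>i (1 + s \<epsilon>\<^sub>i) - 1 - s \<Sum>\<^sub>i \<epsilon>\<^sub>i)\<close>, where \<open>\<epsilon>\<^sub>i\<close> is a product of \<open>p\<close> independent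
  spins of mean \<open>m\<^sup>2\<close>, the sitewise products of the two replicas, so that \<open>\<Sum>\<^sub>i \<epsilon>\<^sub>i\<close> is the elementary
  symmetric polynomial of degree \<open>p\<close> in these spins (lemma \<open>reduced_partition_second_moment\<close>). It
  differs from \<open>S^p / p!\<close>, with \<open>S\<close> the sum of the spins, by at most \<open>N^(p-1)\<close>, so the exponent
  \<open>s \<Sum>\<^sub>i \<epsilon>\<^sub>i\<close> is at most \<open>N \<beta>\<^sup>2 \<bar>S/N\<bar>^p / p!\<close> plus a constant, while \<open>\<bar>S/N\<bar>\<close> exceeds \<open>x\<close> for fair spins
  with probability at most \<open>2 exp (- N I(x))\<close>. By the condition \<open>\<beta> < \<beta>\<^sub>f\<close> the second exponent wins
  for every \<open>x\<close>, so exponential moments are bounded (lemma \<open>spin_exp_moment\<close>). A second-order Taylor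
  expansion then gives \<open>E W\<^sup>2 = O(N^(2-p) (m\<^sup>2 N^(1/2) + N^(1-p/2)))\<close> (lemma \<open>overlap_estimate\<close>): the
  diagonal part of the quadratic term, of order \<open>N^(2-p)\<close> and thus as large as the variance of the
  quadratic statistic, cancels against the second-order term of the logarithm of \<open>1 + s \<epsilon>\<^sub>i\<close>.

  Convergence in distribution is obtained through characteristic functions, because the rows of
  the array live on unrelated probability spaces.
\<close>

section \<open>Elementary symmetric polynomials of signs\<close>

definition esym :: "'a set \<Rightarrow> nat \<Rightarrow> ('a \<Rightarrow> real) \<Rightarrow> real" where
  "esym F k x = (\<Sum>A | A \<subseteq> F \<and> card A = k. \<Prod>a\<in>A. x a)"

lemma esym_0:
  assumes "finite F"
  shows "esym F 0 x = 1"
proof -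
  have "A = {}" if "A \<subseteq> F" "card A = 0" for A
    using that assms finite_subset by fastforce
  then have "{A. A \<subseteq> F \<and> card A = 0} = {{}}" by auto
  then show ?thesis unfolding esym_def by (simp only: sum.insert sum.empty finite.emptyI) simp
qed

lemma esym_eq_0:
  assumes "finite F" "card F < k"
  shows "esym F k x = 0"
proof -
  have "{A. A \<subseteq> F \<and> card A = k} = {}"
    using card_mono[OF assms(1)] assms(2) by (auto simp: not_le[symmetric])
  then show ?thesis unfolding esym_def by (simp only: sum.empty)
qed

lemma esym_empty: "esym {} (Suc k) x = 0"
  by (rule esym_eq_0) simp_all

lemma esym_insert:
  assumes "finite F" "a \<notin> F"
  shows "esym (insert a F) (Suc k) x = esym F (Suc k) x + x a * esym F k x"
proof -
  let ?L = "{A. A \<subseteq> F \<and> card A = Suc k}" and ?R = "{A. A \<subseteq> F \<and> card A = k}"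
  have fin: "finite ?L" "finite ?R" using assms by auto
  have "{A. A \<subseteq> insert a F \<and> card A = Suc k} = ?L \<union> insert a ` ?R" (is "?X = ?Y")
  proof (intro equalityI subsetI)
    fix A assume A: "A \<in> ?X"
    then have "finite A" using assms by (auto intro: finite_subset)
    show "A \<in> ?Y"
    proof (cases "a \<in> A")
      case True
      then have "A = insert a (A - {a})" "card (A - {a}) = k" "A - {a} \<subseteq> F"
        using A \<open>finite A\<close> by auto
      then show ?thesis by blast
    next
      case False then show ?thesis using A by auto
    qed
  next
    fix A assume "A \<in> ?Y"
    then show "A \<in> ?X" using assms by (auto simp: card_insert_if finite_subset)
  qed
  moreover have "?L \<inter> insert a ` ?R = {}" using assms by auto
  moreover have "inj_on (insert a) ?R"
    using assms by (intro inj_onI) (auto simp: set_eq_iff)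
  moreover have "(\<Prod>b\<in>insert a A. x b) = x a * (\<Prod>b\<in>A. x b)" if "A \<in> ?R" for A
    using that assms by (subst prod.insert) (auto intro: finite_subset)
  ultimately show ?thesis
    using fin by (simp add: esym_def sum.union_disjoint sum.reindex sum_distrib_left)
qed

lemma esym_1: "finite F \<Longrightarrow> esym F (Suc 0) x = (\<Sum>a\<in>F. x a)"
  by (induction F rule: finite_induct) (simp_all add: esym_empty esym_insert esym_0)

text \<open>
  For signs, multiplying \<open>e\<^sub>k\<close> by the sum \<open>e\<^sub>1\<close> either adds an index to a subset or, because the
  squares are 1, removes one. This makes every \<open>e\<^sub>k\<close> a function of the sum, and the two bounds below
  follow from it by induction.
\<close>

lemma esym_recurrence:
  assumes "finite F" "\<And>a. a \<in> F \<Longrightarrow> (x a)\<^sup>2 = 1"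
  shows "(real k + 2) * esym F (Suc (Suc k)) x + (real (card F) - real k) * esym F k x
       = (\<Sum>a\<in>F. x a) * esym F (Suc k) x"
  using assms
proof (induction F arbitrary: k rule: finite_induct)
  case empty
  show ?case by (cases k) (simp_all add: esym_empty)
next
  case (insert a F)
  have sq: "x a * x a = 1" using insert.prems[of a] by (simp add: power2_eq_square)
  have IH: "(real k + 2) * esym F (Suc (Suc k)) x + (real (card F) - real k) * esym F k x
       = (\<Sum>a\<in>F. x a) * esym F (Suc k) x" for k
    using insert.IH[of k] insert.prems by auto
  show ?case
  proof (cases k)
    case 0
    have "(real k + 2) * esym (insert a F) (Suc (Suc k)) x
        + (real (card (insert a F)) - real k) * esym (insert a F) k x
      = 2 * esym F (Suc (Suc 0)) x + card F + 2 * x a * (\<Sum>a\<in>F. x a) + 1"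
      using insert.hyps 0 by (simp add: esym_insert esym_0 esym_1 algebra_simps)
    also have "\<dots> = (\<Sum>a\<in>F. x a) * (\<Sum>a\<in>F. x a) + 2 * x a * (\<Sum>a\<in>F. x a) + x a * x a"
      using IH[of 0] insert.hyps sq by (simp add: esym_0 esym_1)
    also have "\<dots> = (\<Sum>b\<in>insert a F. x b) * esym (insert a F) (Suc k) x"
      using insert.hyps 0 by (simp add: esym_insert esym_0 esym_1 algebra_simps)
    finally show ?thesis .
  next
    case (Suc j)
    have "(\<Sum>b\<in>insert a F. x b) * esym (insert a F) (Suc k) x
        = (\<Sum>a\<in>F. x a) * esym F (Suc k) x + x a * ((\<Sum>a\<in>F. x a) * esym F k x)
          + x a * esym F (Suc k) x + (x a * x a) * esym F k x"
      using insert.hyps by (simp add: esym_insert algebra_simps)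
    also have "\<dots> = (real k + 2) * esym F (Suc (Suc k)) x + (real (card F) - real k) * esym F k x
       + x a * ((real j + 2) * esym F (Suc k) x + (real (card F) - real j) * esym F j x)
          + x a * esym F (Suc k) x + esym F k x"
      using IH[of k] IH[of j] sq Suc by simp
    also have "\<dots> = (real k + 2) * esym (insert a F) (Suc (Suc k)) x
        + (real (card (insert a F)) - real k) * esym (insert a F) k x"
      using insert.hyps Suc by (simp add: esym_insert algebra_simps)
    finally show ?thesis by simp
  qed
qed

lemma esym_card_bound:
  assumes "finite F" "\<And>a. a \<in> F \<Longrightarrow> (x a)\<^sup>2 = 1"
  shows "\<bar>esym F k x\<bar> \<le> real (card F) ^ k"
proof -
  have ab: "\<bar>x a\<bar> = 1" if "a \<in> F" for a
    using assms(2)[OF that] by (simp add: abs_square_eq_1)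
  have "\<bar>esym F k x\<bar> \<le> (\<Sum>A | A \<subseteq> F \<and> card A = k. \<bar>\<Prod>a\<in>A. x a\<bar>)"
    unfolding esym_def by (rule sum_abs)
  also have "\<dots> = (\<Sum>A | A \<subseteq> F \<and> card A = k. 1)"
    by (intro sum.cong refl) (auto simp: abs_prod intro!: prod.neutral ab)
  also have "\<dots> = real (card F choose k)"
    using n_subsets[OF assms(1), of k] by simp
  also have "\<dots> \<le> real (card F ^ k)"
    unfolding of_nat_le_iff by (cases "k \<le> card F") (simp_all add: binomial_le_pow binomial_eq_0)
  finally show ?thesis by simp
qed

lemma abs_sum_signs_le:
  assumes "finite F" "\<And>a. a \<in> F \<Longrightarrow> (x a)\<^sup>2 = (1::real)"
  shows "\<bar>\<Sum>a\<in>F. x a\<bar> \<le> real (card F)"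
  using esym_card_bound[OF assms, where k=1] assms(1) by (simp add: esym_1)

text \<open>
  The error is one power of the number of variables smaller than the trivial bound on \<open>e\<^sub>k\<close>. This is
  what makes the correction to \<open>S^p / p!\<close> contribute only a bounded factor to the exponential moments.
\<close>

lemma esym_approx_power:
  assumes "finite F" "\<And>a. a \<in> F \<Longrightarrow> (x a)\<^sup>2 = 1"
  shows "\<bar>esym F (Suc k) x - (\<Sum>a\<in>F. x a) ^ Suc k / fact (Suc k)\<bar> \<le> real (card F) ^ k"
proof (induction k)
  case 0
  show ?case using assms(1) by (simp add: esym_1)
next
  case (Suc k)
  define S where "S = (\<Sum>a\<in>F. x a)"
  define n where "n = real (card F)"
  have S: "\<bar>S\<bar> \<le> n" unfolding S_def n_def by (rule abs_sum_signs_le[OF assms])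
  have n0: "0 \<le> n" by (simp add: n_def)
  let ?d = "esym F (Suc k) x - S ^ Suc k / fact (Suc k)"
  have rec: "(real k + 2) * esym F (Suc (Suc k)) x = S * esym F (Suc k) x - (n - real k) * esym F k x"
    using esym_recurrence[OF assms(1), where x=x and k=k] assms(2) by (simp add: S_def n_def)
  have f: "fact (Suc (Suc k)) = (real k + 2) * fact (Suc k)" by (simp add: algebra_simps)
  have "(real k + 2) * (esym F (Suc (Suc k)) x - S ^ Suc (Suc k) / fact (Suc (Suc k)))
      = S * ?d - (n - real k) * esym F k x"
  proof -
    have "(real k + 2) * (S ^ Suc (Suc k) / fact (Suc (Suc k))) = S * (S ^ Suc k / fact (Suc k))"
      unfolding f by (simp del: fact_Suc)
    then show ?thesis using rec by (simp only: right_diff_distrib)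
  qed
  then have "(real k + 2) * \<bar>esym F (Suc (Suc k)) x - S ^ Suc (Suc k) / fact (Suc (Suc k))\<bar>
      = \<bar>S * ?d - (n - real k) * esym F k x\<bar>"
    by (metis abs_mult abs_of_nonneg add_nonneg_nonneg of_nat_0_le_iff zero_le_numeral)
  also have "\<dots> \<le> \<bar>S\<bar> * \<bar>?d\<bar> + \<bar>n - real k\<bar> * \<bar>esym F k x\<bar>"
    by (metis abs_mult abs_triangle_ineq4)
  finally have tri: "(real k + 2) * \<bar>esym F (Suc (Suc k)) x - S ^ Suc (Suc k) / fact (Suc (Suc k))\<bar>
      \<le> \<bar>S\<bar> * \<bar>?d\<bar> + \<bar>n - real k\<bar> * \<bar>esym F k x\<bar>" .
  have t1: "\<bar>S\<bar> * \<bar>?d\<bar> \<le> n * n ^ k"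
    using Suc.IH S n0 by (intro mult_mono) (auto simp: S_def n_def)
  have t2: "\<bar>n - real k\<bar> * \<bar>esym F k x\<bar> \<le> n * n ^ k"
  proof (cases "k \<le> card F")
    case True
    then show ?thesis using esym_card_bound[OF assms, where k=k] n0
      by (intro mult_mono) (auto simp: n_def)
  next
    case False
    then have "esym F k x = 0" using assms(1) by (intro esym_eq_0) auto
    then show ?thesis using n0 by simp
  qed
  have t3: "n * n ^ k + n * n ^ k \<le> (real k + 2) * n ^ Suc k"
    using n0 by (simp add: algebra_simps)
  have "(real k + 2) * \<bar>esym F (Suc (Suc k)) x - S ^ Suc (Suc k) / fact (Suc (Suc k))\<bar>
      \<le> (real k + 2) * n ^ Suc k"
    using tri t1 t2 t3 by linarith
  then have "\<bar>esym F (Suc (Suc k)) x - S ^ Suc (Suc k) / fact (Suc (Suc k))\<bar> \<le> n ^ Suc k"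
    by (subst (asm) mult_le_cancel_left_pos) auto
  then show ?case unfolding S_def n_def .
qed

text \<open>
  On the scale \<open>S = O(\<surd>n)\<close> of typical fluctuations \<open>e\<^sub>k\<close> is of order \<open>\<surd>n ^ k\<close>, far below \<open>n ^ k\<close>.
\<close>

lemma esym_growth:
  assumes "finite F" "\<And>a. a \<in> F \<Longrightarrow> (x a)\<^sup>2 = 1"
  defines "B \<equiv> sqrt (card F) + \<bar>\<Sum>a\<in>F. x a\<bar>"
  shows "\<bar>esym F k x\<bar> \<le> B ^ k"
proof (induction k rule: less_induct)
  case (less k)
  define S where "S = (\<Sum>a\<in>F. x a)"
  define n where "n = real (card F)"
  have B0: "0 \<le> B" "\<bar>S\<bar> \<le> B" by (auto simp: B_def S_def)
  have "sqrt n \<le> B" by (auto simp: B_def n_def)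
  then have "(sqrt n)\<^sup>2 \<le> B\<^sup>2" by (intro power_mono) (auto simp: n_def)
  then have nB: "n \<le> B\<^sup>2" by (simp add: n_def)
  consider "k = 0" | "k = Suc 0" | j where "k = Suc (Suc j)"
    by (metis not0_implies_Suc)
  then show ?case
  proof cases
    case 1
    then show ?thesis using assms(1) by (simp add: esym_0)
  next
    case 2
    then show ?thesis using assms(1) B0 by (simp add: esym_1 S_def)
  next
    case 3
    have rec: "(real j + 2) * esym F k x = S * esym F (Suc j) x - (n - real j) * esym F j x"
      using esym_recurrence[OF assms(1), where x=x and k=j] assms(2) 3 by (simp add: S_def n_def)
    have "(real j + 2) * \<bar>esym F k x\<bar> = \<bar>S * esym F (Suc j) x - (n - real j) * esym F j x\<bar>"
      unfolding rec[symmetric] by (simp add: abs_mult)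
    also have "\<dots> \<le> \<bar>S\<bar> * \<bar>esym F (Suc j) x\<bar> + \<bar>n - real j\<bar> * \<bar>esym F j x\<bar>"
      by (metis abs_mult abs_triangle_ineq4)
    finally have tri: "(real j + 2) * \<bar>esym F k x\<bar>
      \<le> \<bar>S\<bar> * \<bar>esym F (Suc j) x\<bar> + \<bar>n - real j\<bar> * \<bar>esym F j x\<bar>" .
    have t1: "\<bar>S\<bar> * \<bar>esym F (Suc j) x\<bar> \<le> B * B ^ Suc j"
      using less[of "Suc j"] 3 B0 by (intro mult_mono) auto
    have t2: "\<bar>n - real j\<bar> * \<bar>esym F j x\<bar> \<le> B\<^sup>2 * B ^ j"
    proof (cases "j \<le> card F")
      case True
      then show ?thesis using less[of j] 3 nB
        by (intro mult_mono) (auto simp: n_def)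
    next
      case False
      then have "esym F j x = 0" using assms(1) by (intro esym_eq_0) auto
      then show ?thesis using B0 by simp
    qed
    have t3: "B * B ^ Suc j + B\<^sup>2 * B ^ j = 2 * B ^ k"
      by (simp add: 3 power2_eq_square)
    have t4: "2 * B ^ k \<le> (real j + 2) * B ^ k"
      using B0 by (intro mult_right_mono) auto
    have "(real j + 2) * \<bar>esym F k x\<bar> \<le> (real j + 2) * B ^ k"
      using tri t1 t2 t3 t4 by linarith
    then show ?thesis by (subst (asm) mult_le_cancel_left_pos) auto
  qed
qed

section \<open>Index tuples and spin configurations\<close>

lemma bij_betw_index_tuples:
  "bij_betw set (index_tuples N p) {A. A \<subseteq> {1..N} \<and> card A = p}"
proof (rule bij_betw_byWitness[where f' = sorted_list_of_set])
  show "\<forall>is\<in>index_tuples N p. sorted_list_of_set (set is) = is"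
    by (auto simp: index_tuples_def strict_sorted_iff sorted_list_of_set_sort_remdups distinct_remdups_id sort_key_id_if_sorted)
  show "\<forall>A\<in>{A. A \<subseteq> {1..N} \<and> card A = p}. set (sorted_list_of_set A) = A"
    by (auto simp: finite_subset[OF _ finite_atLeastAtMost])
  show "set ` index_tuples N p \<subseteq> {A. A \<subseteq> {1..N} \<and> card A = p}"
    by (auto simp: index_tuples_def strict_sorted_iff distinct_card)
  show "sorted_list_of_set ` {A. A \<subseteq> {1..N} \<and> card A = p} \<subseteq> index_tuples N p"
  proof safe
    fix A assume A: "A \<subseteq> {1..N}" "p = card A"
    have "finite A" using A(1) by (rule finite_subset) simp
    then show "sorted_list_of_set A \<in> index_tuples N (card A)"
      using A(1) by (simp add: index_tuples_def)
  qed
qed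

lemma finite_index_tuples: "finite (index_tuples N p)"
proof -
  have "finite {A. A \<subseteq> {1..N} \<and> card A = p}" by simp
  then show ?thesis using bij_betw_finite[OF bij_betw_index_tuples[of N p]] by simp
qed

lemma card_index_tuples: "card (index_tuples N p) = N choose p"
  using bij_betw_same_card[OF bij_betw_index_tuples[of N p]] n_subsets[of "{1..N}" p] by simp

lemma spin_product_set:
  assumes "is \<in> index_tuples N p"
  shows "spin_product \<sigma> is = (\<Prod>k\<in>set is. \<sigma> k)"
proof -
  have "distinct is" using assms by (auto simp: index_tuples_def strict_sorted_iff)
  then have "(\<Prod>k\<in>set is. \<sigma> k) = prod_list (map \<sigma> is)"
    by (simp add: prod.distinct_set_conv_list)
  also have "\<dots> = (\<Prod>j<length is. \<sigma> (is ! j))"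
    by (subst prod.list_conv_set_nth) (simp add: lessThan_atLeast0)
  finally show ?thesis by (simp add: spin_product_def)
qed

lemma sum_spin_product:
  "(\<Sum>is\<in>index_tuples N p. spin_product \<sigma> is) = esym {1..N} p \<sigma>"
proof -
  have "(\<Sum>is\<in>index_tuples N p. spin_product \<sigma> is)
      = (\<Sum>is\<in>index_tuples N p. \<Prod>k\<in>set is. \<sigma> k)"
    by (rule sum.cong) (auto intro: spin_product_set)
  also have "\<dots> = esym {1..N} p \<sigma>"
    unfolding esym_def by (rule sum.reindex_bij_betw[OF bij_betw_index_tuples])
  finally show ?thesis .
qed

lemma finite_spin_configs: "finite (spin_configs N)"
  unfolding spin_configs_def by (intro finite_PiE) auto

lemma spin_values: "\<sigma> \<in> spin_configs N \<Longrightarrow> k \<in> {1..N} \<Longrightarrow> \<sigma> k = -1 \<or> \<sigma> k = 1"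
  unfolding spin_configs_def using PiE_mem[of \<sigma> "{1..N}" "\<lambda>_. {-1, 1}" k] by simp

lemma spin_square: "\<sigma> \<in> spin_configs N \<Longrightarrow> k \<in> {1..N} \<Longrightarrow> (\<sigma> k)\<^sup>2 = 1"
  by (metis power2_eq_1_iff spin_values)

lemma spin_product_values:
  assumes "\<sigma> \<in> spin_configs N" "is \<in> index_tuples N p"
  shows "spin_product \<sigma> is = -1 \<or> spin_product \<sigma> is = 1"
proof -
  have "(spin_product \<sigma> is)\<^sup>2 = (\<Prod>k\<in>set is. (\<sigma> k)\<^sup>2)"
    using assms by (simp add: spin_product_set prod_power_distrib)
  also have "\<dots> = 1"
    using assms by (intro prod.neutral) (auto simp: index_tuples_def intro!: spin_square[of \<sigma> N])
  finally show ?thesis by (auto simp: power2_eq_1_iff)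
qed

text \<open>
  The independence of the spins under any product weight: all averages over configurations below
  reduce to this identity.
\<close>

lemma sum_spin_configs_prod:
  "(\<Sum>\<sigma>\<in>spin_configs N. \<Prod>k\<in>{1..N}. f k (\<sigma> k)) = (\<Prod>k\<in>{1..N}. f k (-1) + f k (1::real))"
  for f :: "nat \<Rightarrow> real \<Rightarrow> 'c::comm_semiring_1"
proof -
  have "(\<Prod>k\<in>{1..N}. \<Sum>y\<in>{-1,1::real}. f k y) = (\<Sum>\<sigma>\<in>spin_configs N. \<Prod>k\<in>{1..N}. f k (\<sigma> k))"
    unfolding spin_configs_def by (rule prod_sum_PiE) auto
  then show ?thesis by simp
qed

section \<open>Exponential moments of the magnetisation\<close>

definition spin_avg :: "nat \<Rightarrow> ((nat \<Rightarrow> real) \<Rightarrow> real) \<Rightarrow> real" where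
  "spin_avg N f = (\<Sum>\<sigma>\<in>spin_configs N. f \<sigma>) / 2 ^ N"

lemma spin_avg_mono:
  "(\<And>\<sigma>. \<sigma> \<in> spin_configs N \<Longrightarrow> f \<sigma> \<le> g \<sigma>) \<Longrightarrow> spin_avg N f \<le> spin_avg N g"
  unfolding spin_avg_def by (intro divide_right_mono sum_mono) auto

lemma spin_avg_cong:
  "(\<And>\<sigma>. \<sigma> \<in> spin_configs N \<Longrightarrow> f \<sigma> = g \<sigma>) \<Longrightarrow> spin_avg N f = spin_avg N g"
  unfolding spin_avg_def by (intro arg_cong2[where f="(/)"] sum.cong) auto

lemma spin_avg_add: "spin_avg N (\<lambda>\<sigma>. f \<sigma> + g \<sigma>) = spin_avg N f + spin_avg N g"
  unfolding spin_avg_def by (simp add: sum.distrib add_divide_distrib)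

lemma spin_avg_diff: "spin_avg N (\<lambda>\<sigma>. f \<sigma> - g \<sigma>) = spin_avg N f - spin_avg N g"
  unfolding spin_avg_def by (simp add: sum_subtractf diff_divide_distrib)

lemma spin_avg_cmult: "spin_avg N (\<lambda>\<sigma>. c * f \<sigma>) = c * spin_avg N f"
  unfolding spin_avg_def by (simp add: sum_distrib_left[symmetric])

lemma spin_avg_sum: "spin_avg N (\<lambda>\<sigma>. \<Sum>i\<in>I. f i \<sigma>) = (\<Sum>i\<in>I. spin_avg N (f i))"
  unfolding spin_avg_def by (subst sum.swap) (simp add: sum_divide_distrib)

lemma spin_avg_nonneg:
  "(\<And>\<sigma>. \<sigma> \<in> spin_configs N \<Longrightarrow> 0 \<le> f \<sigma>) \<Longrightarrow> 0 \<le> spin_avg N f"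
  unfolding spin_avg_def by (intro divide_nonneg_nonneg sum_nonneg) auto

lemma spin_avg_prod:
  "spin_avg N (\<lambda>\<sigma>. \<Prod>k\<in>{1..N}. f k (\<sigma> k)) = (\<Prod>k\<in>{1..N}. (f k (-1) + f k 1) / 2)"
  unfolding spin_avg_def sum_spin_configs_prod by (simp add: prod_dividef)

lemma spin_avg_const: "spin_avg N (\<lambda>\<sigma>. c) = c"
  using spin_avg_cmult[of N c "\<lambda>_. 1"] spin_avg_prod[of N "\<lambda>_ _. 1"] by simp

lemma spin_avg_flip: "spin_avg N (\<lambda>\<sigma>. f (\<Sum>k\<in>{1..N}. - \<sigma> k)) = spin_avg N (\<lambda>\<sigma>. f (\<Sum>k\<in>{1..N}. \<sigma> k))"
proof -
  \<comment> \<open>Configurations are undefined outside \<open>{1..N}\<close>, so the flip must not touch those sites.\<close>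
  define T where "T \<sigma> = (\<lambda>k. if k \<in> {1..N} then - \<sigma> k else undefined :: real)" for \<sigma> :: "nat \<Rightarrow> real"
  have T: "T \<sigma> \<in> spin_configs N" "T (T \<sigma>) = \<sigma>" if "\<sigma> \<in> spin_configs N" for \<sigma>
    using that unfolding spin_configs_def T_def by (auto simp: PiE_iff extensional_def fun_eq_iff)
  have "(\<Sum>\<sigma>\<in>spin_configs N. f (\<Sum>k\<in>{1..N}. - \<sigma> k)) = (\<Sum>\<sigma>\<in>spin_configs N. f (\<Sum>k\<in>{1..N}. \<sigma> k))"
    by (rule sum.reindex_bij_witness[where i=T and j=T]) (auto simp: T, simp add: T_def)
  then show ?thesis by (simp add: spin_avg_def)
qed

text \<open>
  The second derivative \<open>1 / (1 - x\<^sup>2)\<close> of the entropy is at least 1, and value and slope vanish at 0.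
\<close>

lemma entropy_ge_square:
  assumes "0 \<le> x" "x < 1"
  shows "x\<^sup>2 / 2 \<le> entropy_I x"
proof -
  have A: "y \<le> (ln (1 + y) - ln (1 - y)) / 2" if "0 \<le> y" "y < 1" for y :: real
  proof -
    have "(ln (1 + 0) - ln (1 - 0)) / 2 - 0 \<le> (ln (1 + y) - ln (1 - y)) / 2 - y"
    proof (rule DERIV_nonneg_imp_nondecreasing[OF that(1)])
      fix z assume "0 \<le> z" "z \<le> y"
      then have z: "0 \<le> z" "z < 1" using that by auto
      have "((\<lambda>y. (ln (1 + y) - ln (1 - y)) / 2 - y) has_real_derivative
         (1 / (1 + z) + 1 / (1 - z)) / 2 - 1) (at z)"
        using z by (auto intro!: derivative_eq_intros)
      moreover have "(1 / (1 + z) + 1 / (1 - z)) / 2 - 1 = z\<^sup>2 / ((1 + z) * (1 - z))"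
      proof -
        have "1 / (1 + z) + 1 / (1 - z) = 2 / ((1 + z) * (1 - z))"
          using z by (subst add_divide_eq_iff) (auto simp: field_simps)
        moreover have "1 = ((1 + z) * (1 - z)) / ((1 + z) * (1 - z))" using z by simp
        ultimately have "(1 / (1 + z) + 1 / (1 - z)) / 2 - 1
            = 1 / ((1 + z) * (1 - z)) - ((1 + z) * (1 - z)) / ((1 + z) * (1 - z))" by simp
        also have "\<dots> = (1 - (1 + z) * (1 - z)) / ((1 + z) * (1 - z))"
          by (rule diff_divide_distrib[symmetric])
        finally show ?thesis by (simp add: algebra_simps power2_eq_square)
      qed
      moreover have "0 \<le> z\<^sup>2 / ((1 + z) * (1 - z))" using z by simp
      ultimately show "\<exists>d. ((\<lambda>y. (ln (1 + y) - ln (1 - y)) / 2 - y) has_real_derivative d) (at z) \<and> 0 \<le> d"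
        by (intro exI[of _ "(1 / (1 + z) + 1 / (1 - z)) / 2 - 1"] conjI) (simp_all only:)
    qed
    then show ?thesis by simp
  qed
  have "entropy_I 0 - 0\<^sup>2 / 2 \<le> entropy_I x - x\<^sup>2 / 2"
  proof (rule DERIV_nonneg_imp_nondecreasing[OF assms(1)])
    fix z assume "0 \<le> z" "z \<le> x"
    then have z: "0 \<le> z" "z < 1" using assms by auto
    have nz: "1 + z \<noteq> 0" "1 - z \<noteq> 0" "0 < 1 + z" "0 < 1 - z" using z by auto
    have D: "((\<lambda>x. (1 + x) * ln (1 + x) / 2) has_real_derivative (ln (1 + z) + 1) / 2) (at z)"
      "((\<lambda>x. (1 - x) * ln (1 - x) / 2) has_real_derivative (- ln (1 - z) - 1) / 2) (at z)"
      using nz by (auto intro!: derivative_eq_intros)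
    have "((\<lambda>x. (1 + x) * ln (1 + x) / 2 + (1 - x) * ln (1 - x) / 2 - x\<^sup>2 / 2) has_real_derivative
        (ln (1 + z) + 1) / 2 + (- ln (1 - z) - 1) / 2 - z) (at z)"
      by (intro DERIV_diff DERIV_add D) (auto intro!: derivative_eq_intros)
    moreover have "entropy_I x = (1 + x) * ln (1 + x) / 2 + (1 - x) * ln (1 - x) / 2" for x
      by (simp add: entropy_I_def field_simps)
    moreover have "(ln (1 + z) + 1) / 2 + (- ln (1 - z) - 1) / 2 - z = (ln (1 + z) - ln (1 - z)) / 2 - z"
      by (simp add: field_simps)
    ultimately have "((\<lambda>x. entropy_I x - x\<^sup>2 / 2) has_real_derivative (ln (1 + z) - ln (1 - z)) / 2 - z) (at z)"
      by (simp only:)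
    then show "\<exists>d. ((\<lambda>x. entropy_I x - x\<^sup>2 / 2) has_real_derivative d) (at z) \<and> 0 \<le> d"
      using A[OF z] by (intro exI conjI) auto
  qed
  then show ?thesis by (simp add: entropy_I_def)
qed

text \<open>
  Cramer's bound for the sum of fair signs; the tilt \<open>artanh x\<close> is optimal and turns the bound into
  the entropy exactly.
\<close>

lemma chernoff_upper:
  assumes x: "0 < x" "x < 1"
  shows "spin_avg N (\<lambda>\<sigma>. of_bool (real N * x \<le> (\<Sum>k\<in>{1..N}. \<sigma> k))) \<le> exp (- real N * entropy_I x)"
proof -
  \<comment> \<open>The tilt \<open>l = a - c\<close> defined below is \<open>artanh x\<close>.\<close>
  define a c where "a = ln (1 + x) / 2" and "c = ln (1 - x) / 2"
  have ea: "exp (2 * a) = 1 + x" "exp (2 * c) = 1 - x" using x by (auto simp: a_def c_def)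
  define l where "l = a - c"
  have l: "0 < l" using x by (simp add: l_def a_def c_def)
  have "exp (-l) + exp l = (exp (2 * a) + exp (2 * c)) * exp (- a - c)"
    by (simp add: l_def distrib_right exp_add[symmetric])
  also have "\<dots> = 2 * exp (- a - c)" by (simp add: ea)
  finally have cosh: "(exp (-l) + exp l) / 2 = exp (- a - c)" by simp
  have "spin_avg N (\<lambda>\<sigma>. of_bool (real N * x \<le> (\<Sum>k\<in>{1..N}. \<sigma> k)))
      \<le> spin_avg N (\<lambda>\<sigma>. \<Prod>k\<in>{1..N}. exp (l * (\<sigma> k - x)))"
  proof (rule spin_avg_mono)
    fix \<sigma>
    have "(\<Prod>k\<in>{1..N}. exp (l * (\<sigma> k - x))) = exp (l * ((\<Sum>k\<in>{1..N}. \<sigma> k) - real N * x))"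
      by (subst exp_sum[symmetric]) (auto simp: sum_distrib_left[symmetric] sum_subtractf)
    then show "of_bool (real N * x \<le> (\<Sum>k\<in>{1..N}. \<sigma> k)) \<le> (\<Prod>k\<in>{1..N}. exp (l * (\<sigma> k - x)))"
      using l by (auto simp: of_bool_def)
  qed
  also have "\<dots> = (\<Prod>k\<in>{1..N}. (exp (l * (-1 - x)) + exp (l * (1 - x))) / 2)"
    by (rule spin_avg_prod)
  also have "(exp (l * (-1 - x)) + exp (l * (1 - x))) / 2 = (exp (- l) + exp l) / 2 * exp (- l * x)"
    by (simp add: exp_add[symmetric] algebra_simps)
  also have "\<dots> = exp (- a - c - l * x)" unfolding cosh by (simp add: exp_add[symmetric])
  also have "- a - c - l * x = - entropy_I x"
    by (simp add: l_def a_def c_def entropy_I_def field_simps)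
  also have "(\<Prod>k\<in>{1..N}. exp (- entropy_I x)) = exp (- real N * entropy_I x)"
    by (simp add: exp_of_nat_mult[symmetric])
  finally show ?thesis .
qed

lemma chernoff_abs:
  assumes x: "0 < x" "x < 1"
  shows "spin_avg N (\<lambda>\<sigma>. of_bool (real N * x \<le> \<bar>\<Sum>k\<in>{1..N}. \<sigma> k\<bar>)) \<le> 2 * exp (- real N * entropy_I x)"
proof -
  let ?a = "\<lambda>\<sigma>. of_bool (real N * x \<le> \<bar>\<Sum>k\<in>{1..N}. \<sigma> k\<bar>) :: real"
    and ?p = "\<lambda>\<sigma>. of_bool (real N * x \<le> (\<Sum>k\<in>{1..N}. \<sigma> k)) :: real"
  have "spin_avg N ?a
     \<le> spin_avg N (\<lambda>\<sigma>. of_bool (real N * x \<le> (\<Sum>k\<in>{1..N}. \<sigma> k)) + of_bool (real N * x \<le> (\<Sum>k\<in>{1..N}. - \<sigma> k)))"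
    by (rule spin_avg_mono) (auto simp: of_bool_def sum_negf abs_if)
  also have "\<dots> = 2 * spin_avg N ?p"
    unfolding spin_avg_add spin_avg_flip[where f="\<lambda>s. of_bool (real N * x \<le> s)"] by simp
  finally show ?thesis using chernoff_upper[OF x, of N] by linarith
qed

text \<open>
  The quadratic surplus is what makes the exponential moments of \<open>S / \<surd>N\<close> summable later on. It
  exists because \<open>\<beta>\<^sup>2\<close> is a fixed fraction below \<open>\<beta>\<^sub>f\<^sup>2\<close> and the entropy dominates \<open>x\<^sup>2 / 2\<close>.
\<close>

lemma beta_f_gap:
  assumes "0 < \<beta>" "\<beta> < beta_f p"
  obtains d where "0 < d" "\<And>x. 0 < x \<Longrightarrow> x < 1 \<Longrightarrow> \<beta>\<^sup>2 / fact p * x ^ p + d * x\<^sup>2 \<le> entropy_I x"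
proof -
  \<comment> \<open>Half of the relative gap: the factor 2 pays for the loss in \<open>I(x) \<ge> x\<^sup>2 / 2\<close>.\<close>
  define d where "d = (1 - \<beta>\<^sup>2 / (beta_f p)\<^sup>2) / 2"
  have bf: "0 < beta_f p" using assms by simp
  have "\<beta>\<^sup>2 < (beta_f p)\<^sup>2" using assms by (intro power_strict_mono) auto
  then have d: "0 < d" using bf by (simp add: d_def)
  moreover have "\<beta>\<^sup>2 / fact p * x ^ p + d * x\<^sup>2 \<le> entropy_I x" if x: "0 < x" "x < 1" for x
  proof -
    have Ipos: "0 \<le> entropy_I y" if "0 < y" "y < 1" for y
      using entropy_ge_square[of y] that by (smt (verit) zero_le_power2 divide_nonneg_pos)
    have "bdd_below ((\<lambda>x. sqrt (fact p * entropy_I x / x ^ p)) ` {0<..<1})"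
      by (rule bdd_belowI[of _ 0]) (auto intro!: divide_nonneg_pos mult_nonneg_nonneg Ipos)
    then have "beta_f p \<le> sqrt (fact p * entropy_I x / x ^ p)"
      unfolding beta_f_def using x by (intro cINF_lower) auto
    then have "(beta_f p)\<^sup>2 \<le> (sqrt (fact p * entropy_I x / x ^ p))\<^sup>2"
      using bf by (intro power_mono) auto
    also have "\<dots> = fact p * entropy_I x / x ^ p"
      using x Ipos[OF x] by simp
    finally have "(beta_f p)\<^sup>2 * x ^ p / fact p \<le> entropy_I x"
      using x by (simp add: field_simps)
    then have "\<beta>\<^sup>2 / (beta_f p)\<^sup>2 * ((beta_f p)\<^sup>2 * x ^ p / fact p) \<le> \<beta>\<^sup>2 / (beta_f p)\<^sup>2 * entropy_I x"
      by (intro mult_left_mono) auto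
    then have 1: "\<beta>\<^sup>2 / fact p * x ^ p \<le> (1 - 2 * d) * entropy_I x"
      using bf by (simp add: d_def field_simps)
    have "d * (x\<^sup>2 / 2) \<le> d * entropy_I x"
      using entropy_ge_square[of x] x d by (intro mult_left_mono) auto
    then show ?thesis using 1 by (simp add: algebra_simps)
  qed
  ultimately show thesis by (rule that)
qed

text \<open>
  Everything that the high-temperature condition contributes to the proof. The closed interval
  matters because the magnetisation attains \<open>\<plusminus>1\<close>; the endpoint is reached by continuity of the bound.
\<close>

lemma spin_tail:
  assumes "0 < \<beta>" "\<beta> < beta_f p" "1 \<le> p"
  obtains d where "0 < d"
    "\<And>N x. 0 \<le> x \<Longrightarrow> x \<le> 1 \<Longrightarrow>
      spin_avg N (\<lambda>\<sigma>. of_bool (real N * x \<le> \<bar>\<Sum>k\<in>{1..N}. \<sigma> k\<bar>))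
        \<le> 2 * exp (- real N * (\<beta>\<^sup>2 / fact p * x ^ p + d * x\<^sup>2))"
proof -
  obtain d where d: "0 < d"
    "\<And>x. 0 < x \<Longrightarrow> x < 1 \<Longrightarrow> \<beta>\<^sup>2 / fact p * x ^ p + d * x\<^sup>2 \<le> entropy_I x"
    using beta_f_gap[OF assms(1,2)] by blast
  let ?P = "\<lambda>N x. spin_avg N (\<lambda>\<sigma>. of_bool (real N * x \<le> \<bar>\<Sum>k\<in>{1..N}. \<sigma> k\<bar>))"
  let ?E = "\<lambda>N x. 2 * exp (- real N * (\<beta>\<^sup>2 / fact p * x ^ p + d * x\<^sup>2))"
  have inner: "?P N x \<le> ?E N x" if "0 < x" "x < 1" for N x
  proof -
    have "2 * exp (- real N * entropy_I x) \<le> ?E N x"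
      using d(2)[OF that] by (simp add: mult_left_mono)
    then show ?thesis using chernoff_abs[OF that, of N] by linarith
  qed
  have one: "?P N x \<le> 1" for N x
    using spin_avg_mono[of N "\<lambda>\<sigma>. of_bool (real N * x \<le> \<bar>\<Sum>k\<in>{1..N}. \<sigma> k\<bar>)" "\<lambda>_. 1"]
    by (simp add: spin_avg_const)
  have lim: "?P N x \<le> ?E N x" if x: "0 < x" "x \<le> 1" for N x
  proof -
    define y where "y = (\<lambda>n::nat. x * (1 - 1 / (real n + 2)))"
    have y: "0 < y n" "y n < 1" "y n \<le> x" for n
    proof -
      define w where "w = 1 - 1 / (real n + 2)"
      have w: "0 < w" "w < 1" by (auto simp: w_def field_simps)
      have "x * w \<le> 1 * w" "x * w \<le> x * 1" "0 < x * w"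
        using x w by (intro mult_right_mono mult_left_mono mult_pos_pos; simp)+
      then show "0 < y n" "y n < 1" "y n \<le> x" using w(2) by (auto simp: y_def w_def[symmetric])
    qed
    have "y \<longlonglongrightarrow> x" unfolding y_def by real_asymp
    then have "(\<lambda>n. ?E N (y n)) \<longlonglongrightarrow> ?E N x" by (intro tendsto_intros)
    moreover have "?P N x \<le> ?E N (y n)" for n
    proof -
      have "real N * y n \<le> real N * x" using y(3) by (intro mult_left_mono) auto
      then have "?P N x \<le> ?P N (y n)"
        by (intro spin_avg_mono) (auto simp: of_bool_def)
      then show ?thesis using inner[OF y(1)[of n] y(2), of N] by linarith
    qed
    ultimately show ?thesis by (intro LIMSEQ_le_const[where X="\<lambda>n. ?E N (y n)"]) blast+
  qed
  have "?P N x \<le> ?E N x" if "0 \<le> x" "x \<le> 1" for N x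
  proof (cases "x = 0")
    case True
    have "?P N x \<le> 1" by (rule one)
    moreover have "?E N x \<ge> 1" using True assms(3) by (simp add: power_0_left)
    ultimately show ?thesis by linarith
  next
    case False then show ?thesis using lim that by simp
  qed
  then show thesis using that d(1) by blast
qed

lemma power_Suc_diff_le:
  fixes x r :: real
  assumes "0 \<le> x" "x \<le> r"
  shows "r ^ Suc n - x ^ Suc n \<le> (real n + 1) * (r - x) * r ^ n"
proof (induction n)
  case (Suc n)
  have "r ^ Suc (Suc n) - x ^ Suc (Suc n) = r * (r ^ Suc n - x ^ Suc n) + (r - x) * x ^ Suc n"
    by (simp add: algebra_simps)
  moreover have "r * (r ^ Suc n - x ^ Suc n) \<le> r * ((real n + 1) * (r - x) * r ^ n)"
    using Suc assms by (intro mult_left_mono) auto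
  moreover have "(r - x) * x ^ Suc n \<le> (r - x) * r ^ Suc n"
    using assms by (intro mult_left_mono power_mono) auto
  ultimately show ?case by (simp add: algebra_simps)
qed simp

text \<open>
  Below \<open>\<beta>\<^sub>f\<close> the exponent \<open>\<beta>\<^sup>2 \<bar>S\<bar>^p / (p! N^(p-1))\<close> of the second moment is absorbed by the large
  deviation bound, with room for any exponential of \<open>S / \<surd>N\<close>. The magnetisation is cut into bins of
  width \<open>\<surd>N\<close> and the tail bound is applied at the left end of each bin. Within a bin the exponent
  varies by at most a multiple of the bin number, which the Gaussian surplus of \<open>spin_tail\<close>
  outweighs. Working with tails instead of the probabilities of single values of \<open>S\<close> loses no power
  of \<open>N\<close>.
\<close>

lemma spin_exp_moment:
  assumes \<beta>: "0 < \<beta>" "\<beta> < beta_f p" and p: "2 \<le> p" and C: "0 \<le> C"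
  obtains K where "\<And>N. 1 \<le> N \<Longrightarrow>
    spin_avg N (\<lambda>\<sigma>. exp (C * (\<bar>\<Sum>k\<in>{1..N}. \<sigma> k\<bar> / sqrt N)
        + \<beta>\<^sup>2 / fact p * (\<bar>\<Sum>k\<in>{1..N}. \<sigma> k\<bar> ^ p / real N ^ (p - 1)))) \<le> K"
proof -
  obtain d where d: "0 < d"
    "\<And>N x. 0 \<le> x \<Longrightarrow> x \<le> 1 \<Longrightarrow>
      spin_avg N (\<lambda>\<sigma>. of_bool (real N * x \<le> \<bar>\<Sum>k\<in>{1..N}. \<sigma> k\<bar>))
        \<le> 2 * exp (- real N * (\<beta>\<^sup>2 / fact p * x ^ p + d * x\<^sup>2))"
    by (rule spin_tail[OF \<beta>]) (use p in auto)
  define b where "b = \<beta>\<^sup>2 / fact p"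
  have b: "0 \<le> b" by (simp add: b_def)
  define c where "c = C + b * real p"
  \<comment> \<open>Maximising \<open>(c + 1) k - d k\<^sup>2\<close> over \<open>k\<close> leaves a geometric series of ratio \<open>exp (-1)\<close>.\<close>
  define K where "K = 2 * exp (c + (c + 1)\<^sup>2 / (4 * d)) * (1 / (1 - exp (-1)))"
  show thesis
  proof (rule that[of K])
    fix N :: nat assume N: "1 \<le> N"
    define q where "q = sqrt N"
    have q: "1 \<le> q" "q * q = real N" using N by (auto simp: q_def)
    \<comment> \<open>Bins beyond \<open>q = \<surd>N\<close> are empty because \<open>\<bar>S\<bar> \<le> N\<close>.\<close>
    define B where "B = {k. k \<le> N \<and> real k \<le> q}"
    have "finite B" by (simp add: B_def)
    define S where "S \<sigma> = \<bar>\<Sum>k\<in>{1..N}. \<sigma> k :: real\<bar>" for \<sigma>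
    define E where "E k = exp (c * (real k + 1) + b * (real N * (real k / q) ^ p))" for k :: nat
    let ?f = "\<lambda>\<sigma>. exp (C * (S \<sigma> / q) + b * (S \<sigma> ^ p / real N ^ (p - 1)))"
      and ?i = "\<lambda>k \<sigma>. of_bool (real N * (real k / q) \<le> S \<sigma>) :: real"
      and ?K = "c + (c + 1)\<^sup>2 / (4 * d)"
    have pw: "?f \<sigma>
       \<le> (\<Sum>k\<in>B. E k * ?i k \<sigma>)"
      if \<sigma>: "\<sigma> \<in> spin_configs N" for \<sigma>
    proof -
      define u where "u = S \<sigma> / q"
      define r where "r = u / q"
      define k where "k = nat \<lfloor>u\<rfloor>"
      define x where "x = real k / q"
      have "S \<sigma> \<le> real N" unfolding S_def
        using abs_sum_signs_le[of "{1..N}" \<sigma>] spin_square[OF \<sigma>] by simp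
      then have u: "0 \<le> u" "u \<le> q"
        using q by (auto simp: u_def S_def divide_le_eq)
      have k: "real k \<le> u" "u < real k + 1"
        using u unfolding k_def by (auto simp: of_nat_nat)
      have r: "0 \<le> r" "r \<le> 1" "x \<le> r" "r - x \<le> 1 / q" "0 \<le> x" "q * r = u"
        using u k q by (auto simp: r_def x_def divide_right_mono diff_divide_distrib[symmetric])
      have "real k \<le> real N" using k u q(1) mult_left_mono[of 1 q q] unfolding q(2) by linarith
      then have kB: "k \<in> B" using k u by (auto simp: B_def)
      obtain m where m: "p = Suc (Suc m)" using p by (metis add_2_eq_Suc le_Suc_ex)
      have "S \<sigma> = q * u" using q by (simp add: u_def)
      then have S: "S \<sigma> = real N * r" using q r(6) by (simp add: mult.assoc flip: q(2))
      have SN: "S \<sigma> ^ p / real N ^ (p - 1) = real N * r ^ p"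
        unfolding S power_mult_distrib using N by (simp add: m)
      have "r ^ p - x ^ p \<le> real p * (r - x) * r ^ Suc m"
        using power_Suc_diff_le[OF r(5,3), of "Suc m"] by (simp add: m add.commute)
      also have "\<dots> \<le> real p * (1 / q) * (r * 1)"
        using r power_le_one[of r m] q(1) unfolding power_Suc
        by (intro mult_mono) (auto intro!: mult_nonneg_nonneg)
      finally have "q * q * (r ^ p - x ^ p) \<le> q * q * (real p * (1 / q) * (r * 1))"
        using q(1) by (intro mult_left_mono) auto
      also have "\<dots> = real p * u" using q(1) r(6) by simp
      also have "\<dots> \<le> real p * (real k + 1)" using k by (intro mult_left_mono) auto
      finally have "real N * r ^ p \<le> real N * x ^ p + real p * (real k + 1)"
        by (simp add: q(2) algebra_simps)
      then have "b * (real N * r ^ p) \<le> b * (real N * x ^ p + real p * (real k + 1))"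
        using b by (rule mult_left_mono)
      moreover have "C * u \<le> C * (real k + 1)" using C k by (intro mult_left_mono) auto
      ultimately have "C * u + b * (real N * r ^ p) \<le> c * (real k + 1) + b * (real N * x ^ p)"
        by (simp add: c_def algebra_simps)
      then have "?f \<sigma> \<le> E k"
        unfolding SN E_def by (simp add: u_def x_def)
      moreover have "real N * (real k / q) \<le> S \<sigma>"
        unfolding S using r(3) by (intro mult_left_mono) (auto simp: x_def)
      ultimately have "?f \<sigma>
          \<le> E k * ?i k \<sigma>" by simp
      also have "\<dots> \<le> (\<Sum>k\<in>B. E k * ?i k \<sigma>)"
        using kB \<open>finite B\<close> by (intro member_le_sum) (auto simp: E_def)
      finally show ?thesis .
    qed
    have bin: "E k * spin_avg N (?i k)
       \<le> 2 * exp ?K * exp (-1) ^ k" if k: "k \<in> B" for k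
    proof -
      have k1: "0 \<le> real k / q" "real k / q \<le> 1" using k q by (auto simp: B_def)
      have "E k * spin_avg N (?i k)
         \<le> E k * (2 * exp (- real N * (b * (real k / q) ^ p + d * (real k / q)\<^sup>2)))"
        using d(2)[OF k1, of N] by (intro mult_left_mono) (auto simp: S_def b_def E_def)
      also have "\<dots> = 2 * exp (c * (real k + 1) + b * (real N * (real k / q) ^ p)
          - real N * (b * (real k / q) ^ p + d * (real k / q)\<^sup>2))"
        by (simp add: E_def exp_add[symmetric] exp_diff exp_minus field_simps)
      also have "c * (real k + 1) + b * (real N * (real k / q) ^ p)
          - real N * (b * (real k / q) ^ p + d * (real k / q)\<^sup>2)
         = c * (real k + 1) - d * (real N * (real k / q)\<^sup>2)"
        by (simp add: algebra_simps)
      also have "real N * (real k / q)\<^sup>2 = (real k)\<^sup>2"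
        using q by (simp add: power2_eq_square flip: q(2))
      also have "c * (real k + 1) - d * (real k)\<^sup>2 \<le> ?K - real k"
      proof -
        have "0 \<le> (2 * d * real k - (c + 1))\<^sup>2 / (4 * d)" using d(1) by simp
        also have "\<dots> = d * (real k)\<^sup>2 - (c + 1) * real k + (c + 1)\<^sup>2 / (4 * d)"
          using d(1) by (simp add: power2_eq_square field_simps)
        finally show ?thesis by (simp add: algebra_simps)
      qed
      also have "exp (?K - real k) = exp ?K * exp (-1) ^ k"
        by (simp add: exp_of_nat_mult[symmetric] mult_exp_exp)
      finally show ?thesis by simp
    qed
    have "spin_avg N ?f
       \<le> spin_avg N (\<lambda>\<sigma>. \<Sum>k\<in>B. E k * ?i k \<sigma>)"
      by (rule spin_avg_mono) (rule pw)
    also have "\<dots> = (\<Sum>k\<in>B. E k * spin_avg N (?i k))"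
      by (simp add: spin_avg_sum spin_avg_cmult)
    also have "\<dots> \<le> (\<Sum>k\<in>B. 2 * exp ?K * exp (-1) ^ k)"
      by (intro sum_mono bin)
    also have "\<dots> = 2 * exp ?K * (\<Sum>k\<in>B. exp (-1) ^ k)"
      by (simp add: sum_distrib_left)
    also have "(\<Sum>k\<in>B. exp (-1) ^ k) \<le> (\<Sum>k. exp (-1 :: real) ^ k)"
      using \<open>finite B\<close> by (intro sum_le_suminf) (auto intro!: summable_geometric)
    also have "(\<Sum>k. exp (-1 :: real) ^ k) = 1 / (1 - exp (-1))"
      by (intro suminf_geometric) auto
    finally show "spin_avg N (\<lambda>\<sigma>. exp (C * (\<bar>\<Sum>k\<in>{1..N}. \<sigma> k\<bar> / sqrt N)
        + \<beta>\<^sup>2 / fact p * (\<bar>\<Sum>k\<in>{1..N}. \<sigma> k\<bar> ^ p / real N ^ (p - 1)))) \<le> K"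
      by (simp add: S_def q_def b_def K_def mult_left_mono)
  qed
qed

section \<open>The overlap polynomial\<close>

lemma one_plus_le_exp_cubic:
  fixes x :: real
  assumes "-1 \<le> x"
  shows "1 + x \<le> exp (x - x\<^sup>2 / 2 + x ^ 3 / 3)"
proof (cases "x = -1")
  case False
  define f where "f y = y - y\<^sup>2 / 2 + y ^ 3 / 3 - ln (1 + y)" for y :: real
  have D: "(f has_real_derivative z ^ 3 / (1 + z)) (at z)" if "-1 < z" for z
  proof -
    have "(f has_real_derivative 1 - z + z\<^sup>2 - 1 / (1 + z)) (at z)"
      unfolding f_def using that by (auto intro!: derivative_eq_intros simp: power2_eq_square)
    moreover have "1 - z + z\<^sup>2 - 1 / (1 + z) = z ^ 3 / (1 + z)"
      using that by (simp add: field_simps power2_eq_square power3_eq_cube)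
    ultimately show ?thesis by (simp only:)
  qed
  have "f 0 \<le> f x"
  proof (cases "0 \<le> x")
    case True
    show ?thesis
    proof (rule DERIV_nonneg_imp_nondecreasing[OF True])
      fix z assume "0 \<le> z" "z \<le> x"
      then show "\<exists>y. (f has_real_derivative y) (at z) \<and> 0 \<le> y"
        using D[of z] by (intro exI[of _ "z ^ 3 / (1 + z)"]) auto
    qed
  next
    case neg: False
    show ?thesis
    proof (rule DERIV_nonpos_imp_nonincreasing[of x 0 f])
      show "x \<le> 0" using neg by simp
      fix z assume "x \<le> z" "z \<le> 0"
      then show "\<exists>y. (f has_real_derivative y) (at z) \<and> y \<le> 0"
        using D[of z] assms False
        by (intro exI[of _ "z ^ 3 / (1 + z)"]) (auto intro!: divide_nonpos_pos simp: power_le_zero_eq)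
    qed
  qed
  then have "ln (1 + x) \<le> x - x\<^sup>2 / 2 + x ^ 3 / 3" by (simp add: f_def)
  then have "exp (ln (1 + x)) \<le> exp (x - x\<^sup>2 / 2 + x ^ 3 / 3)" by (subst exp_le_cancel_iff)
  then show ?thesis using assms False by simp
qed simp

lemma exp_le_quadratic_cubic:
  fixes y :: real
  shows "exp y \<le> 1 + y + y\<^sup>2 / 2 + \<bar>y\<bar> ^ 3 * exp \<bar>y\<bar>"
proof -
  obtain t where t: "\<bar>t\<bar> \<le> \<bar>y\<bar>" "exp y = (\<Sum>m<3. y ^ m / fact m) + exp t / fact 3 * y ^ 3"
    using Maclaurin_exp_le[of y 3] by blast
  have "exp t / fact 3 * y ^ 3 \<le> \<bar>exp t / fact 3 * y ^ 3\<bar>" by (rule abs_ge_self)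
  also have "\<dots> = \<bar>y\<bar> ^ 3 * (exp t / fact 3)" by (simp add: abs_mult power_abs)
  also have "\<dots> \<le> \<bar>y\<bar> ^ 3 * exp \<bar>y\<bar>"
  proof (rule mult_left_mono)
    have "exp t / fact 3 \<le> exp t / 1" by (intro divide_left_mono) (auto simp: fact_numeral)
    also have "\<dots> \<le> exp \<bar>y\<bar>" using t(1) by simp
    finally show "exp t / fact 3 \<le> exp \<bar>y\<bar>" .
  qed simp
  finally show ?thesis
    unfolding t(2) by (simp add: eval_nat_numeral)
qed

lemma spin_avg_weight: "spin_avg N (\<lambda>\<sigma>. \<Prod>k\<in>{1..N}. 1 + \<mu> * \<sigma> k) = 1"
  using spin_avg_prod[of N "\<lambda>k x. 1 + \<mu> * x"] by simp

text \<open>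
  Distinct index tuples differ in some site, and averaging the spin at that site gives 0.
\<close>

lemma spin_avg_orthogonal:
  assumes "is \<in> index_tuples N p" "js \<in> index_tuples N p"
  shows "spin_avg N (\<lambda>\<sigma>. spin_product \<sigma> is * spin_product \<sigma> js) = of_bool (is = js)"
proof -
  have sub: "set is \<subseteq> {1..N}" "set js \<subseteq> {1..N}" using assms by (auto simp: index_tuples_def)
  define f where "f k x = (if k \<in> set is then x else 1) * (if k \<in> set js then x else 1)" for k and x :: real
  have ext: "(\<Prod>k\<in>set ks. \<sigma> k) = (\<Prod>k\<in>{1..N}. if k \<in> set ks then \<sigma> k else 1)"
    if "set ks \<subseteq> {1..N}" for ks and \<sigma> :: "nat \<Rightarrow> real"
    using that by (subst prod.inter_restrict[symmetric]) (auto simp: Int_absorb1)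
  have "spin_avg N (\<lambda>\<sigma>. spin_product \<sigma> is * spin_product \<sigma> js)
      = spin_avg N (\<lambda>\<sigma>. \<Prod>k\<in>{1..N}. f k (\<sigma> k))"
    using assms by (intro spin_avg_cong) (simp add: spin_product_set ext[OF sub(1)] ext[OF sub(2)] f_def prod.distrib)
  also have "\<dots> = (\<Prod>k\<in>{1..N}. (f k (-1) + f k 1) / 2)" by (rule spin_avg_prod)
  also have "\<dots> = of_bool (is = js)"
  proof (cases "is = js")
    case True
    then show ?thesis by (auto simp: f_def intro!: prod.neutral)
  next
    case False
    then have "set is \<noteq> set js"
      using assms bij_betw_imp_inj_on[OF bij_betw_index_tuples[of N p]] by (auto dest: inj_onD)
    then obtain k where "k \<in> {1..N}" "(k \<in> set is) \<noteq> (k \<in> set js)" using sub by blast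
    then have "\<exists>k\<in>{1..N}. (f k (-1) + f k 1) / 2 = 0"
      by (intro bexI[of _ k]) (auto simp: f_def)
    then show ?thesis using False by (subst prod_zero) auto
  qed
  finally show ?thesis .
qed

lemma spin_avg_sum_square:
  "spin_avg N (\<lambda>\<sigma>. (\<Sum>is\<in>index_tuples N p. spin_product \<sigma> is)\<^sup>2) = real (N choose p)"
proof -
  have "spin_avg N (\<lambda>\<sigma>. (\<Sum>is\<in>index_tuples N p. spin_product \<sigma> is)\<^sup>2)
     = spin_avg N (\<lambda>\<sigma>. \<Sum>is\<in>index_tuples N p. \<Sum>js\<in>index_tuples N p. spin_product \<sigma> is * spin_product \<sigma> js)"
    by (intro spin_avg_cong) (simp add: power2_eq_square sum_product)
  also have "\<dots> = (\<Sum>is\<in>index_tuples N p. \<Sum>js\<in>index_tuples N p. of_bool (is = js))"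
    unfolding spin_avg_sum by (intro sum.cong refl spin_avg_orthogonal)
  also have "\<dots> = (\<Sum>is\<in>index_tuples N p. 1)"
    using finite_index_tuples by (intro sum.cong refl) (simp add: of_bool_def)
  finally show ?thesis by (simp add: card_index_tuples)
qed

text \<open>
  The overlap of two replicas enters through the spins \<open>\<epsilon>\<close>, independent of mean \<open>\<mu>\<close>; the average over
  them is written as one over fair spins with a density.
\<close>

definition overlap_remainder :: "nat \<Rightarrow> nat \<Rightarrow> real \<Rightarrow> real \<Rightarrow> real" where
  "overlap_remainder N p s \<mu> = spin_avg N (\<lambda>\<epsilon>. (\<Prod>k\<in>{1..N}. 1 + \<mu> * \<epsilon> k) *
     ((\<Prod>is\<in>index_tuples N p. 1 + s * spin_product \<epsilon> is) - 1
       - s * (\<Sum>is\<in>index_tuples N p. spin_product \<epsilon> is)))"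

text \<open>
  The left-hand side is the second moment of the remainder \<open>W\<close>, seen as an average over fair spins
  with density \<open>\<Prod>\<^sub>k (1 + \<mu> \<sigma>\<^sub>k)\<close>. Put \<open>y = s e - \<kappa>\<close>, where \<open>e\<close> is the sum of the spin products and
  \<open>\<kappa>\<close> is about \<open>n s\<^sup>2 / 2\<close>, with \<open>n\<close> the number of index tuples; \<open>y\<close> bounds the logarithm of the
  product from above. With \<open>d = N^(1 - p/2)\<close>, \<open>y\<close> is of order \<open>d\<close>, so that in
  \<open>exp y \<le> 1 + y + y\<^sup>2 / 2 + \<bar>y\<bar>\<^sup>3 exp \<bar>y\<bar>\<close> the last term costs \<open>d\<^sup>3\<close>. Of the quadratic term only
  \<open>s\<^sup>2 (e\<^sup>2 - n) / 2\<close> is larger than that; since \<open>e\<^sup>2\<close> has mean \<open>n\<close> under fair spins, it contributes only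
  through the deviation of the density from 1, which is of order \<open>\<mu> \<surd>N\<close>.
\<close>

lemma overlap_estimate:
  assumes \<beta>: "0 < \<beta>" "\<beta> < beta_f p" and p: "2 \<le> p" and R: "0 \<le> R"
  obtains K where "0 \<le> K" "\<And>N s \<mu>. 1 \<le> N \<Longrightarrow> 0 \<le> s \<Longrightarrow> s \<le> 1 \<Longrightarrow> s \<le> \<beta>\<^sup>2 / real N ^ (p - 1) \<Longrightarrow>
      0 \<le> \<mu> \<Longrightarrow> \<mu> \<le> 1 \<Longrightarrow> \<mu> * sqrt N \<le> R \<Longrightarrow>
    overlap_remainder N p s \<mu>
      \<le> K * (1 / real N ^ (p - 2)) * (\<mu> * sqrt N + 1 / sqrt N ^ (p - 2))"
proof -
  obtain m where m: "p = m + 2" using p by (metis add.commute le_Suc_ex)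
  \<comment> \<open>\<open>R + 1\<close> accounts for the density \<open>\<Prod>\<^sub>k (1 + \<mu> \<sigma>\<^sub>k)\<close> and \<open>3 p\<close> for the cube of \<open>y\<close>.\<close>
  define c where "c = R + 1 + 3 * real p"
  have "0 \<le> c" using R by (simp add: c_def)
  obtain K0 where K0: "\<And>N. 1 \<le> N \<Longrightarrow>
    spin_avg N (\<lambda>\<sigma>. exp (c * (\<bar>\<Sum>k\<in>{1..N}. \<sigma> k\<bar> / sqrt N)
        + \<beta>\<^sup>2 / fact p * (\<bar>\<Sum>k\<in>{1..N}. \<sigma> k\<bar> ^ p / real N ^ (p - 1)))) \<le> K0"
    using spin_exp_moment[OF \<beta> p \<open>0 \<le> c\<close>] by blast
  define B where "B = \<beta>\<^sup>2"
  have B0: "0 \<le> B" by (simp add: B_def)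
  \<comment> \<open>In units of \<open>d\<^sup>3\<close> the four terms bound \<open>\<kappa> s e\<close>, \<open>\<kappa>\<^sup>2 / 2\<close>, \<open>n s\<^sup>3 / 3\<close> and the Taylor remainder.\<close>
  define C1 where "C1 = B ^ 3 + B ^ 4 + B ^ 3 + (B + B\<^sup>2) ^ 3 * exp (B + B\<^sup>2)"
  have C1: "0 \<le> C1" using B0 by (simp add: C1_def)
  have "0 \<le> K0"
    by (rule order_trans[OF spin_avg_nonneg K0[of 1]]) auto
  show thesis
  proof (rule that[of "(B\<^sup>2 + C1) * K0"])
    show "0 \<le> (B\<^sup>2 + C1) * K0" using C1 \<open>0 \<le> K0\<close> by simp
  next
    fix N :: nat and s \<mu> :: real
    assume N: "1 \<le> N" and s: "0 \<le> s" "s \<le> 1" "s \<le> \<beta>\<^sup>2 / real N ^ (p - 1)"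
      and \<mu>: "0 \<le> \<mu>" "\<mu> \<le> 1" "\<mu> * sqrt N \<le> R"
    define q where "q = sqrt N"
    have q: "1 \<le> q" "real N = q\<^sup>2" using N by (auto simp: q_def)
    define d where "d = 1 / q ^ m"
    have d: "0 < d" "d \<le> 1" using q(1) by (auto simp: d_def)
    have dd: "1 / real N ^ (p - 2) = d\<^sup>2" "1 / sqrt N ^ (p - 2) = d"
      using q(1) by (simp_all add: m d_def q(2) power_one_over power_mult[symmetric] power_divide mult.commute flip: q_def)
    have s3: "s \<le> B / q ^ (2 * m + 2)"
    proof -
      have "real N ^ (p - 1) = q ^ (2 * (m + 1))" by (simp only: m q(2) power_mult) simp
      then show ?thesis using s(3) by (simp add: B_def)
    qed
    define n where "n = real (N choose p)"
    have n: "0 \<le> n" "n \<le> q ^ (2 * m + 4)"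
    proof -
      show "0 \<le> n" by (simp add: n_def)
      have "N choose p \<le> N ^ p"
        by (cases "p \<le> N") (simp_all add: binomial_le_pow binomial_eq_0)
      then have "n \<le> real N ^ p" unfolding n_def by (metis of_nat_le_iff of_nat_power)
      moreover have "real N ^ p = q ^ (2 * (m + 2))" by (simp only: m q(2) power_mult)
      moreover have "2 * (m + 2) = 2 * m + 4" by simp
      ultimately show "n \<le> q ^ (2 * m + 4)" by (simp only:)
    qed
    have sd: "s \<le> B * d"
    proof -
      have "B / q ^ (2 * m + 2) \<le> B / q ^ m"
        using q(1) B0 by (intro divide_left_mono power_increasing) auto
      then show ?thesis using s3 by (simp add: d_def)
    qed
    have ns: "n * s\<^sup>2 \<le> B\<^sup>2 * d\<^sup>2"
    proof -
      have "n * s\<^sup>2 \<le> q ^ (2 * m + 4) * (B / q ^ (2 * m + 2))\<^sup>2"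
        using n s s3 by (intro mult_mono power_mono) auto
      also have "\<dots> = B\<^sup>2 * d\<^sup>2"
      proof -
        define P where "P = q ^ m"
        have P: "P \<noteq> 0" "q \<noteq> 0" using q(1) by (auto simp: P_def)
        have e: "q ^ (2 * m + 4) = P\<^sup>2 * q ^ 4" "q ^ (2 * m + 2) = P\<^sup>2 * q\<^sup>2"
          by (simp_all only: P_def power_add mult.commute[of 2 m] power_mult)
        show ?thesis
          unfolding e d_def P_def[symmetric] using P by (simp add: field_simps eval_nat_numeral)
      qed
      finally show ?thesis .
    qed
    \<comment> \<open>The exponent of \<open>one_plus_le_exp_cubic\<close> at \<open>x = \<plusminus>s\<close>, summed over all tuples, is at most \<open>s e - \<kappa>\<close>.\<close>
    define \<kappa> where "\<kappa> = n * s\<^sup>2 / 2 - n * s ^ 3 / 3"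
    have ns3: "n * s ^ 3 \<le> B ^ 3 * d ^ 3"
    proof -
      have "n * s ^ 3 = (n * s\<^sup>2) * s" by (simp add: power2_eq_square power3_eq_cube)
      also have "\<dots> \<le> (B\<^sup>2 * d\<^sup>2) * (B * d)" by (rule mult_mono[OF ns sd]) (use s n in auto)
      finally show ?thesis by (simp add: power2_eq_square power3_eq_cube mult_ac)
    qed
    have \<kappa>: "0 \<le> \<kappa>" "\<kappa> \<le> B\<^sup>2 * d\<^sup>2"
    proof -
      have "n * s ^ 3 \<le> n * s\<^sup>2" using n s power_decreasing[of 2 3 s] by (intro mult_left_mono) auto
      moreover have "0 \<le> n * s\<^sup>2" "0 \<le> n * s ^ 3" using n s by auto
      ultimately show "0 \<le> \<kappa>" "\<kappa> \<le> B\<^sup>2 * d\<^sup>2" using ns by (auto simp: \<kappa>_def)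
    qed
    define S where "S \<sigma> = \<bar>\<Sum>k\<in>{1..N}. \<sigma> k :: real\<bar>" for \<sigma>
    define u where "u \<sigma> = S \<sigma> / q" for \<sigma>
    have u0: "0 \<le> u \<sigma>" for \<sigma> using q(1) by (simp add: u_def S_def)
    define e where "e \<sigma> = (\<Sum>is\<in>index_tuples N p. spin_product \<sigma> is)" for \<sigma>
    define w where "w \<sigma> = (\<Prod>k\<in>{1..N}. 1 + \<mu> * \<sigma> k)" for \<sigma>
    define Q where "Q \<sigma> = (\<Prod>is\<in>index_tuples N p. 1 + s * spin_product \<sigma> is)" for \<sigma>
    define G where "G \<sigma> = exp (B / fact p * (S \<sigma> ^ p / real N ^ (p - 1)))" for \<sigma>
    have G1: "1 \<le> G \<sigma>" for \<sigma> by (simp add: G_def S_def B0)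
    have K0': "spin_avg N (\<lambda>\<sigma>. exp (c * u \<sigma>) * G \<sigma>) \<le> K0"
      using K0[OF N] by (simp add: u_def S_def G_def B_def q_def exp_add)
    { fix \<sigma> assume \<sigma>: "\<sigma> \<in> spin_configs N"
      let ?E = "exp (real p * u \<sigma>)" and ?T = "exp (3 * real p * u \<sigma>)"
        and ?F = "exp ((R + 1) * u \<sigma>)" and ?C = "exp (c * u \<sigma>) * G \<sigma>"
      let ?se = "\<bar>s * e \<sigma>\<bar>" and ?B = "B + B\<^sup>2"
        and ?V = "s\<^sup>2 / 2 * ((w \<sigma> - 1) * (e \<sigma>)\<^sup>2)" and ?U = "s\<^sup>2 / 2 * ((e \<sigma>)\<^sup>2 - n * w \<sigma>)"
      note sq = spin_square[OF \<sigma>]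
      have fin: "finite {1..N}" by simp
      have se: "?se \<le> B * d * ?E"
      proof -
        have "\<bar>e \<sigma>\<bar> \<le> (q + S \<sigma>) ^ p"
          using esym_growth[OF fin sq, of "\<lambda>k. k" p] unfolding e_def sum_spin_product S_def q_def by simp
        also have "q + S \<sigma> = q * (1 + u \<sigma>)" using q(1) by (simp add: u_def algebra_simps)
        also have "(q * (1 + u \<sigma>)) ^ p \<le> q ^ p * ?E"
          unfolding power_mult_distrib exp_of_nat_mult using u0[of \<sigma>] q(1)
          by (intro mult_left_mono power_mono) (auto simp: exp_ge_add_one_self)
        finally have "s * \<bar>e \<sigma>\<bar> \<le> B / q ^ (2 * m + 2) * (q ^ p * ?E)"
          using s s3 by (intro mult_mono) auto
        also have "B / q ^ (2 * m + 2) * (q ^ p * ?E) = B * d * ?E"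
          using q(1) by (simp add: m d_def divide_simps power_add power_mult power2_eq_square)
        finally show ?thesis using s by (simp add: abs_mult)
      qed
      have se2: "?se \<le> ln (G \<sigma>) + B"
      proof -
        have "\<bar>esym {1..N} (Suc (m + 1)) \<sigma> - (\<Sum>k\<in>{1..N}. \<sigma> k) ^ Suc (m + 1) / fact (Suc (m + 1))\<bar> \<le> real (card {1..N}) ^ (m + 1)"
          by (rule esym_approx_power) (use sq in auto)
        then have "\<bar>e \<sigma> - (\<Sum>k\<in>{1..N}. \<sigma> k) ^ p / fact p\<bar> \<le> real N ^ (p - 1)"
          unfolding e_def sum_spin_product by (simp add: m del: fact_Suc)
        moreover have "\<bar>(\<Sum>k\<in>{1..N}. \<sigma> k) ^ p / fact p\<bar> = S \<sigma> ^ p / fact p"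
          by (simp add: S_def power_abs)
        ultimately have "\<bar>e \<sigma>\<bar> \<le> S \<sigma> ^ p / fact p + real N ^ (p - 1)" by linarith
        then have "s * \<bar>e \<sigma>\<bar> \<le> (B / real N ^ (p - 1)) * (S \<sigma> ^ p / fact p + real N ^ (p - 1))"
          using s N unfolding B_def by (intro mult_mono) auto
        also have "\<dots> = ln (G \<sigma>) + B" using N by (simp add: G_def field_simps)
        finally show ?thesis using s by (simp add: abs_mult)
      qed
      define y where "y = s * e \<sigma> - \<kappa>"
      have "Q \<sigma> \<le> exp y"
      proof -
        have "Q \<sigma> \<le> (\<Prod>is\<in>index_tuples N p. exp (s * spin_product \<sigma> is - s\<^sup>2 / 2 + s ^ 3 / 3))"
          unfolding Q_def
        proof (rule prod_mono)
          fix "is" assume i: "is \<in> index_tuples N p"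
          define \<epsilon> where "\<epsilon> = spin_product \<sigma> is"
          have e: "\<epsilon> = -1 \<or> \<epsilon> = 1" unfolding \<epsilon>_def by (rule spin_product_values[OF \<sigma> i])
          then have "-1 \<le> s * \<epsilon>" using s by auto
          then have "1 + s * \<epsilon> \<le> exp (s * \<epsilon> - (s * \<epsilon>)\<^sup>2 / 2 + (s * \<epsilon>) ^ 3 / 3)"
            by (rule one_plus_le_exp_cubic)
          also have "\<dots> \<le> exp (s * \<epsilon> - s\<^sup>2 / 2 + s ^ 3 / 3)" using e s by auto
          finally show "0 \<le> 1 + s * spin_product \<sigma> is \<and> 1 + s * spin_product \<sigma> is
              \<le> exp (s * spin_product \<sigma> is - s\<^sup>2 / 2 + s ^ 3 / 3)"
            using \<open>-1 \<le> s * \<epsilon>\<close> unfolding \<epsilon>_def by simp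
        qed
        also have "\<dots> = exp y"
          unfolding exp_sum[OF finite_index_tuples, symmetric]
          by (simp add: y_def \<kappa>_def e_def n_def card_index_tuples sum.distrib sum_subtractf
              sum_distrib_left[symmetric] algebra_simps)
        finally show ?thesis .
      qed
      moreover have "exp y \<le> 1 + y + y\<^sup>2 / 2 + \<bar>y\<bar> ^ 3 * exp \<bar>y\<bar>" by (rule exp_le_quadratic_cubic)
      ultimately have 1: "Q \<sigma> - 1 - s * e \<sigma> \<le> y\<^sup>2 / 2 - \<kappa> + \<bar>y\<bar> ^ 3 * exp \<bar>y\<bar>"
        by (simp add: y_def)
      have E1: "1 \<le> ?E" using u0[of \<sigma>] by simp
      have dE: "d\<^sup>2 \<le> d * ?E"
        unfolding power2_eq_square using d E1 by (intro mult_left_mono) linarith+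
      have yb: "\<bar>y\<bar> \<le> ?B * (d * ?E)"
      proof -
        have "\<bar>y\<bar> \<le> ?se + \<kappa>" using \<kappa> by (simp add: y_def abs_if)
        moreover have "B\<^sup>2 * d\<^sup>2 \<le> B\<^sup>2 * (d * ?E)" using dE by (rule mult_left_mono) simp
        ultimately show ?thesis using se \<kappa> by (simp add: algebra_simps)
      qed
      have y2: "\<bar>y\<bar> \<le> ln (G \<sigma>) + ?B"
      proof -
        have "\<bar>y\<bar> \<le> ?se + \<kappa>" using \<kappa> by (simp add: y_def abs_if)
        moreover have "B\<^sup>2 * d\<^sup>2 \<le> B\<^sup>2 * 1" using d by (intro mult_left_mono) (auto simp: power_le_one)
        ultimately show ?thesis using se2 \<kappa> by linarith
      qed
      have E3: "?E ^ 3 = ?T"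
        by (simp add: exp_of_nat_mult[symmetric] mult.assoc)
      have cub: "\<bar>y\<bar> ^ 3 * exp \<bar>y\<bar> \<le> (?B ^ 3 * exp ?B) * (d ^ 3 * (?T * G \<sigma>))"
      proof -
        have "\<bar>y\<bar> ^ 3 \<le> (?B * (d * ?E)) ^ 3" using yb by (intro power_mono) auto
        moreover have "exp \<bar>y\<bar> \<le> G \<sigma> * exp ?B"
        proof -
          have "exp \<bar>y\<bar> \<le> exp (ln (G \<sigma>) + ?B)" using y2 by simp
          then show ?thesis using G1[of \<sigma>] by (simp add: exp_add)
        qed
        ultimately have "\<bar>y\<bar> ^ 3 * exp \<bar>y\<bar> \<le> (?B * (d * ?E)) ^ 3 * (G \<sigma> * exp ?B)"
          using d B0 by (intro mult_mono) auto
        also have "\<dots> = (?B ^ 3 * exp ?B) * (d ^ 3 * (?T * G \<sigma>))"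
          unfolding power_mult_distrib E3 by (simp add: mult_ac)
        finally show ?thesis .
      qed
      define H where "H = d ^ 3 * (?T * G \<sigma>)"
      have E31: "1 \<le> ?T" "?E \<le> ?T"
        using u0[of \<sigma>] by (auto simp: mult_right_mono)
      have H1: "d ^ 3 * ?E \<le> H"
      proof -
        have "?E * 1 \<le> ?T * G \<sigma>"
          by (rule mult_mono[OF E31(2) G1]) auto
        then show ?thesis using d unfolding H_def by (intro mult_left_mono) auto
      qed
      have H2: "d ^ 3 \<le> H"
      proof -
        have "d ^ 3 * 1 \<le> d ^ 3 * ?E" using E1 by (rule mult_left_mono) (use d in simp)
        then show ?thesis using H1 by linarith
      qed
      have "y\<^sup>2 / 2 - \<kappa> = s\<^sup>2 / 2 * ((e \<sigma>)\<^sup>2 - n) - \<kappa> * (s * e \<sigma>) + \<kappa>\<^sup>2 / 2 + n * s ^ 3 / 3"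
      proof -
        have "y\<^sup>2 / 2 = (s * e \<sigma>)\<^sup>2 / 2 - \<kappa> * (s * e \<sigma>) + \<kappa>\<^sup>2 / 2"
          by (simp add: y_def power2_eq_square algebra_simps add_divide_distrib diff_divide_distrib)
        moreover have "s\<^sup>2 / 2 * ((e \<sigma>)\<^sup>2 - n) = (s * e \<sigma>)\<^sup>2 / 2 - n * s\<^sup>2 / 2"
          by (simp add: power_mult_distrib algebra_simps diff_divide_distrib)
        ultimately show ?thesis unfolding \<kappa>_def by linarith
      qed
      moreover have "- \<kappa> * (s * e \<sigma>) \<le> B ^ 3 * H"
      proof -
        have "- \<kappa> * (s * e \<sigma>) \<le> \<kappa> * ?se"
          using \<kappa>(1) by (metis abs_ge_minus_self minus_mult_commute mult_left_mono)
        also have "\<dots> \<le> (B\<^sup>2 * d\<^sup>2) * (B * d * ?E)"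
          by (rule mult_mono[OF \<kappa>(2) se]) (use \<kappa> in auto)
        also have "\<dots> = B ^ 3 * (d ^ 3 * ?E)"
          by (simp add: power2_eq_square power3_eq_cube mult_ac)
        also have "\<dots> \<le> B ^ 3 * H" using H1 B0 by (intro mult_left_mono) auto
        finally show ?thesis .
      qed
      moreover have "\<kappa>\<^sup>2 / 2 \<le> B ^ 4 * H"
      proof -
        have "\<kappa>\<^sup>2 \<le> (B\<^sup>2 * d\<^sup>2)\<^sup>2" using \<kappa> by (intro power_mono) auto
        also have "\<dots> = B ^ 4 * d ^ 4" by (simp add: power_mult_distrib power_mult[symmetric])
        also have "\<dots> \<le> B ^ 4 * d ^ 3" using d B0 by (intro mult_left_mono power_decreasing) auto
        also have "\<dots> \<le> B ^ 4 * H" using H2 B0 by (intro mult_left_mono) auto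
        finally show ?thesis using zero_le_power2[of \<kappa>] by linarith
      qed
      moreover have "n * s ^ 3 / 3 \<le> B ^ 3 * H"
      proof -
        have "B ^ 3 * d ^ 3 \<le> B ^ 3 * H" using H2 B0 by (intro mult_left_mono) auto
        moreover have "0 \<le> n * s ^ 3" using n s by simp
        ultimately show ?thesis using ns3 by linarith
      qed
      moreover have "\<bar>y\<bar> ^ 3 * exp \<bar>y\<bar> \<le> (?B ^ 3 * exp ?B) * H"
        using cub unfolding H_def .
      ultimately have main: "Q \<sigma> - 1 - s * e \<sigma> \<le> s\<^sup>2 / 2 * ((e \<sigma>)\<^sup>2 - n) + C1 * H"
        using 1 unfolding C1_def distrib_right by linarith
      have abs\<sigma>: "\<bar>\<mu> * \<sigma> k\<bar> \<le> 1" "1 + \<mu> * \<sigma> k \<ge> 0" if "k \<in> {1..N}" for k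
        using spin_values[OF \<sigma> that] \<mu> by auto
      have w0: "0 \<le> w \<sigma>" unfolding w_def by (intro prod_nonneg) (use abs\<sigma> in auto)
      have w_le: "w \<sigma> \<le> exp (\<mu> * S \<sigma>)"
      proof -
        have "w \<sigma> \<le> (\<Prod>k\<in>{1..N}. exp (\<mu> * \<sigma> k))"
          unfolding w_def using abs\<sigma> by (intro prod_mono) (auto simp: exp_ge_add_one_self)
        also have "\<dots> = exp (\<mu> * (\<Sum>k\<in>{1..N}. \<sigma> k))"
          by (simp add: exp_sum[symmetric] sum_distrib_left)
        also have "\<dots> \<le> exp (\<mu> * S \<sigma>)" using \<mu> by (simp add: S_def mult_left_mono)
        finally show ?thesis .
      qed
      have \<mu>S: "\<mu> * S \<sigma> = (\<mu> * q) * u \<sigma>" using q(1) by (simp add: u_def)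
      have \<mu>S': "\<mu> * S \<sigma> \<le> R * u \<sigma>"
        unfolding \<mu>S using \<mu>(3) u0 by (intro mult_right_mono) (auto simp: q_def)
      have wR: "w \<sigma> \<le> exp (R * u \<sigma>)" using w_le \<mu>S' by (meson exp_le_cancel_iff order_trans)
      have w1: "w \<sigma> - 1 \<le> (\<mu> * q) * ?F"
      proof -
        define z where "z = \<mu> * S \<sigma>"
        have z0: "0 \<le> z" using \<mu> by (simp add: z_def S_def)
        have "exp z * (1 - z) \<le> exp z * exp (- z)"
          using exp_ge_add_one_self[of "-z"] by (intro mult_left_mono) auto
        then have "exp z - 1 \<le> z * exp z" by (simp add: exp_minus algebra_simps)
        also have "\<dots> \<le> z * exp (R * u \<sigma>)" using \<mu>S' z0 by (intro mult_left_mono) (auto simp: z_def)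
        also have "\<dots> = (\<mu> * q) * (u \<sigma> * exp (R * u \<sigma>))" by (simp add: z_def \<mu>S)
        also have "\<dots> \<le> (\<mu> * q) * (exp (u \<sigma>) * exp (R * u \<sigma>))"
        proof -
          have "u \<sigma> \<le> exp (u \<sigma>)" using exp_ge_add_one_self[of "u \<sigma>"] by linarith
          then show ?thesis using \<mu> q(1) by (intro mult_left_mono mult_right_mono) auto
        qed
        also have "exp (u \<sigma>) * exp (R * u \<sigma>) = ?F"
          by (simp add: mult_exp_exp algebra_simps)
        finally show ?thesis using w_le by (simp add: z_def)
      qed
      have "w \<sigma> * (Q \<sigma> - 1 - s * e \<sigma>) \<le> w \<sigma> * (s\<^sup>2 / 2 * ((e \<sigma>)\<^sup>2 - n) + C1 * H)"
        using main w0 by (rule mult_left_mono)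
      also have "\<dots> = ?V + ?U + C1 * (w \<sigma> * H)"
        by (simp add: algebra_simps add_divide_distrib diff_divide_distrib)
      finally have split: "w \<sigma> * (Q \<sigma> - 1 - s * e \<sigma>) \<le> ?V
          + ?U + C1 * (w \<sigma> * H)" .
      have t1: "?V \<le> B\<^sup>2 * d\<^sup>2 * (\<mu> * q) * (?C)"
      proof -
        have "?V = ?se\<^sup>2 / 2 * (w \<sigma> - 1)"
          by (simp add: power_mult_distrib)
        also have "\<dots> \<le> ?se\<^sup>2 / 2 * ((\<mu> * q) * ?F)"
          using w1 by (intro mult_left_mono) auto
        also have "\<dots> \<le> (B * d * ?E)\<^sup>2 * ((\<mu> * q) * ?F)"
        proof (rule mult_right_mono)
          have "?se\<^sup>2 \<le> (B * d * ?E)\<^sup>2" using se by (intro power_mono) auto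
          then show "?se\<^sup>2 / 2 \<le> (B * d * ?E)\<^sup>2"
            using zero_le_power2[of "?se"] by linarith
        qed (use \<mu> q(1) in auto)
        also have "\<dots> = B\<^sup>2 * d\<^sup>2 * (\<mu> * q) * (?E * ?E * ?F)"
          by (simp add: power2_eq_square mult_ac)
        also have "\<dots> \<le> B\<^sup>2 * d\<^sup>2 * (\<mu> * q) * (?C)"
        proof (rule mult_left_mono)
          have "?E * ?E * ?F = exp ((2 * real p + R + 1) * u \<sigma>)"
            by (simp add: mult_exp_exp algebra_simps)
          also have "\<dots> \<le> exp (c * u \<sigma>)"
            using u0[of \<sigma>] by (auto simp: c_def intro!: mult_right_mono)
          also have "\<dots> \<le> ?C" using G1[of \<sigma>] by simp
          finally show "?E * ?E * ?F \<le> ?C" .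
        qed (use \<mu> q(1) in auto)
        finally show ?thesis .
      qed
      have t2: "C1 * (w \<sigma> * H) \<le> C1 * d ^ 3 * (?C)"
      proof -
        have "w \<sigma> * (?T * G \<sigma>) \<le> ?F * (?T * G \<sigma>)"
        proof (rule mult_right_mono)
          have "R * u \<sigma> \<le> (R + 1) * u \<sigma>" using u0[of \<sigma>] by (simp add: mult_right_mono)
          then show "w \<sigma> \<le> ?F" using wR by (meson exp_le_cancel_iff order_trans)
        qed (use G1[of \<sigma>] in auto)
        also have "\<dots> = ?C"
        proof -
          have "c * u \<sigma> = (R + 1) * u \<sigma> + 3 * real p * u \<sigma>" by (simp add: c_def algebra_simps)
          then show ?thesis by (simp add: exp_add)
        qed
        finally have "C1 * d ^ 3 * (w \<sigma> * (?T * G \<sigma>)) \<le> C1 * d ^ 3 * (?C)"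
          using C1 d by (intro mult_left_mono) auto
        then show ?thesis by (simp add: H_def mult_ac)
      qed
      have "w \<sigma> * (Q \<sigma> - 1 - s * e \<sigma>)
         \<le> (B\<^sup>2 * d\<^sup>2 * (\<mu> * q) + C1 * d ^ 3) * (?C) + ?U"
        unfolding distrib_right using split t1 t2 by linarith
    }
    then have "spin_avg N (\<lambda>\<sigma>. w \<sigma> * (Q \<sigma> - 1 - s * e \<sigma>))
       \<le> spin_avg N (\<lambda>\<sigma>. (B\<^sup>2 * d\<^sup>2 * (\<mu> * q) + C1 * d ^ 3) * (exp (c * u \<sigma>) * G \<sigma>)
            + s\<^sup>2 / 2 * ((e \<sigma>)\<^sup>2 - n * w \<sigma>))"
      by (rule spin_avg_mono)
    also have "\<dots> = (B\<^sup>2 * d\<^sup>2 * (\<mu> * q) + C1 * d ^ 3) * spin_avg N (\<lambda>\<sigma>. exp (c * u \<sigma>) * G \<sigma>)"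
      unfolding spin_avg_add spin_avg_cmult spin_avg_diff
      by (simp add: w_def e_def n_def spin_avg_weight spin_avg_sum_square del: One_nat_def)
    also have "\<dots> \<le> (B\<^sup>2 * d\<^sup>2 * (\<mu> * q) + C1 * d ^ 3) * K0"
      using K0' C1 d \<mu> q(1) by (intro mult_left_mono) auto
    also have "\<dots> \<le> ((B\<^sup>2 + C1) * K0) * d\<^sup>2 * (\<mu> * q + d)"
    proof -
      have "0 \<le> C1 * d\<^sup>2 * (\<mu> * q)" "0 \<le> B\<^sup>2 * d\<^sup>2 * d" using C1 d \<mu> q(1) by auto
      then have "B\<^sup>2 * d\<^sup>2 * (\<mu> * q) + C1 * d ^ 3 \<le> (B\<^sup>2 + C1) * d\<^sup>2 * (\<mu> * q + d)"
        by (simp add: algebra_simps power2_eq_square power3_eq_cube)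
      then have "(B\<^sup>2 * d\<^sup>2 * (\<mu> * q) + C1 * d ^ 3) * K0 \<le> ((B\<^sup>2 + C1) * d\<^sup>2 * (\<mu> * q + d)) * K0"
        using \<open>0 \<le> K0\<close> by (rule mult_right_mono)
      then show ?thesis by (simp add: mult_ac)
    qed
    finally show "overlap_remainder N p s \<mu>
      \<le> (B\<^sup>2 + C1) * K0 * (1 / real N ^ (p - 2)) * (\<mu> * sqrt N + 1 / sqrt N ^ (p - 2))"
      unfolding dd overlap_remainder_def w_def Q_def e_def q_def .
  qed
qed

section \<open>Disorder average of the second-order remainder\<close>

context prob_space
begin

lemma expectation_prod_indep:
  fixes t :: "'i \<Rightarrow> 'a \<Rightarrow> real" and f :: "'i \<Rightarrow> real \<Rightarrow> real"
  assumes "finite I" "indep_vars (\<lambda>_. borel) t I"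
    and "\<And>i. i \<in> I \<Longrightarrow> f i \<in> borel_measurable borel"
    and "\<And>i. i \<in> I \<Longrightarrow> integrable M (\<lambda>\<omega>. f i (t i \<omega>))"
  shows "integrable M (\<lambda>\<omega>. \<Prod>i\<in>I. f i (t i \<omega>))"
    and "expectation (\<lambda>\<omega>. \<Prod>i\<in>I. f i (t i \<omega>)) = (\<Prod>i\<in>I. expectation (\<lambda>\<omega>. f i (t i \<omega>)))"
proof -
  have "indep_vars (\<lambda>_. borel) (\<lambda>i \<omega>. f i (t i \<omega>)) I"
    using assms(2,3) by (rule indep_vars_compose2)
  then show "integrable M (\<lambda>\<omega>. \<Prod>i\<in>I. f i (t i \<omega>))"
    and "expectation (\<lambda>\<omega>. \<Prod>i\<in>I. f i (t i \<omega>)) = (\<Prod>i\<in>I. expectation (\<lambda>\<omega>. f i (t i \<omega>)))"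
    using assms(1,4) by (auto intro!: indep_vars_integrable indep_vars_lebesgue_integral)
qed

lemma covariance_indep_linear_forms:
  fixes X :: "'i \<Rightarrow> 'a \<Rightarrow> real" and a c :: "'i \<Rightarrow> real"
  assumes fin: "finite I" and ind: "indep_vars (\<lambda>_. borel) X I"
    and int: "\<And>i. i \<in> I \<Longrightarrow> integrable M (\<lambda>\<omega>. (X i \<omega>)\<^sup>2)"
    and mean: "\<And>i. i \<in> I \<Longrightarrow> expectation (X i) = 0"
    and var: "\<And>i. i \<in> I \<Longrightarrow> expectation (\<lambda>\<omega>. (X i \<omega>)\<^sup>2) = v"
  shows "integrable M (\<lambda>\<omega>. (\<Sum>i\<in>I. X i \<omega> * a i) * (\<Sum>i\<in>I. X i \<omega> * c i))"
    and "expectation (\<lambda>\<omega>. (\<Sum>i\<in>I. X i \<omega> * a i) * (\<Sum>i\<in>I. X i \<omega> * c i)) = v * (\<Sum>i\<in>I. a i * c i)"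
proof -
  have int1: "integrable M (X i)" if "i \<in> I" for i
    by (rule square_integrable_imp_integrable[OF _ int[OF that]]) (use ind that in \<open>auto simp: indep_vars_def\<close>)
  have XX: "integrable M (\<lambda>\<omega>. X i \<omega> * X j \<omega>)" "expectation (\<lambda>\<omega>. X i \<omega> * X j \<omega>) = (if i = j then v else 0)"
    if ij: "i \<in> I" "j \<in> I" for i j
  proof -
    have sub: "i \<noteq> j \<Longrightarrow> indep_vars (\<lambda>_. borel) X {i, j}"
      using ind ij by (auto intro: indep_vars_subset)
    have "i \<noteq> j \<Longrightarrow> integrable M (\<lambda>\<omega>. \<Prod>k\<in>{i, j}. X k \<omega>)"
      using ij int1 by (intro indep_vars_integrable sub) auto
    then show "integrable M (\<lambda>\<omega>. X i \<omega> * X j \<omega>)"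
      using int[OF ij(1)] by (cases "i = j") (auto simp: power2_eq_square)
    have "i \<noteq> j \<Longrightarrow> expectation (\<lambda>\<omega>. \<Prod>k\<in>{i, j}. X k \<omega>) = (\<Prod>k\<in>{i, j}. expectation (X k))"
      using ij int1 by (intro indep_vars_lebesgue_integral sub) auto
    then show "expectation (\<lambda>\<omega>. X i \<omega> * X j \<omega>) = (if i = j then v else 0)"
      using var[OF ij(1)] mean ij by (cases "i = j") (auto simp: power2_eq_square)
  qed
  have e: "(\<Sum>i\<in>I. X i \<omega> * a i) * (\<Sum>i\<in>I. X i \<omega> * c i) = (\<Sum>i\<in>I. \<Sum>j\<in>I. (a i * c j) * (X i \<omega> * X j \<omega>))" for \<omega>
    by (simp add: sum_product mult_ac)
  show "integrable M (\<lambda>\<omega>. (\<Sum>i\<in>I. X i \<omega> * a i) * (\<Sum>i\<in>I. X i \<omega> * c i))" unfolding e using XX(1) by auto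
  have "expectation (\<lambda>\<omega>. \<Sum>i\<in>I. \<Sum>j\<in>I. (a i * c j) * (X i \<omega> * X j \<omega>))
     = (\<Sum>i\<in>I. \<Sum>j\<in>I. (a i * c j) * expectation (\<lambda>\<omega>. X i \<omega> * X j \<omega>))"
    using XX(1) by (subst Bochner_Integration.integral_sum; simp add: Bochner_Integration.integral_sum)
  also have "\<dots> = (\<Sum>i\<in>I. \<Sum>j\<in>I. if i = j then (a i * c j) * v else 0)"
    by (intro sum.cong refl) (simp add: XX)
  also have "\<dots> = v * (\<Sum>i\<in>I. a i * c i)" using fin by (simp add: sum_distrib_left mult_ac)
  finally show "expectation (\<lambda>\<omega>. (\<Sum>i\<in>I. X i \<omega> * a i) * (\<Sum>i\<in>I. X i \<omega> * c i)) = v * (\<Sum>i\<in>I. a i * c i)"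
    unfolding e .
qed

text \<open>
  In the expansion of \<open>\<Prod>\<^sub>i (1 + a\<^sub>i t\<^sub>i)\<close> the products of distinct \<open>t\<^sub>i\<close> are orthogonal, and \<open>D a\<close> is
  what remains after the terms of degree 0 and 1. The covariance is therefore the same truncation
  of \<open>\<Prod>\<^sub>i (1 + s a\<^sub>i c\<^sub>i)\<close>.
\<close>

lemma second_order_remainder_covariance:
  fixes t :: "'i \<Rightarrow> 'a \<Rightarrow> real" and a c :: "'i \<Rightarrow> real"
  assumes fin: "finite I" and ind: "indep_vars (\<lambda>_. borel) t I"
    and bnd: "\<And>i \<omega>. i \<in> I \<Longrightarrow> \<bar>t i \<omega>\<bar> \<le> 1"
    and mean: "\<And>i. i \<in> I \<Longrightarrow> expectation (t i) = 0"
    and var: "\<And>i. i \<in> I \<Longrightarrow> expectation (\<lambda>\<omega>. (t i \<omega>)\<^sup>2) = s"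
  defines "D \<equiv> \<lambda>a \<omega>. (\<Prod>i\<in>I. 1 + t i \<omega> * a i) - 1 - (\<Sum>i\<in>I. t i \<omega> * a i)"
  shows "integrable M (\<lambda>\<omega>. D a \<omega> * D c \<omega>)"
    and "expectation (\<lambda>\<omega>. D a \<omega> * D c \<omega>)
      = (\<Prod>i\<in>I. 1 + s * (a i * c i)) - 1 - s * (\<Sum>i\<in>I. a i * c i)"
proof -
  have rv: "t i \<in> borel_measurable M" if "i \<in> I" for i
    using ind that by (auto simp: indep_vars_def)
  have int1: "integrable M (t i)" if "i \<in> I" for i
    using bnd[OF that] rv[OF that] by (intro integrable_const_bound[where B=1]) auto
  have int2: "integrable M (\<lambda>\<omega>. (t i \<omega>)\<^sup>2)" if "i \<in> I" for i
  proof (rule integrable_const_bound[where B=1])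
    show "AE \<omega> in M. norm ((t i \<omega>)\<^sup>2) \<le> 1"
      using bnd[OF that] by (auto simp: abs_square_le_1)
    show "(\<lambda>\<omega>. (t i \<omega>)\<^sup>2) \<in> borel_measurable M" using rv[OF that] by measurable
  qed
  have quad: "integrable M (\<lambda>\<omega>. x + y * t i \<omega> + z * (t i \<omega>)\<^sup>2)"
    "expectation (\<lambda>\<omega>. x + y * t i \<omega> + z * (t i \<omega>)\<^sup>2) = x + z * s" if "i \<in> I" for i x y z
    using int1[OF that] int2[OF that] mean[OF that] var[OF that] by (auto simp: prob_space)
  define P where "P a \<omega> = (\<Prod>i\<in>I. 1 + t i \<omega> * a i)" for a \<omega>
  define L where "L a \<omega> = (\<Sum>i\<in>I. t i \<omega> * a i)" for a \<omega>
  have general: "integrable M (\<lambda>\<omega>. \<Prod>i\<in>I. x i + y i * t i \<omega> + z i * (t i \<omega>)\<^sup>2)"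
    "expectation (\<lambda>\<omega>. \<Prod>i\<in>I. x i + y i * t i \<omega> + z i * (t i \<omega>)\<^sup>2) = (\<Prod>i\<in>I. x i + z i * s)" for x y z
    using expectation_prod_indep[OF fin ind, of "\<lambda>i u. x i + y i * u + z i * u\<^sup>2"] quad
    by (auto intro!: prod.cong)
  have PP: "integrable M (\<lambda>\<omega>. P a \<omega> * P c \<omega>)"
    "expectation (\<lambda>\<omega>. P a \<omega> * P c \<omega>) = (\<Prod>i\<in>I. 1 + s * (a i * c i))"
  proof -
    have "P a \<omega> * P c \<omega> = (\<Prod>i\<in>I. 1 + (a i + c i) * t i \<omega> + (a i * c i) * (t i \<omega>)\<^sup>2)" for \<omega>
      unfolding P_def prod.distrib[symmetric]
      by (intro prod.cong refl) (simp add: power2_eq_square algebra_simps)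
    then show "integrable M (\<lambda>\<omega>. P a \<omega> * P c \<omega>)"
      "expectation (\<lambda>\<omega>. P a \<omega> * P c \<omega>) = (\<Prod>i\<in>I. 1 + s * (a i * c i))"
      using general[of "\<lambda>_. 1" "\<lambda>i. a i + c i" "\<lambda>i. a i * c i"] by (auto simp: mult_ac)
  qed
  have P1: "integrable M (\<lambda>\<omega>. P a \<omega>)" "expectation (\<lambda>\<omega>. P a \<omega>) = 1" for a
    using general[of "\<lambda>_. 1" a "\<lambda>i. 0"] by (auto simp: mult_ac P_def)
  have L1: "integrable M (\<lambda>\<omega>. L a \<omega>)" "expectation (\<lambda>\<omega>. L a \<omega>) = 0" for a
    using int1 mean by (auto simp: L_def)
  have Pt: "integrable M (\<lambda>\<omega>. P a \<omega> * t j \<omega>)" "expectation (\<lambda>\<omega>. P a \<omega> * t j \<omega>) = s * a j" if j: "j \<in> I" for a j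
  proof -
    \<comment> \<open>These coefficients merge the extra \<open>t\<^sub>j\<close> into the factor of the product with index \<open>j\<close>.\<close>
    define x y z where "x i = (if i = j then 0 else 1 :: real)" and "y i = (if i = j then 1 else a i)"
      and "z i = (if i = j then a i else 0)" for i
    have "P a \<omega> * t j \<omega> = (\<Prod>i\<in>I. x i + y i * t i \<omega> + z i * (t i \<omega>)\<^sup>2)" for \<omega>
    proof -
      have "P a \<omega> * t j \<omega> = P a \<omega> * (\<Prod>i\<in>I. if i = j then t i \<omega> else 1)"
        using fin j by simp
      also have "\<dots> = (\<Prod>i\<in>I. x i + y i * t i \<omega> + z i * (t i \<omega>)\<^sup>2)"
        unfolding P_def prod.distrib[symmetric]
        by (intro prod.cong refl) (simp add: x_def y_def z_def power2_eq_square algebra_simps)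
      finally show ?thesis .
    qed
    moreover have "(\<Prod>i\<in>I. x i + z i * s) = (\<Prod>i\<in>I. if i = j then a i * s else 1)"
      by (intro prod.cong refl) (simp add: x_def z_def)
    ultimately show "integrable M (\<lambda>\<omega>. P a \<omega> * t j \<omega>)" "expectation (\<lambda>\<omega>. P a \<omega> * t j \<omega>) = s * a j"
      using general[of x y z] fin j by (auto simp: mult_ac)
  qed
  have PL: "integrable M (\<lambda>\<omega>. P a \<omega> * L c \<omega>)" "expectation (\<lambda>\<omega>. P a \<omega> * L c \<omega>) = s * (\<Sum>i\<in>I. a i * c i)" for a c
  proof -
    have e: "P a \<omega> * L c \<omega> = (\<Sum>j\<in>I. c j * (P a \<omega> * t j \<omega>))" for \<omega>
      by (simp add: L_def sum_distrib_left mult_ac)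
    show "integrable M (\<lambda>\<omega>. P a \<omega> * L c \<omega>)" unfolding e using Pt(1) by auto
    have "expectation (\<lambda>\<omega>. \<Sum>j\<in>I. c j * (P a \<omega> * t j \<omega>)) = (\<Sum>j\<in>I. c j * (s * a j))"
      by (subst Bochner_Integration.integral_sum) (auto simp: Pt)
    then show "expectation (\<lambda>\<omega>. P a \<omega> * L c \<omega>) = s * (\<Sum>i\<in>I. a i * c i)"
      unfolding e by (simp add: sum_distrib_left mult_ac)
  qed
  have LL: "integrable M (\<lambda>\<omega>. L a \<omega> * L c \<omega>)" "expectation (\<lambda>\<omega>. L a \<omega> * L c \<omega>) = s * (\<Sum>i\<in>I. a i * c i)"
    unfolding L_def using covariance_indep_linear_forms[OF fin ind int2 mean var, of a c] by blast+
  have expand: "D a \<omega> * D c \<omega> = P a \<omega> * P c \<omega> - P a \<omega> * L c \<omega> - P c \<omega> * L a \<omega> + L a \<omega> * L c \<omega>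
      - P a \<omega> - P c \<omega> + L a \<omega> + L c \<omega> + 1" for \<omega>
    unfolding D_def P_def[symmetric] L_def[symmetric] by (simp add: algebra_simps)
  show "integrable M (\<lambda>\<omega>. D a \<omega> * D c \<omega>)" unfolding expand using PP PL LL P1 L1 by auto
  show "expectation (\<lambda>\<omega>. D a \<omega> * D c \<omega>)
      = (\<Prod>i\<in>I. 1 + s * (a i * c i)) - 1 - s * (\<Sum>i\<in>I. a i * c i)"
    unfolding expand using PP PL LL P1 L1 by (simp add: prob_space mult_ac)
qed

end

section \<open>Replicas and the factorisation of the partition function\<close>

text \<open>
  The probability of \<open>\<sigma>\<close> when the spins are independent with mean \<open>m\<close>.
\<close>

definition site_weight :: "real \<Rightarrow> nat \<Rightarrow> (nat \<Rightarrow> real) \<Rightarrow> real" where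
  "site_weight m N \<sigma> = (\<Prod>k\<in>{1..N}. (1 + m * \<sigma> k) / 2)"

lemma sum_site_weight: "(\<Sum>\<sigma>\<in>spin_configs N. site_weight m N \<sigma>) = 1"
  unfolding site_weight_def using sum_spin_configs_prod[where N=N and f="\<lambda>k x. (1 + m * x) / 2"]
  by (simp add: add_divide_distrib[symmetric])

lemma sum_site_weight_spin_product:
  assumes "is \<in> index_tuples N p"
  shows "(\<Sum>\<sigma>\<in>spin_configs N. site_weight m N \<sigma> * spin_product \<sigma> is) = m ^ p"
proof -
  have sub: "set is \<subseteq> {1..N}" and card: "card (set is) = p"
    using assms by (auto simp: index_tuples_def strict_sorted_iff distinct_card)
  define f where "f k x = (1 + m * x) / 2 * (if k \<in> set is then x else 1)" for k :: nat and x
  have "site_weight m N \<sigma> * spin_product \<sigma> is = (\<Prod>k\<in>{1..N}. f k (\<sigma> k))" for \<sigma>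
  proof -
    have "(\<Prod>k\<in>set is. \<sigma> k) = (\<Prod>k\<in>{1..N}. if k \<in> set is then \<sigma> k else 1)"
      using sub by (subst prod.inter_restrict[symmetric]) (auto simp: Int_absorb1)
    then show ?thesis
      by (simp only: spin_product_set[OF assms] site_weight_def f_def prod.distrib)
  qed
  then have "(\<Sum>\<sigma>\<in>spin_configs N. site_weight m N \<sigma> * spin_product \<sigma> is) = (\<Prod>k\<in>{1..N}. f k (-1) + f k 1)"
    by (simp only: sum_spin_configs_prod)
  also have "\<dots> = (\<Prod>k\<in>{1..N}. if k \<in> set is then m else 1)"
    by (intro prod.cong refl) (auto simp: f_def field_simps)
  also have "\<dots> = (\<Prod>k\<in>{1..N} \<inter> set is. m)" by (rule prod.inter_restrict[symmetric]) simp
  also have "{1..N} \<inter> set is = set is" using sub by auto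
  finally show ?thesis using card by simp
qed

text \<open>
  The sitewise product of two independent families of independent spins of mean \<open>m\<close> is a family
  of independent spins of mean \<open>m\<^sup>2\<close>. For a fixed first replica the product runs once through all
  configurations, so the sum over the first replica can be carried out site by site.
\<close>

lemma replica_overlap_sum:
  assumes G: "\<And>\<sigma> \<tau>. (\<And>k. k \<in> {1..N} \<Longrightarrow> \<sigma> k = \<tau> k) \<Longrightarrow> G \<sigma> = G \<tau>"
  shows "(\<Sum>\<sigma>\<in>spin_configs N. \<Sum>\<tau>\<in>spin_configs N.
      site_weight m N \<sigma> * site_weight m N \<tau> * G (\<lambda>k. \<sigma> k * \<tau> k))
    = spin_avg N (\<lambda>\<epsilon>. (\<Prod>k\<in>{1..N}. 1 + m\<^sup>2 * \<epsilon> k) * G \<epsilon>)"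
proof -
  define T where "T \<sigma> \<tau> = (\<lambda>k. if k \<in> {1..N} then \<sigma> k * \<tau> k else undefined :: real)" for \<sigma> \<tau> :: "nat \<Rightarrow> real"
  have T: "T \<sigma> \<tau> \<in> spin_configs N" "T \<sigma> (T \<sigma> \<tau>) = \<tau>"
    if "\<sigma> \<in> spin_configs N" "\<tau> \<in> spin_configs N" for \<sigma> \<tau>
  proof -
    show "T \<sigma> \<tau> \<in> spin_configs N"
      using spin_values[OF that(1)] spin_values[OF that(2)]
      unfolding spin_configs_def T_def by (fastforce simp: PiE_iff extensional_def)
    show "T \<sigma> (T \<sigma> \<tau>) = \<tau>"
    proof
      fix k
      show "T \<sigma> (T \<sigma> \<tau>) k = \<tau> k"
      proof (cases "k \<in> {1..N}")
        case True
        then show ?thesis using spin_square[OF that(1) True]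
          by (simp add: T_def power2_eq_square mult.assoc[symmetric])
      next
        case False
        then show ?thesis using that(2) unfolding spin_configs_def T_def
          by (auto simp: PiE_iff extensional_def)
      qed
    qed
  qed
  have inner: "(\<Sum>\<tau>\<in>spin_configs N. site_weight m N \<sigma> * site_weight m N \<tau> * G (\<lambda>k. \<sigma> k * \<tau> k))
      = (\<Sum>\<epsilon>\<in>spin_configs N. site_weight m N \<sigma> * site_weight m N (T \<sigma> \<epsilon>) * G \<epsilon>)"
    if \<sigma>: "\<sigma> \<in> spin_configs N" for \<sigma>
  proof (rule sum.reindex_bij_witness[where i="T \<sigma>" and j="T \<sigma>"])
    fix \<tau> assume \<tau>: "\<tau> \<in> spin_configs N"
    show "T \<sigma> (T \<sigma> \<tau>) = \<tau>" "T \<sigma> \<tau> \<in> spin_configs N" using T[OF \<sigma> \<tau>] by auto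
    have "G (T \<sigma> \<tau>) = G (\<lambda>k. \<sigma> k * \<tau> k)" by (rule G) (simp add: T_def)
    then show "site_weight m N \<sigma> * site_weight m N (T \<sigma> (T \<sigma> \<tau>)) * G (T \<sigma> \<tau>)
        = site_weight m N \<sigma> * site_weight m N \<tau> * G (\<lambda>k. \<sigma> k * \<tau> k)"
      using T[OF \<sigma> \<tau>] by simp
  next
    fix \<epsilon> assume "\<epsilon> \<in> spin_configs N"
    then show "T \<sigma> (T \<sigma> \<epsilon>) = \<epsilon>" "T \<sigma> \<epsilon> \<in> spin_configs N" using T[OF \<sigma>] by auto
  qed
  have pair: "(\<Sum>\<sigma>\<in>spin_configs N. site_weight m N \<sigma> * site_weight m N (T \<sigma> \<epsilon>))
      = (\<Prod>k\<in>{1..N}. 1 + m\<^sup>2 * \<epsilon> k) / 2 ^ N" for \<epsilon>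
  proof -
    define f where "f k x = (1 + m * x) / 2 * ((1 + m * (x * \<epsilon> k)) / 2)" for k x
    have "site_weight m N \<sigma> * site_weight m N (T \<sigma> \<epsilon>) = (\<Prod>k\<in>{1..N}. f k (\<sigma> k))" for \<sigma>
      unfolding site_weight_def f_def prod.distrib by (simp add: T_def)
    then have "(\<Sum>\<sigma>\<in>spin_configs N. site_weight m N \<sigma> * site_weight m N (T \<sigma> \<epsilon>))
        = (\<Prod>k\<in>{1..N}. f k (-1) + f k 1)" by (simp only: sum_spin_configs_prod)
    also have "\<dots> = (\<Prod>k\<in>{1..N}. (1 + m\<^sup>2 * \<epsilon> k) / 2)"
      by (intro prod.cong refl) (simp add: f_def field_simps power2_eq_square)
    finally show ?thesis by (simp add: prod_dividef)
  qed
  have "(\<Sum>\<sigma>\<in>spin_configs N. \<Sum>\<tau>\<in>spin_configs N.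
      site_weight m N \<sigma> * site_weight m N \<tau> * G (\<lambda>k. \<sigma> k * \<tau> k))
    = (\<Sum>\<sigma>\<in>spin_configs N. \<Sum>\<epsilon>\<in>spin_configs N. site_weight m N \<sigma> * site_weight m N (T \<sigma> \<epsilon>) * G \<epsilon>)"
    by (intro sum.cong refl inner)
  also have "\<dots> = (\<Sum>\<epsilon>\<in>spin_configs N. (\<Sum>\<sigma>\<in>spin_configs N. site_weight m N \<sigma> * site_weight m N (T \<sigma> \<epsilon>)) * G \<epsilon>)"
    by (subst sum.swap) (simp add: sum_distrib_right)
  also have "\<dots> = spin_avg N (\<lambda>\<epsilon>. (\<Prod>k\<in>{1..N}. 1 + m\<^sup>2 * \<epsilon> k) * G \<epsilon>)"
    unfolding pair spin_avg_def by (simp add: sum_divide_distrib)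
  finally show ?thesis .
qed

text \<open>
  What is left of the partition function after the hyperbolic cosines are factored out, with
  \<open>m = tanh h\<close> and \<open>t = tanh (b J)\<close>.
\<close>

definition reduced_partition :: "real \<Rightarrow> nat \<Rightarrow> nat \<Rightarrow> (nat list \<Rightarrow> real) \<Rightarrow> real" where
  "reduced_partition m p N t =
     (\<Sum>\<sigma>\<in>spin_configs N. site_weight m N \<sigma> * (\<Prod>is\<in>index_tuples N p. 1 + t is * spin_product \<sigma> is))"

lemma exp_mult_sign:
  fixes x s :: real
  assumes "s = -1 \<or> s = 1"
  shows "exp (x * s) = cosh x * (1 + tanh x * s)"
proof -
  have "cosh x * (1 + tanh x * s) = cosh x + sinh x * s" by (simp add: tanh_def field_simps)
  then show ?thesis using assms cosh_plus_sinh[of x] cosh_minus_sinh[of x] by auto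
qed

text \<open>
  The high-temperature expansion: \<open>exp (x s) = cosh x (1 + s tanh x)\<close> for a sign \<open>s\<close>, applied to
  every spin and every spin product.
\<close>

lemma partition_function_factor:
  "partition_function p N g \<beta> h
    = (2 * cosh h) ^ N * (\<Prod>is\<in>index_tuples N p. cosh (\<beta> * real N powr (- ((real p - 1) / 2)) * g is))
      * reduced_partition (tanh h) p N (\<lambda>is. tanh (\<beta> * real N powr (- ((real p - 1) / 2)) * g is))"
proof -
  define b where "b = \<beta> * real N powr (- ((real p - 1) / 2))"
  have "exp (b * (\<Sum>is\<in>index_tuples N p. g is * spin_product \<sigma> is) + h * (\<Sum>i=1..N. \<sigma> i))
     = ((2 * cosh h) ^ N * (\<Prod>is\<in>index_tuples N p. cosh (b * g is)))
        * (site_weight (tanh h) N \<sigma> * (\<Prod>is\<in>index_tuples N p. 1 + tanh (b * g is) * spin_product \<sigma> is))"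
    if \<sigma>: "\<sigma> \<in> spin_configs N" for \<sigma>
  proof -
    have "exp (h * (\<Sum>i=1..N. \<sigma> i)) = (\<Prod>k\<in>{1..N}. exp (h * \<sigma> k))"
      by (simp add: sum_distrib_left exp_sum)
    also have "\<dots> = (\<Prod>k\<in>{1..N}. 2 * cosh h * ((1 + tanh h * \<sigma> k) / 2))"
      using spin_values[OF \<sigma>] by (intro prod.cong refl) (simp add: exp_mult_sign)
    also have "\<dots> = (2 * cosh h) ^ N * site_weight (tanh h) N \<sigma>"
      unfolding prod.distrib site_weight_def by simp
    finally have 1: "exp (h * (\<Sum>i=1..N. \<sigma> i)) = (2 * cosh h) ^ N * site_weight (tanh h) N \<sigma>" .
    have "exp (b * (\<Sum>is\<in>index_tuples N p. g is * spin_product \<sigma> is))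
       = (\<Prod>is\<in>index_tuples N p. exp (b * g is * spin_product \<sigma> is))"
      using finite_index_tuples by (simp add: sum_distrib_left exp_sum mult.assoc)
    also have "\<dots> = (\<Prod>is\<in>index_tuples N p. cosh (b * g is) * (1 + tanh (b * g is) * spin_product \<sigma> is))"
      using spin_product_values[OF \<sigma>] by (intro prod.cong refl exp_mult_sign)
    finally show ?thesis unfolding exp_add 1 prod.distrib by simp
  qed
  then show ?thesis
    unfolding partition_function_def reduced_partition_def b_def[symmetric]
    by (simp add: sum_distrib_left)
qed

lemma site_weight_pos:
  assumes "\<bar>m\<bar> < 1" "\<sigma> \<in> spin_configs N"
  shows "0 < site_weight m N \<sigma>"
  unfolding site_weight_def
proof (rule prod_pos)
  fix k assume "k \<in> {1..N}"
  then show "0 < (1 + m * \<sigma> k) / 2" using spin_values[OF assms(2)] assms(1) by force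
qed

lemma reduced_partition_pos:
  assumes "\<bar>m\<bar> < 1" "\<And>is. \<bar>t is\<bar> < 1"
  shows "0 < reduced_partition m p N t"
  unfolding reduced_partition_def
proof (rule sum_pos[OF finite_spin_configs])
  have "(\<lambda>k. if k \<in> {1..N} then 1 else undefined) \<in> spin_configs N"
    unfolding spin_configs_def by (auto simp: PiE_iff extensional_def)
  then show "spin_configs N \<noteq> {}" by blast
  fix \<sigma> assume \<sigma>: "\<sigma> \<in> spin_configs N"
  have "0 < (\<Prod>is\<in>index_tuples N p. 1 + t is * spin_product \<sigma> is)"
  proof (rule prod_pos)
    fix "is" assume "is \<in> index_tuples N p"
    then show "0 < 1 + t is * spin_product \<sigma> is"
      using spin_product_values[OF \<sigma>] assms(2)[of "is"] by force
  qed
  then show "0 < site_weight m N \<sigma> * (\<Prod>is\<in>index_tuples N p. 1 + t is * spin_product \<sigma> is)"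
    using site_weight_pos[OF assms(1) \<sigma>] by simp
qed

text \<open>
  Squaring \<open>W\<close> introduces a second replica. The disorder average of a pair of replicas depends only
  on their sitewise product, which is then averaged by \<open>replica_overlap_sum\<close>.
\<close>

lemma (in prob_space) reduced_partition_second_moment:
  fixes t :: "nat list \<Rightarrow> 'a \<Rightarrow> real" and m :: real
  assumes ind: "indep_vars (\<lambda>_. borel) t (index_tuples N p)"
    and bnd: "\<And>is \<omega>. is \<in> index_tuples N p \<Longrightarrow> \<bar>t is \<omega>\<bar> \<le> 1"
    and mean: "\<And>is. is \<in> index_tuples N p \<Longrightarrow> expectation (t is) = 0"
    and var: "\<And>is. is \<in> index_tuples N p \<Longrightarrow> expectation (\<lambda>\<omega>. (t is \<omega>)\<^sup>2) = s"
  defines "W \<equiv> \<lambda>\<omega>. reduced_partition m p N (\<lambda>is. t is \<omega>) - 1 - m ^ p * (\<Sum>is\<in>index_tuples N p. t is \<omega>)"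
  shows "integrable M (\<lambda>\<omega>. (W \<omega>)\<^sup>2)"
    and "expectation (\<lambda>\<omega>. (W \<omega>)\<^sup>2) = overlap_remainder N p s (m\<^sup>2)"
proof -
  let ?I = "index_tuples N p" and ?S = "spin_configs N" and ?w = "site_weight m N"
  define D where "D a \<omega> = (\<Prod>is\<in>?I. 1 + t is \<omega> * a is) - 1 - (\<Sum>is\<in>?I. t is \<omega> * a is)" for a :: "nat list \<Rightarrow> real" and \<omega>
  have W: "W \<omega> = (\<Sum>\<sigma>\<in>?S. ?w \<sigma> * D (spin_product \<sigma>) \<omega>)" for \<omega>
  proof -
    have "(\<Sum>\<sigma>\<in>?S. ?w \<sigma> * (\<Sum>is\<in>?I. t is \<omega> * spin_product \<sigma> is))
        = (\<Sum>is\<in>?I. t is \<omega> * (\<Sum>\<sigma>\<in>?S. ?w \<sigma> * spin_product \<sigma> is))"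
      unfolding sum_distrib_left by (subst sum.swap) (simp add: mult_ac)
    also have "\<dots> = (\<Sum>is\<in>?I. t is \<omega> * m ^ p)"
      by (intro sum.cong refl) (simp only: sum_site_weight_spin_product)
    also have "\<dots> = m ^ p * (\<Sum>is\<in>?I. t is \<omega>)"
      by (simp add: sum_distrib_left mult.commute)
    finally show ?thesis
      unfolding W_def D_def reduced_partition_def
      by (simp add: right_diff_distrib sum_subtractf sum_site_weight)
  qed
  have sq: "(W \<omega>)\<^sup>2 = (\<Sum>\<sigma>\<in>?S. \<Sum>\<tau>\<in>?S. (?w \<sigma> * ?w \<tau>) * (D (spin_product \<sigma>) \<omega> * D (spin_product \<tau>) \<omega>))" for \<omega>
    unfolding W power2_eq_square sum_product by (simp add: mult_ac)
  have DD: "integrable M (\<lambda>\<omega>. D a \<omega> * D c \<omega>)"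
    "expectation (\<lambda>\<omega>. D a \<omega> * D c \<omega>) = (\<Prod>is\<in>?I. 1 + s * (a is * c is)) - 1 - s * (\<Sum>is\<in>?I. a is * c is)" for a c
    unfolding D_def by (rule second_order_remainder_covariance[OF finite_index_tuples ind bnd mean var]; assumption)+
  show "integrable M (\<lambda>\<omega>. (W \<omega>)\<^sup>2)"
    unfolding sq using DD(1) by auto
  define G where "G \<epsilon> = (\<Prod>is\<in>?I. 1 + s * spin_product \<epsilon> is) - 1 - s * (\<Sum>is\<in>?I. spin_product \<epsilon> is)" for \<epsilon> :: "nat \<Rightarrow> real"
  have "expectation (\<lambda>\<omega>. (W \<omega>)\<^sup>2)
     = (\<Sum>\<sigma>\<in>?S. \<Sum>\<tau>\<in>?S. (?w \<sigma> * ?w \<tau>) * expectation (\<lambda>\<omega>. D (spin_product \<sigma>) \<omega> * D (spin_product \<tau>) \<omega>))"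
    unfolding sq using DD(1) by (subst Bochner_Integration.integral_sum; simp add: Bochner_Integration.integral_sum)
  also have "\<dots> = (\<Sum>\<sigma>\<in>?S. \<Sum>\<tau>\<in>?S. ?w \<sigma> * ?w \<tau> * G (\<lambda>k. \<sigma> k * \<tau> k))"
    unfolding DD(2) G_def by (simp add: spin_product_def prod.distrib)
  also have "\<dots> = spin_avg N (\<lambda>\<epsilon>. (\<Prod>k\<in>{1..N}. 1 + m\<^sup>2 * \<epsilon> k) * G \<epsilon>)"
  proof (rule replica_overlap_sum)
    fix \<sigma> \<tau> :: "nat \<Rightarrow> real" assume eq: "\<And>k. k \<in> {1..N} \<Longrightarrow> \<sigma> k = \<tau> k"
    have "spin_product \<sigma> is = spin_product \<tau> is" if "is \<in> ?I" for "is"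
    proof -
      have "set is \<subseteq> {1..N}" using that by (auto simp: index_tuples_def)
      then show ?thesis unfolding spin_product_set[OF that] by (intro prod.cong refl eq) auto
    qed
    then show "G \<sigma> = G \<tau>" unfolding G_def by simp
  qed
  finally show "expectation (\<lambda>\<omega>. (W \<omega>)\<^sup>2) = overlap_remainder N p s (m\<^sup>2)"
    unfolding G_def overlap_remainder_def .
qed

section \<open>Hermite polynomials under the Gaussian law\<close>

definition gauss_mean :: "real poly \<Rightarrow> real" where
  "gauss_mean q = (\<integral>x. poly q x \<partial>std_normal_distribution)"

lemma integrable_poly_gauss: "integrable std_normal_distribution (\<lambda>x. poly q x)"
  unfolding poly_altdef using integrable_std_normal_distribution_moment by auto

lemma gauss_mean_add: "gauss_mean (p + q) = gauss_mean p + gauss_mean q"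
  unfolding gauss_mean_def poly_add
  by (intro Bochner_Integration.integral_add integrable_poly_gauss)

lemma gauss_mean_smult: "gauss_mean (smult c q) = c * gauss_mean q"
  unfolding gauss_mean_def poly_smult by (rule integral_mult_right_zero)

lemma gauss_mean_diff: "gauss_mean (p - q) = gauss_mean p - gauss_mean q"
  unfolding gauss_mean_def poly_diff
  by (intro Bochner_Integration.integral_diff integrable_poly_gauss)

lemma gauss_mean_monom_Suc: "gauss_mean (monom a (Suc n)) = gauss_mean (pderiv (monom a n))"
proof -
  define m where "m k = (\<integral>x. x ^ k \<partial>std_normal_distribution)" for k
  have mon: "gauss_mean (monom c k) = c * m k" for c k
    by (simp add: gauss_mean_def m_def poly_monom)
  have "m (Suc n) = real n * m (n - 1)"
  proof (cases "even n")
    case True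
    then have "m (Suc n) = 0" unfolding m_def by (intro integral_std_normal_distribution_moment_odd) simp
    moreover have "real n * m (n - 1) = 0"
      unfolding m_def using True integral_std_normal_distribution_moment_odd[of "n - 1"] by (cases n) auto
    ultimately show ?thesis by simp
  next
    case False
    then obtain k where n: "n = Suc (2 * k)" by (auto elim!: oddE)
    have "m (Suc n) = fact (2 * Suc k) / (2 ^ Suc k * fact (Suc k))"
      unfolding m_def n using std_normal_distribution_even_moments(1)[of "Suc k"] by simp
    also have "\<dots> = real n * (fact (2 * k) / (2 ^ k * fact k))"
    proof -
      define F G Q where "F = (fact (2 * k) :: real)" and "G = (fact k :: real)" and "Q = (2 :: real) ^ k"
      have pos: "F > 0" "G > 0" "Q > 0" "real k + 1 > 0" by (auto simp: F_def G_def Q_def)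
      have f: "(fact (2 * Suc k) :: real) = 2 * (real k + 1) * ((2 * real k + 1) * F)"
        "(fact (Suc k) :: real) = (real k + 1) * G" "(2 :: real) ^ Suc k = 2 * Q" "real n = 2 * real k + 1"
        by (simp_all add: F_def G_def Q_def n algebra_simps)
      have "2 * (real k + 1) * ((2 * real k + 1) * F) / (2 * Q * ((real k + 1) * G))
          = (2 * (real k + 1)) * ((2 * real k + 1) * F) / ((2 * (real k + 1)) * (Q * G))"
        by (simp add: mult_ac)
      also have "\<dots> = (2 * real k + 1) * F / (Q * G)"
        using pos by (subst mult_divide_mult_cancel_left) auto
      finally show ?thesis unfolding f by (simp add: F_def G_def Q_def)
    qed
    also have "\<dots> = real n * m (n - 1)"
      unfolding m_def n using std_normal_distribution_even_moments(1)[of k] by simp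
    finally show ?thesis .
  qed
  then show ?thesis by (simp add: pderiv_monom mon)
qed

text \<open>
  Gaussian integration by parts. On monomials it is the recurrence of the moments; induction on the
  polynomial needs the extra power of the variable in the auxiliary statement.
\<close>

lemma gauss_mean_stein: "gauss_mean ([:0, 1:] * q) = gauss_mean (pderiv q)"
proof -
  have gen: "gauss_mean (monom 1 (Suc n) * q) = gauss_mean (pderiv (monom 1 n * q))" for n
  proof (induction q arbitrary: n)
    case 0
    then show ?case by simp
  next
    case (pCons a q)
    have split: "monom 1 k * pCons a q = monom a k + monom 1 (Suc k) * q" for k
    proof -
      have "pCons a q = [:a:] + monom 1 (Suc 0) * q" by (simp add: monom_Suc monom_0)
      then show ?thesis by (simp add: distrib_left mult_monom mult.assoc[symmetric] smult_monom)
    qed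
    show ?case
      unfolding split gauss_mean_add pderiv_add gauss_mean_monom_Suc pCons.IH[of "Suc n"] ..
  qed
  show ?thesis using gen[of 0] by (simp add: monom_Suc monom_0)
qed

lemma pderiv_hermite: "pderiv (hermite (Suc n)) = smult (real (Suc n)) (hermite n)"
proof (induction n rule: less_induct)
  case (less n)
  consider "n = 0" | "n = Suc 0" | k where "n = Suc (Suc k)" by (metis not0_implies_Suc)
  then show ?case
  proof cases
    case 1
    then show ?thesis by (simp add: pderiv_pCons)
  next
    case 2
    then show ?thesis by (simp add: pderiv_pCons pderiv_mult pderiv_diff pderiv_smult)
  next
    case 3
    have IH: "pderiv (hermite (Suc (Suc k))) = smult (real (Suc (Suc k))) (hermite (Suc k))"
      "pderiv (hermite (Suc k)) = smult (real (Suc k)) (hermite k)"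
      using less[of "Suc k"] less[of k] 3 by auto
    have "pderiv (hermite (Suc n)) = hermite (Suc (Suc k))
       + [:0, 1:] * pderiv (hermite (Suc (Suc k))) - smult (real (Suc (Suc k))) (pderiv (hermite (Suc k)))"
      unfolding 3 hermite.simps(3)[of "Suc k"] pderiv_diff pderiv_mult pderiv_smult
      by (simp add: pderiv_pCons del: hermite.simps)
    also have "\<dots> = hermite (Suc (Suc k)) + smult (real (Suc (Suc k)))
         ([:0, 1:] * hermite (Suc k) - smult (real (Suc k)) (hermite k))"
      unfolding IH by (simp add: smult_diff_right mult_smult_right del: hermite.simps)
    also have "\<dots> = smult (1 + real (Suc (Suc k))) (hermite (Suc (Suc k)))"
      unfolding hermite.simps(3)[symmetric] smult_add_left smult_1_left ..
    also have "\<dots> = smult (real (Suc n)) (hermite n)" by (simp add: 3 del: hermite.simps)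
    finally show ?thesis .
  qed
qed

lemma hermite_Suc: "hermite (Suc n) = [:0, 1:] * hermite n - pderiv (hermite n)"
  by (cases n) (simp_all add: pderiv_hermite del: mult_pCons_left)

text \<open>
  As \<open>H\<^sub>n\<^sub>+\<^sub>1 = x H\<^sub>n - H\<^sub>n'\<close>, integration by parts moves one factor onto the derivative
  \<open>H\<^sub>n\<^sub>+\<^sub>1' = (n + 1) H\<^sub>n\<close>.
\<close>

lemma gauss_mean_hermite_square: "gauss_mean (hermite n * hermite n) = fact n"
proof (induction n)
  case 0
  interpret prob_space std_normal_distribution using real_dist_normal_dist by (simp add: real_distribution_def)
  show ?case using prob_space by (simp add: gauss_mean_def)
next
  case (Suc n)
  have "gauss_mean (hermite (Suc n) * hermite (Suc n))
      = gauss_mean ([:0, 1:] * (hermite n * hermite (Suc n)) - pderiv (hermite n) * hermite (Suc n))"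
    by (subst (1) hermite_Suc) (simp only: left_diff_distrib mult.assoc)
  also have "\<dots> = gauss_mean (hermite n * pderiv (hermite (Suc n)))"
    unfolding gauss_mean_diff gauss_mean_stein pderiv_mult gauss_mean_add by (simp only: mult.commute)
  also have "\<dots> = real (Suc n) * fact n"
    unfolding pderiv_hermite mult_smult_right gauss_mean_smult Suc.IH ..
  finally show ?case by simp
qed

lemma v1p_sq_eq: "v1p_sq p \<beta> \<rho> = \<beta>\<^sup>2 * \<rho> ^ (2 * p) / fact p"
proof -
  have f: "(fact p :: real) > 0" by simp
  have "(\<integral>\<eta>. poly (hermite p) \<eta> / sqrt (fact p) * poly (hermite p) \<eta> \<partial>std_normal_distribution)
      = (\<integral>\<eta>. poly (hermite p * hermite p) \<eta> / sqrt (fact p) \<partial>std_normal_distribution)"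
    by (simp add: field_simps)
  also have "\<dots> = fact p / sqrt (fact p)"
    using gauss_mean_hermite_square[of p] by (simp add: gauss_mean_def)
  also have "\<dots> = sqrt (fact p)" using f by (simp add: real_div_sqrt)
  finally have e: "(\<integral>\<eta>. poly (hermite p) \<eta> / sqrt (fact p) * poly (hermite p) \<eta> \<partial>std_normal_distribution) = sqrt (fact p)" .
  have "(fact p :: real) powr (3/2) = fact p powr (1 + 1/2)" by simp
  also have "\<dots> = fact p * sqrt (fact p)" using f by (subst powr_add) (simp add: powr_half_sqrt)
  finally show ?thesis unfolding v1p_sq_def e using f by simp
qed

section \<open>Characteristic functions of row sums\<close>

lemma char_power_limit:
  assumes \<mu>: "real_distribution \<mu>"
    and int: "integrable \<mu> (\<lambda>x. x)" "integrable \<mu> (\<lambda>x. x\<^sup>2)"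
    and mean: "(\<integral>x. x \<partial>\<mu>) = 0" and var: "(\<integral>x. x\<^sup>2 \<partial>\<mu>) = v"
  shows "(\<lambda>n. char \<mu> (t / sqrt (real n)) ^ n) \<longlonglongrightarrow> complex_of_real (exp (- (t\<^sup>2 * v) / 2))"
proof -
  interpret \<mu>: real_distribution \<mu> by fact
  have v0: "0 \<le> v" unfolding var[symmetric] by (intro integral_nonneg_AE) auto
  let ?w = "\<lambda>n. 1 + (- (t\<^sup>2 * v) / 2) / real n"
  let ?m = "\<lambda>n x. min (6 * x\<^sup>2) (\<bar>t / sqrt (real n)\<bar> * \<bar>x\<bar> ^ 3)"
  let ?R = "\<lambda>n. LINT x|\<mu>. ?m n x" and ?lim = "complex_of_real (exp (- (t\<^sup>2 * v) / 2))"
  have main: "\<forall>\<^sub>F n in sequentially. cmod (char \<mu> (t / sqrt (real n)) ^ n - complex_of_real (?w n ^ n)) \<le> t\<^sup>2 / 6 * ?R n"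
  proof (rule eventually_sequentiallyI)
    fix n :: nat assume "n \<ge> max 1 (nat \<lceil>t\<^sup>2 * v / 4\<rceil>)"
    then have n: "n \<ge> 1" "real n \<ge> t\<^sup>2 * v / 4" by (auto simp: nat_ceiling_le_eq)
    let ?t = "t / sqrt (real n)"
    have "cmod (char \<mu> ?t - (1 - ?t\<^sup>2 * v / 2)) \<le> ?t\<^sup>2 / 6 * ?R n"
      by (rule \<mu>.char_approx3) (use int mean var in auto)
    moreover have "?t\<^sup>2 = t\<^sup>2 / real n" by (simp add: power_divide)
    ultimately have b: "cmod (char \<mu> ?t - complex_of_real (?w n)) \<le> t\<^sup>2 / real n / 6 * ?R n"
      by (simp add: mult.commute)
    have "cmod (char \<mu> ?t ^ n - complex_of_real (?w n) ^ n) \<le> real n * cmod (char \<mu> ?t - complex_of_real (?w n))"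
    proof (rule norm_power_diff)
      show "cmod (char \<mu> ?t) \<le> 1" by (rule \<mu>.cmod_char_le_1)
      have "\<bar>?w n\<bar> \<le> 1"
      proof -
        have "0 \<le> t\<^sup>2 * v / 2 / real n" using v0 by simp
        moreover have "t\<^sup>2 * v / 2 / real n \<le> 2" using n by (simp add: field_simps)
        ultimately show ?thesis by (simp add: abs_le_iff)
      qed
      then show "cmod (complex_of_real (?w n)) \<le> 1" by (simp only: norm_of_real)
    qed
    also have "\<dots> \<le> real n * (t\<^sup>2 / real n / 6 * ?R n)" by (intro mult_left_mono b) simp
    also have "\<dots> = t\<^sup>2 / 6 * ?R n" using n by simp
    finally show "cmod (char \<mu> ?t ^ n - complex_of_real (?w n ^ n)) \<le> t\<^sup>2 / 6 * ?R n" by simp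
  qed
  have "(\<lambda>n. ?m n x) \<longlonglongrightarrow> 0" for x :: real
  proof -
    have "(\<lambda>n. \<bar>t / sqrt (real n)\<bar> * \<bar>x\<bar> ^ 3) \<longlonglongrightarrow> \<bar>0\<bar> * \<bar>x\<bar> ^ 3"
      by (intro tendsto_intros tendsto_divide_0[OF tendsto_const] filterlim_at_top_imp_at_infinity
          filterlim_compose[OF sqrt_at_top filterlim_real_sequentially])
    then have "(\<lambda>n. ?m n x) \<longlonglongrightarrow> min (6 * x\<^sup>2) (\<bar>0\<bar> * \<bar>x\<bar> ^ 3)"
      by (intro tendsto_min tendsto_const)
    then show ?thesis by simp
  qed
  moreover have "AE x in \<mu>. norm (?m n x) \<le> 6 * x\<^sup>2" for n
    by (rule AE_I2) (simp add: min_def)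
  ultimately have "?R \<longlonglongrightarrow> (LINT x|\<mu>. 0)"
    using int(2) by (intro integral_dominated_convergence[where w = "\<lambda>x. 6 * x\<^sup>2"] AE_I2) simp_all
  then have "(\<lambda>n. t\<^sup>2 / 6 * ?R n) \<longlonglongrightarrow> 0" by (simp only: integral_zero tendsto_mult_right_zero)
  moreover have "(\<lambda>n. complex_of_real (?w n ^ n)) \<longlonglongrightarrow> ?lim"
    by (intro tendsto_of_real tendsto_exp_limit_sequentially)
  ultimately show ?thesis
    by (intro Lim_transform[OF _ Lim_null_comparison[OF main]])
qed

text \<open>
  A central limit theorem for rows that live on different probability spaces and share only the
  law of their entries. The variance \<open>v\<close> may be 0.
\<close>

lemma char_row_sum_limit:
  fixes g :: "nat \<Rightarrow> 'i \<Rightarrow> 'a \<Rightarrow> real" and J :: "'b \<Rightarrow> real" and \<phi> :: "real \<Rightarrow> real"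
  assumes P: "prob_space P" and J: "J \<in> borel_measurable P"
    and M: "\<And>N. prob_space (M N)"
    and ind: "\<And>N. prob_space.indep_vars (M N) (\<lambda>_. borel) (g N) (I N)"
    and law: "\<And>N i. i \<in> I N \<Longrightarrow> distr (M N) borel (g N i) = distr P borel J"
    and card: "filterlim (\<lambda>N. card (I N)) at_top sequentially"
    and \<phi>: "\<phi> \<in> borel_measurable borel"
    and int: "integrable P (\<lambda>\<omega>. \<phi> (J \<omega>))" "integrable P (\<lambda>\<omega>. (\<phi> (J \<omega>))\<^sup>2)"
    and mean: "(\<integral>\<omega>. \<phi> (J \<omega>) \<partial>P) = 0" and var: "(\<integral>\<omega>. (\<phi> (J \<omega>))\<^sup>2 \<partial>P) = v"
  shows "(\<lambda>N. char (distr (M N) borel (\<lambda>\<omega>. (\<Sum>i\<in>I N. \<phi> (g N i \<omega>) / sqrt (card (I N))))) t)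
     \<longlonglongrightarrow> complex_of_real (exp (- (t\<^sup>2 * v) / 2))"
proof -
  define \<mu> where "\<mu> = distr P borel (\<lambda>\<omega>. \<phi> (J \<omega>))"
  interpret P: prob_space P by fact
  have [measurable]: "J \<in> borel_measurable P" "\<phi> \<in> borel_measurable borel" by fact+
  have \<mu>: "real_distribution \<mu>" unfolding \<mu>_def by (rule P.real_distribution_distr) measurable
  have lim: "(\<lambda>n. char \<mu> (t / sqrt (real n)) ^ n) \<longlonglongrightarrow> complex_of_real (exp (- (t\<^sup>2 * v) / 2))"
    using int mean var by (intro char_power_limit[OF \<mu>]) (simp_all add: \<mu>_def integrable_distr_eq integral_distr)
  have "char (distr (M N) borel (\<lambda>\<omega>. (\<Sum>i\<in>I N. \<phi> (g N i \<omega>) / sqrt (card (I N))))) t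
      = char \<mu> (t / sqrt (card (I N))) ^ card (I N)" for N
  proof -
    interpret M: prob_space "M N" by fact
    let ?n = "card (I N)"
    let ?Y = "\<lambda>i \<omega>. \<phi> (g N i \<omega>) / sqrt ?n" and ?\<psi> = "char \<mu> (t / sqrt ?n)"
    have "char (distr (M N) borel (\<lambda>\<omega>. (\<Sum>i\<in>I N. \<phi> (g N i \<omega>) / sqrt ?n))) t
        = (\<Prod>i\<in>I N. char (distr (M N) borel (?Y i)) t)"
      by (rule M.char_distr_sum) (rule M.indep_vars_compose2[OF ind], measurable)
    also have "\<dots> = (\<Prod>i\<in>I N. ?\<psi>)"
    proof (rule prod.cong[OF refl])
      fix i assume i: "i \<in> I N"
      have [measurable]: "g N i \<in> borel_measurable (M N)"
        using ind[of N] i by (auto simp: M.indep_vars_def)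
      have "char (distr (M N) borel (?Y i)) t
          = (\<integral>\<omega>. iexp (t * (\<phi> (g N i \<omega>) / sqrt ?n)) \<partial>M N)"
        unfolding char_def by (subst integral_distr) auto
      also have "\<dots> = (\<integral>x. iexp (t * (\<phi> x / sqrt ?n)) \<partial>distr (M N) borel (g N i))"
        by (subst integral_distr) auto
      also have "\<dots> = (\<integral>\<omega>. iexp (t * (\<phi> (J \<omega>) / sqrt ?n)) \<partial>P)"
        unfolding law[OF i] by (subst integral_distr) auto
      also have "\<dots> = ?\<psi>"
        unfolding char_def \<mu>_def by (subst integral_distr) auto
      finally show "char (distr (M N) borel (?Y i)) t = ?\<psi>" .
    qed
    finally show ?thesis by simp
  qed
  then show ?thesis using filterlim_compose[OF lim card] by simp
qed

text \<open>
  Allows an error that is small in mean to be combined with one that is only small in probability,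
  the latter being capped at 2.
\<close>

lemma (in prob_space) char_diff_le:
  assumes [measurable]: "X \<in> borel_measurable M" "Y \<in> borel_measurable M"
    and F: "integrable M F" "\<And>\<omega>. \<omega> \<in> space M \<Longrightarrow> min 2 (\<bar>t\<bar> * \<bar>X \<omega> - Y \<omega>\<bar>) \<le> F \<omega>"
  shows "cmod (char (distr M borel X) t - char (distr M borel Y) t) \<le> expectation F"
proof -
  have int: "integrable M (\<lambda>\<omega>. iexp (t * Z \<omega>))" if [measurable]: "Z \<in> borel_measurable M" for Z
    by (intro integrable_const_bound[where B=1]) auto
  have "char (distr M borel X) t - char (distr M borel Y) t = (\<integral>\<omega>. iexp (t * X \<omega>) - iexp (t * Y \<omega>) \<partial>M)"
  proof -
    have "char (distr M borel Z) t = (\<integral>\<omega>. iexp (t * Z \<omega>) \<partial>M)" if [measurable]: "Z \<in> borel_measurable M" for Z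
      unfolding char_def by (subst integral_distr) auto
    then show ?thesis by (simp only: assms(1,2) Bochner_Integration.integral_diff[OF int int])
  qed
  also have "cmod \<dots> \<le> (\<integral>\<omega>. cmod (iexp (t * X \<omega>) - iexp (t * Y \<omega>)) \<partial>M)"
    by (rule integral_norm_bound)
  also have "\<dots> \<le> expectation F"
  proof (rule integral_mono)
    show "integrable M (\<lambda>\<omega>. cmod (iexp (t * X \<omega>) - iexp (t * Y \<omega>)))"
      using int[of X] int[of Y] by (intro integrable_norm Bochner_Integration.integrable_diff) auto
    show "integrable M F" by fact
    fix \<omega> assume \<omega>: "\<omega> \<in> space M"
    define a b where "a = t * X \<omega>" and "b = t * Y \<omega>"
    have "cmod (iexp a - iexp b) \<le> cmod (iexp a) + cmod (iexp b)" by (rule norm_triangle_ineq4)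
    then have 1: "cmod (iexp a - iexp b) \<le> 2" by simp
    have "iexp a - iexp b = iexp b * (iexp (a - b) - 1)"
      by (simp add: algebra_simps exp_diff)
    then have "cmod (iexp a - iexp b) = cmod (iexp (a - b) - 1)" by (simp add: norm_mult)
    also have "\<dots> \<le> \<bar>a - b\<bar>" using iexp_approx1[of "a - b" 0] by simp
    also have "\<dots> = \<bar>t\<bar> * \<bar>X \<omega> - Y \<omega>\<bar>" by (simp add: a_def b_def abs_mult flip: right_diff_distrib)
    finally show "cmod (iexp (t * X \<omega>) - iexp (t * Y \<omega>)) \<le> F \<omega>"
      using 1 F(2)[OF \<omega>] unfolding a_def b_def by linarith
  qed
  finally show ?thesis .
qed

lemma (in prob_space) expectation_abs_le_sqrt:
  fixes X :: "'a \<Rightarrow> real"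
  assumes [measurable]: "X \<in> borel_measurable M" and "integrable M (\<lambda>\<omega>. (X \<omega>)\<^sup>2)"
  shows "integrable M X" "expectation (\<lambda>\<omega>. \<bar>X \<omega>\<bar>) \<le> sqrt (expectation (\<lambda>\<omega>. (X \<omega>)\<^sup>2))"
proof -
  show i: "integrable M X" by (rule square_integrable_imp_integrable[OF assms])
  have "0 \<le> variance (\<lambda>\<omega>. \<bar>X \<omega>\<bar>)" by (rule variance_positive)
  also have "\<dots> = expectation (\<lambda>\<omega>. (X \<omega>)\<^sup>2) - (expectation (\<lambda>\<omega>. \<bar>X \<omega>\<bar>))\<^sup>2"
    using variance_eq[of "\<lambda>\<omega>. \<bar>X \<omega>\<bar>"] i assms(2) by simp
  finally show "expectation (\<lambda>\<omega>. \<bar>X \<omega>\<bar>) \<le> sqrt (expectation (\<lambda>\<omega>. (X \<omega>)\<^sup>2))"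
    by (intro real_le_rsqrt) auto
qed

lemma (in prob_space) second_moment_indep_sum:
  fixes X :: "'i \<Rightarrow> 'a \<Rightarrow> real"
  assumes fin: "finite I" and ind: "indep_vars (\<lambda>_. borel) X I"
    and int: "\<And>i. i \<in> I \<Longrightarrow> integrable M (\<lambda>\<omega>. (X i \<omega>)\<^sup>2)"
    and mean: "\<And>i. i \<in> I \<Longrightarrow> expectation (X i) = 0"
    and var: "\<And>i. i \<in> I \<Longrightarrow> expectation (\<lambda>\<omega>. (X i \<omega>)\<^sup>2) = v"
  shows "integrable M (\<lambda>\<omega>. (\<Sum>i\<in>I. X i \<omega>)\<^sup>2)"
    and "expectation (\<lambda>\<omega>. (\<Sum>i\<in>I. X i \<omega>)\<^sup>2) = real (card I) * v"
  using covariance_indep_linear_forms[OF assms, of "\<lambda>_. 1" "\<lambda>_. 1"]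
  by (simp_all add: power2_eq_square mult.commute)

section \<open>Comparison with a linear statistic\<close>

lemma tanh_le_self: "0 \<le> y \<Longrightarrow> tanh y \<le> (y::real)"
proof -
  assume y: "0 \<le> y"
  have "0 - tanh 0 \<le> y - tanh (y::real)"
  proof (rule DERIV_nonneg_imp_nondecreasing[OF y])
    fix z :: real
    have "((\<lambda>y. y - tanh y) has_real_derivative (1 - (1 - (tanh z)\<^sup>2))) (at z)"
      by (auto intro!: derivative_eq_intros)
    then show "\<exists>d. ((\<lambda>y. y - tanh y) has_real_derivative d) (at z) \<and> 0 \<le> d"
      by (intro exI conjI) auto
  qed
  then show ?thesis by simp
qed

lemma abs_tanh_le: "\<bar>tanh y\<bar> \<le> \<bar>y::real\<bar>"
  using tanh_le_self[of "\<bar>y\<bar>"] by (simp add: tanh_real_abs)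

lemma abs_tanh_less_1: "\<bar>tanh (x::real)\<bar> < 1"
  using tanh_real_bounds[of x] by (auto simp: abs_less_iff)

lemma ln_cosh_nonneg: "0 \<le> ln (cosh (y::real))"
  using cosh_real_ge_1[of y] by simp

lemma ln_cosh_le: "ln (cosh y) \<le> (y::real)\<^sup>2 / 2"
proof -
  have "0\<^sup>2 / 2 - ln (cosh 0) \<le> \<bar>y\<bar>\<^sup>2 / 2 - ln (cosh \<bar>y\<bar>)"
  proof (rule DERIV_nonneg_imp_nondecreasing[of 0 "\<bar>y\<bar>"])
    fix z :: real assume z: "0 \<le> z"
    have "((\<lambda>y. y\<^sup>2 / 2 - ln (cosh y)) has_real_derivative (z - tanh z)) (at z)"
      by (auto intro!: derivative_eq_intros simp: tanh_def)
    then show "\<exists>d. ((\<lambda>y. y\<^sup>2 / 2 - ln (cosh y)) has_real_derivative d) (at z) \<and> 0 \<le> d"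
      using tanh_le_self[OF z] by (intro exI conjI) auto
  qed simp
  then show ?thesis by simp
qed

lemma tendsto_ln_cosh_quotient:
  "((\<lambda>b. ln (cosh (b * x)) / b\<^sup>2) \<longlongrightarrow> x\<^sup>2 / 2) (at_right (0::real))"
proof (cases "x = 0")
  case False
  have *: "((\<lambda>y. ln (cosh y) / y\<^sup>2) \<longlongrightarrow> 1 / 2) (at_right (0::real))" by real_asymp
  have "filterlim (\<lambda>b. b * \<bar>x\<bar>) (at_right 0) (at_right (0::real))"
    using False by real_asymp
  from filterlim_compose[OF * this] have "((\<lambda>b. ln (cosh (b * \<bar>x\<bar>)) / (b * \<bar>x\<bar>)\<^sup>2) \<longlongrightarrow> 1 / 2) (at_right 0)" .
  from tendsto_mult[OF this tendsto_const[of "x\<^sup>2"]]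
  have "((\<lambda>b. ln (cosh (b * \<bar>x\<bar>)) / (b * \<bar>x\<bar>)\<^sup>2 * x\<^sup>2) \<longlongrightarrow> x\<^sup>2 / 2) (at_right 0)" by simp
  moreover have "ln (cosh (b * \<bar>x\<bar>)) / (b * \<bar>x\<bar>)\<^sup>2 * x\<^sup>2 = ln (cosh (b * x)) / b\<^sup>2" for b
    using False by (cases "0 \<le> x") (auto simp: power_mult_distrib)
  ultimately show ?thesis by simp
qed simp

lemma tendsto_tanh_quotient:
  "((\<lambda>b. tanh (b * x) / b) \<longlongrightarrow> x) (at_right (0::real))"
proof -
  have "((\<lambda>b. tanh (b * x)) has_real_derivative x) (at 0)"
    by (auto intro!: derivative_eq_intros)
  then have "((\<lambda>b. tanh (b * x) / b) \<longlongrightarrow> x) (at 0)"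
    by (simp add: has_field_derivative_iff)
  then show ?thesis by (rule filterlim_mono) (auto simp: at_le)
qed

lemma tendsto_binomial_ratio: "(\<lambda>N. real (N choose p) / real N ^ p) \<longlonglongrightarrow> 1 / fact p"
proof -
  have "(\<lambda>N. (\<Prod>i<p. (real N - real i) / real N) / fact p) \<longlonglongrightarrow> (\<Prod>i<p. 1) / fact p"
  proof (intro tendsto_divide tendsto_prod tendsto_const)
    fix i show "(\<lambda>N. (real N - real i) / real N) \<longlonglongrightarrow> 1" by real_asymp
  qed simp
  moreover have "(\<Prod>i<p. (real N - real i) / real N) / fact p = real (N choose p) / real N ^ p" for N
    by (simp add: binomial_gbinomial gbinomial_prod_rev prod_dividef lessThan_atLeast0)
  ultimately show ?thesis by simp
qed

lemma tendsto_powr_nonpos: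
  assumes "e \<le> 0"
  shows "(\<lambda>N. real N powr e) \<longlonglongrightarrow> of_bool (e = 0)"
proof (cases "e = 0")
  case True
  have "\<forall>\<^sub>F N in sequentially. 1 = real N powr e"
    by (rule eventually_sequentiallyI[of 1]) (simp add: True)
  then show ?thesis using True by (auto intro: Lim_transform_eventually[OF tendsto_const])
next
  case False
  then show ?thesis using assms
    by (auto intro!: tendsto_neg_powr filterlim_real_sequentially)
qed

lemma char_centered_normal:
  assumes "0 \<le> v"
  shows "char (centered_normal v) t = complex_of_real (exp (- (t\<^sup>2 * v) / 2))"
proof -
  have "char (centered_normal v) t = char std_normal_distribution (t * sqrt v)"
    unfolding char_def centered_normal_def by (subst integral_distr) (auto simp: mult_ac)
  then show ?thesis using assms by (simp add: char_std_normal_distribution power_mult_distrib)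
qed

lemma real_distribution_centered_normal: "real_distribution (centered_normal v)"
proof -
  interpret real_distribution std_normal_distribution by (rule real_dist_normal_dist)
  show ?thesis unfolding centered_normal_def by (rule real_distribution_distr) simp
qed

lemma borel_measurable_tanh [measurable (raw)]:
  fixes f :: "'a \<Rightarrow> real"
  assumes "f \<in> borel_measurable M"
  shows "(\<lambda>x. tanh (f x)) \<in> borel_measurable M"
  by (rule measurable_compose[OF assms])
     (intro borel_measurable_continuous_onI continuous_intros; simp)

lemma borel_measurable_cosh [measurable (raw)]:
  fixes f :: "'a \<Rightarrow> real"
  assumes "f \<in> borel_measurable M"
  shows "(\<lambda>x. cosh (f x)) \<in> borel_measurable M"
  by (rule measurable_compose[OF assms])
     (intro borel_measurable_continuous_onI continuous_intros)

lemma X_N_decomposition: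
  assumes b: "b = \<beta> * real N powr (- ((real p - 1) / 2))"
  shows "X_N P J p \<beta> h N g
    = (\<Sum>is\<in>index_tuples N p. ln (cosh (b * g is)) - (\<integral>\<omega>. ln (cosh (b * J \<omega>)) \<partial>P))
      + ln (reduced_partition (tanh h) p N (\<lambda>is. tanh (b * g is)))"
proof -
  let ?R = "reduced_partition (tanh h) p N (\<lambda>is. tanh (b * g is))"
  have R: "0 < ?R" by (rule reduced_partition_pos) (rule abs_tanh_less_1)+
  have C: "0 < (\<Prod>is\<in>index_tuples N p. cosh (b * g is))" by (intro prod_pos) simp
  have "ln (partition_function p N g \<beta> h)
      = ln ((2 * cosh h) ^ N) + ln (\<Prod>is\<in>index_tuples N p. cosh (b * g is)) + ln ?R"
    unfolding partition_function_factor[of p N g \<beta> h] b[symmetric]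
    using R C by (subst ln_mult_pos, simp, simp, subst ln_mult_pos) auto
  also have "ln ((2 * cosh h) ^ N) = real N * ln (2 * cosh h)" by (rule ln_realpow)
  also have "ln (\<Prod>is\<in>index_tuples N p. cosh (b * g is)) = (\<Sum>is\<in>index_tuples N p. ln (cosh (b * g is)))"
    by (rule ln_prod[OF finite_index_tuples]) simp
  finally have Z: "ln (partition_function p N g \<beta> h) = real N * ln (2 * cosh h)
      + (\<Sum>is\<in>index_tuples N p. ln (cosh (b * g is))) + ln ?R" .
  have "\<beta> * x / real N powr ((real p - 1) / 2) = b * x" for x
    unfolding b powr_minus by (simp only: divide_inverse mult_ac)
  then show ?thesis
    unfolding X_N_def Z by (simp add: sum_subtractf card_index_tuples)
qed

text \<open>
  For small \<open>v\<close> this is the quadratic error of the logarithm; elsewhere the bound 2 is paid for by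
  Chebyshev, as \<open>8 v\<^sup>2 \<ge> 2\<close>.
\<close>

lemma log_remainder_bound:
  fixes v D \<theta> :: real
  assumes "-1 < v" "0 \<le> D" "0 \<le> \<theta>"
  shows "min 2 (\<theta> * (D * \<bar>ln (1 + v) - v\<bar>)) \<le> (8 + 2 * \<theta> * D) * v\<^sup>2"
proof (cases "\<bar>v\<bar> \<le> 1 / 2")
  case True
  have "\<bar>ln (1 + v) - v\<bar> \<le> 2 * v\<^sup>2" by (rule abs_ln_one_plus_x_minus_x_bound) (use True in simp)
  then have "\<theta> * (D * \<bar>ln (1 + v) - v\<bar>) \<le> \<theta> * (D * (2 * v\<^sup>2))"
    using assms by (intro mult_left_mono) auto
  also have "\<dots> \<le> (8 + 2 * \<theta> * D) * v\<^sup>2" by (simp add: algebra_simps)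
  finally show ?thesis by linarith
next
  case False
  then have "(1/2)\<^sup>2 \<le> \<bar>v\<bar>\<^sup>2" by (intro power_mono) auto
  then have "2 \<le> 8 * v\<^sup>2" by (simp add: power2_eq_square)
  moreover have "0 \<le> 2 * \<theta> * D * v\<^sup>2" using assms by simp
  ultimately show ?thesis by (simp add: algebra_simps)
qed

lemma borel_measurable_X_N:
  assumes [measurable]: "\<And>is. is \<in> index_tuples N p \<Longrightarrow> g is \<in> borel_measurable M"
  shows "(\<lambda>\<omega>. X_N P J p \<beta> h N (\<lambda>is. g is \<omega>)) \<in> borel_measurable M"
  unfolding X_N_decomposition[OF refl] reduced_partition_def by measurable

lemma min_2_le_add: "x \<le> a + c \<Longrightarrow> 0 \<le> a \<Longrightarrow> min 2 x \<le> a + min 2 (c::real)"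
  by (simp add: min_def)

text \<open>
  The estimate for one \<open>N\<close>. With \<open>Z = 1 + L + W\<close> the reduced partition function and \<open>L\<close> its linear
  part, \<open>D X\<^sub>N\<close> is the normalised sum of the \<open>\<psi>(J\<^sub>i)\<close>, plus \<open>D W\<close>, plus \<open>D\<close> times the error of
  \<open>ln Z \<approx> Z - 1\<close>. Replacing \<open>\<psi>\<close> by another statistic \<open>\<phi>\<close> costs the mean square of \<open>\<psi>(J) - \<phi>(J)\<close> for
  a single variable, because the summands are independent and centred.
\<close>

lemma (in prob_space) free_energy_char_error:
  fixes g :: "nat list \<Rightarrow> 'a \<Rightarrow> real" and P :: "'b measure" and J :: "'b \<Rightarrow> real"
    and \<beta> D h \<theta> w :: real and N p :: nat
  assumes P: "prob_space P" and J: "J \<in> borel_measurable P"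
    and ind: "indep_vars (\<lambda>_. borel) g (index_tuples N p)"
    and law: "\<And>is. is \<in> index_tuples N p \<Longrightarrow> distr M borel (g is) = distr P borel J"
    and D: "0 \<le> D"
  defines "b \<equiv> \<beta> * real N powr (- ((real p - 1) / 2))"
  defines "n \<equiv> real (N choose p)"
  defines "s \<equiv> \<integral>\<omega>. (tanh (b * J \<omega>))\<^sup>2 \<partial>P"
  defines "\<psi> \<equiv> \<lambda>x. sqrt n * D * (ln (cosh (b * x)) - (\<integral>\<omega>. ln (cosh (b * J \<omega>)) \<partial>P) + tanh h ^ p * tanh (b * x))"
  assumes N: "p \<le> N"
    and t0: "(\<integral>\<omega>. tanh (b * J \<omega>) \<partial>P) = 0"
    and w: "overlap_remainder N p s ((tanh h)\<^sup>2) \<le> w"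
    and \<phi>: "\<phi> \<in> borel_measurable borel"
    and int: "integrable P (\<lambda>\<omega>. (\<psi> (J \<omega>) - \<phi> (J \<omega>))\<^sup>2)"
    and mean: "(\<integral>\<omega>. \<psi> (J \<omega>) - \<phi> (J \<omega>) \<partial>P) = 0"
  shows "cmod (char (distr M borel (\<lambda>\<omega>. D * X_N P J p \<beta> h N (\<lambda>is. g is \<omega>))) \<theta>
        - char (distr M borel (\<lambda>\<omega>. \<Sum>is\<in>index_tuples N p. \<phi> (g is \<omega>) / sqrt n)) \<theta>)
      \<le> \<bar>\<theta>\<bar> * sqrt (\<integral>\<omega>. (\<psi> (J \<omega>) - \<phi> (J \<omega>))\<^sup>2 \<partial>P) + \<bar>\<theta>\<bar> * D * sqrt w
        + (8 + 2 * \<bar>\<theta>\<bar> * D) * (2 * w + 2 * (tanh h ^ (2 * p) * (n * s)))"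
proof -
  interpret P: prob_space P by fact
  let ?I = "index_tuples N p" and ?X = "\<lambda>\<omega>. X_N P J p \<beta> h N (\<lambda>is. g is \<omega>)"
    and ?c = "\<integral>\<omega>. ln (cosh (b * J \<omega>)) \<partial>P"
  define m where "m = tanh h"
  define t where "t is \<omega> = tanh (b * g is \<omega>)" for "is" \<omega>
  have n: "0 < n" unfolding n_def using N by (simp add: zero_less_binomial_iff)
  have [measurable]: "J \<in> borel_measurable P" "\<phi> \<in> borel_measurable borel" by fact+
  have rv[measurable]: "g is \<in> borel_measurable M" if "is \<in> ?I" for "is"
    using ind that by (auto simp: indep_vars_def)
  have \<psi>[measurable]: "\<psi> \<in> borel_measurable borel" unfolding \<psi>_def by measurable
  have transfer: "(\<integral>\<omega>. f (g is \<omega>) \<partial>M) = (\<integral>\<omega>. f (J \<omega>) \<partial>P)"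
    "integrable M (\<lambda>\<omega>. f (g is \<omega>)) \<longleftrightarrow> integrable P (\<lambda>\<omega>. f (J \<omega>))"
    if i: "is \<in> ?I" and [measurable]: "f \<in> borel_measurable borel" for f :: "real \<Rightarrow> real" and "is"
  proof -
    have "(\<integral>\<omega>. f (g is \<omega>) \<partial>M) = (\<integral>x. f x \<partial>distr M borel (g is))" using i by (subst integral_distr) auto
    also have "\<dots> = (\<integral>\<omega>. f (J \<omega>) \<partial>P)" unfolding law[OF i] by (subst integral_distr) auto
    finally show "(\<integral>\<omega>. f (g is \<omega>) \<partial>M) = (\<integral>\<omega>. f (J \<omega>) \<partial>P)" .
    have "integrable M (\<lambda>\<omega>. f (g is \<omega>)) \<longleftrightarrow> integrable (distr M borel (g is)) f"
      using i by (subst integrable_distr_eq) auto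
    also have "\<dots> \<longleftrightarrow> integrable P (\<lambda>\<omega>. f (J \<omega>))"
      unfolding law[OF i] by (subst integrable_distr_eq) auto
    finally show "integrable M (\<lambda>\<omega>. f (g is \<omega>)) \<longleftrightarrow> integrable P (\<lambda>\<omega>. f (J \<omega>))" .
  qed
  have tind: "indep_vars (\<lambda>_. borel) t ?I"
    unfolding t_def by (rule indep_vars_compose2[OF ind, of "\<lambda>_ x. tanh (b * x)"]) measurable
  have t1: "\<bar>t is \<omega>\<bar> \<le> 1" "\<bar>t is \<omega>\<bar> < 1" for "is" \<omega> using abs_tanh_less_1 by (simp_all add: t_def less_imp_le)
  have tmean: "expectation (t is) = 0" and tvar: "expectation (\<lambda>\<omega>. (t is \<omega>)\<^sup>2) = s" if "is \<in> ?I" for "is"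
    using transfer(1)[OF that, of "\<lambda>x. tanh (b * x)"] transfer(1)[OF that, of "\<lambda>x. (tanh (b * x))\<^sup>2"] t0
    by (simp_all add: t_def[abs_def] s_def)
  define Z where "Z \<omega> = reduced_partition m p N (\<lambda>is. t is \<omega>)" for \<omega>
  define L where "L \<omega> = m ^ p * (\<Sum>is\<in>?I. t is \<omega>)" for \<omega>
  define W where "W \<omega> = Z \<omega> - 1 - L \<omega>" for \<omega>
  have tm[measurable]: "is \<in> ?I \<Longrightarrow> t is \<in> borel_measurable M" for "is" unfolding t_def[abs_def] by measurable
  have Zm[measurable]: "Z \<in> borel_measurable M"
    unfolding Z_def[abs_def] reduced_partition_def by measurable
  have Lm[measurable]: "L \<in> borel_measurable M" unfolding L_def[abs_def] by measurable
  have Wm[measurable]: "W \<in> borel_measurable M" unfolding W_def[abs_def] by measurable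
  have Zpos: "0 < Z \<omega>" for \<omega>
    unfolding Z_def m_def by (rule reduced_partition_pos[OF abs_tanh_less_1 t1(2)])
  note W2' = reduced_partition_second_moment[OF tind t1(1) tmean tvar, of m]
  have W2: "integrable M (\<lambda>\<omega>. (W \<omega>)\<^sup>2)" "expectation (\<lambda>\<omega>. (W \<omega>)\<^sup>2) \<le> w"
    using W2' w unfolding W_def L_def Z_def m_def by auto
  have L2: "integrable M (\<lambda>\<omega>. (L \<omega>)\<^sup>2)" "expectation (\<lambda>\<omega>. (L \<omega>)\<^sup>2) = m ^ (2 * p) * (n * s)"
  proof -
    have ti: "integrable M (\<lambda>\<omega>. (t is \<omega>)\<^sup>2)" if "is \<in> ?I" for "is"
    proof (rule integrable_const_bound[where B=1])
      show "AE \<omega> in M. norm ((t is \<omega>)\<^sup>2) \<le> 1" using t1 by (auto simp: abs_square_le_1)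
    qed (use that in measurable)
    note q = second_moment_indep_sum[OF finite_index_tuples tind ti tmean tvar]
    have e: "(L \<omega>)\<^sup>2 = m ^ (2 * p) * (\<Sum>is\<in>?I. t is \<omega>)\<^sup>2" for \<omega>
      by (simp add: L_def power_mult_distrib power_mult[symmetric] mult.commute)
    show "integrable M (\<lambda>\<omega>. (L \<omega>)\<^sup>2)" "expectation (\<lambda>\<omega>. (L \<omega>)\<^sup>2) = m ^ (2 * p) * (n * s)"
      unfolding e using q by (simp_all add: n_def card_index_tuples)
  qed
  have w0: "0 \<le> w" by (rule order_trans[OF _ W2(2)]) simp
  have X: "?X \<omega>
     = (\<Sum>is\<in>?I. ln (cosh (b * g is \<omega>)) - ?c) + ln (Z \<omega>)" for \<omega>
    unfolding Z_def t_def m_def by (rule X_N_decomposition) (simp add: b_def)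
  have Xm[measurable]: "?X \<in> borel_measurable M"
    by (rule borel_measurable_X_N) (rule rv)
  define S where "S \<omega> = (\<Sum>is\<in>?I. \<phi> (g is \<omega>) / sqrt n)" for \<omega>
  have Sm[measurable]: "S \<in> borel_measurable M" unfolding S_def[abs_def] by measurable
  define \<Delta> where "\<Delta> \<omega> = (\<Sum>is\<in>?I. (\<psi> (g is \<omega>) - \<phi> (g is \<omega>)) / sqrt n)" for \<omega>
  have \<Delta>m[measurable]: "\<Delta> \<in> borel_measurable M" unfolding \<Delta>_def[abs_def] by measurable
  define d where "d = (\<integral>\<omega>. (\<psi> (J \<omega>) - \<phi> (J \<omega>))\<^sup>2 \<partial>P)"
  have \<Delta>2: "integrable M (\<lambda>\<omega>. (\<Delta> \<omega>)\<^sup>2)" "expectation (\<lambda>\<omega>. (\<Delta> \<omega>)\<^sup>2) = d"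
  proof -
    define Y where "Y is \<omega> = (\<psi> (g is \<omega>) - \<phi> (g is \<omega>)) / sqrt n" for "is" \<omega>
    have Yi: "indep_vars (\<lambda>_. borel) Y ?I"
      unfolding Y_def by (rule indep_vars_compose2[OF ind, of "\<lambda>_ x. (\<psi> x - \<phi> x) / sqrt n"]) measurable
    have Ysq: "(Y is \<omega>)\<^sup>2 = (\<psi> (g is \<omega>) - \<phi> (g is \<omega>))\<^sup>2 / n" for "is" \<omega>
      using n by (simp add: Y_def power_divide)
    have Yint: "integrable M (\<lambda>\<omega>. (Y is \<omega>)\<^sup>2)" if "is \<in> ?I" for "is"
      unfolding Ysq using transfer(2)[OF that, of "\<lambda>x. (\<psi> x - \<phi> x)\<^sup>2"] int by simp
    have Ymean: "expectation (Y is) = 0" if "is \<in> ?I" for "is"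
      unfolding Y_def[abs_def] using transfer(1)[OF that, of "\<lambda>x. \<psi> x - \<phi> x"] mean by simp
    have Yvar: "expectation (\<lambda>\<omega>. (Y is \<omega>)\<^sup>2) = d / n" if "is \<in> ?I" for "is"
      unfolding Ysq using transfer(1)[OF that, of "\<lambda>x. (\<psi> x - \<phi> x)\<^sup>2"] by (simp add: d_def)
    note q = second_moment_indep_sum[OF finite_index_tuples Yi Yint Ymean Yvar]
    show "integrable M (\<lambda>\<omega>. (\<Delta> \<omega>)\<^sup>2)" "expectation (\<lambda>\<omega>. (\<Delta> \<omega>)\<^sup>2) = d"
      using q n unfolding \<Delta>_def Y_def by (simp_all add: card_index_tuples n_def[symmetric])
  qed
  have diff: "D * ?X \<omega> - S \<omega> = \<Delta> \<omega> + D * W \<omega> + D * (ln (Z \<omega>) - (Z \<omega> - 1))" for \<omega>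
  proof -
    have "(\<Sum>is\<in>?I. \<psi> (g is \<omega>) / sqrt n)
        = (\<Sum>is\<in>?I. D * (ln (cosh (b * g is \<omega>)) - ?c) + D * m ^ p * t is \<omega>)"
    proof (rule sum.cong[OF refl])
      fix "is"
      define x where "x = g is \<omega>"
      have "\<psi> x / sqrt n = D * (ln (cosh (b * x)) - ?c + m ^ p * tanh (b * x))"
        using n by (simp add: \<psi>_def m_def)
      then show "\<psi> (g is \<omega>) / sqrt n = D * (ln (cosh (b * g is \<omega>)) - ?c) + D * m ^ p * t is \<omega>"
        unfolding t_def x_def by (simp only: distrib_left mult.assoc)
    qed
    also have "\<dots> = D * (\<Sum>is\<in>?I. ln (cosh (b * g is \<omega>)) - ?c) + D * L \<omega>"
      by (simp add: sum.distrib sum_distrib_left L_def mult.assoc)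
    finally have "(\<Sum>is\<in>?I. \<psi> (g is \<omega>) / sqrt n)
      = D * (\<Sum>is\<in>?I. ln (cosh (b * g is \<omega>)) - ?c) + D * L \<omega>" .
    moreover have "\<Delta> \<omega> = (\<Sum>is\<in>?I. \<psi> (g is \<omega>) / sqrt n) - S \<omega>"
      unfolding \<Delta>_def S_def by (simp add: diff_divide_distrib sum_subtractf)
    ultimately show ?thesis unfolding X W_def by (simp add: algebra_simps)
  qed
  define F where "F \<omega> = \<bar>\<theta>\<bar> * \<bar>\<Delta> \<omega>\<bar> + \<bar>\<theta>\<bar> * D * \<bar>W \<omega>\<bar> + (8 + 2 * \<bar>\<theta>\<bar> * D) * (2 * (W \<omega>)\<^sup>2 + 2 * (L \<omega>)\<^sup>2)" for \<omega>
  have \<Delta>1: "integrable M \<Delta>" "expectation (\<lambda>\<omega>. \<bar>\<Delta> \<omega>\<bar>) \<le> sqrt d"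
    using expectation_abs_le_sqrt[OF \<Delta>m \<Delta>2(1)] \<Delta>2(2) by auto
  have W1: "integrable M W" "expectation (\<lambda>\<omega>. \<bar>W \<omega>\<bar>) \<le> sqrt w"
  proof -
    show "integrable M W" by (rule expectation_abs_le_sqrt[OF Wm W2(1)])
    have "sqrt (expectation (\<lambda>\<omega>. (W \<omega>)\<^sup>2)) \<le> sqrt w" using W2(2) by simp
    then show "expectation (\<lambda>\<omega>. \<bar>W \<omega>\<bar>) \<le> sqrt w"
      using expectation_abs_le_sqrt(2)[OF Wm W2(1)] by linarith
  qed
  have Fint: "integrable M F"
    unfolding F_def using \<Delta>1(1) W1(1) W2(1) L2(1) by auto
  have "cmod (char (distr M borel (\<lambda>\<omega>. D * ?X \<omega>)) \<theta> - char (distr M borel S) \<theta>) \<le> expectation F"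
  proof (rule char_diff_le[OF _ Sm Fint])
    show "(\<lambda>\<omega>. D * ?X \<omega>) \<in> borel_measurable M" by measurable
    fix \<omega>
    define r where "r = ln (Z \<omega>) - (Z \<omega> - 1)"
    have "min 2 (\<bar>\<theta>\<bar> * (D * \<bar>ln (1 + (Z \<omega> - 1)) - (Z \<omega> - 1)\<bar>)) \<le> (8 + 2 * \<bar>\<theta>\<bar> * D) * (Z \<omega> - 1)\<^sup>2"
      using Zpos[of \<omega>] D by (intro log_remainder_bound) auto
    then have "min 2 (\<bar>\<theta>\<bar> * (D * \<bar>r\<bar>)) \<le> (8 + 2 * \<bar>\<theta>\<bar> * D) * (Z \<omega> - 1)\<^sup>2" by (simp add: r_def)
    also have "\<dots> \<le> (8 + 2 * \<bar>\<theta>\<bar> * D) * (2 * (W \<omega>)\<^sup>2 + 2 * (L \<omega>)\<^sup>2)"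
    proof (rule mult_left_mono)
      have "0 \<le> (W \<omega> - L \<omega>)\<^sup>2" by simp
      moreover have "Z \<omega> - 1 = W \<omega> + L \<omega>" by (simp add: W_def)
      ultimately show "(Z \<omega> - 1)\<^sup>2 \<le> 2 * (W \<omega>)\<^sup>2 + 2 * (L \<omega>)\<^sup>2"
        by (simp add: power2_sum power2_diff)
    qed (use D in simp)
    finally have r: "min 2 (\<bar>\<theta>\<bar> * (D * \<bar>r\<bar>)) \<le> (8 + 2 * \<bar>\<theta>\<bar> * D) * (2 * (W \<omega>)\<^sup>2 + 2 * (L \<omega>)\<^sup>2)" .
    have "\<bar>D * ?X \<omega> - S \<omega>\<bar> \<le> \<bar>\<Delta> \<omega>\<bar> + D * \<bar>W \<omega>\<bar> + D * \<bar>r\<bar>"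
    proof -
      have "\<bar>\<Delta> \<omega> + D * W \<omega> + D * r\<bar> \<le> \<bar>\<Delta> \<omega>\<bar> + \<bar>D * W \<omega>\<bar> + \<bar>D * r\<bar>" by linarith
      then show ?thesis unfolding diff r_def using D by (simp add: abs_mult)
    qed
    then have "\<bar>\<theta>\<bar> * \<bar>D * ?X \<omega> - S \<omega>\<bar> \<le> \<bar>\<theta>\<bar> * (\<bar>\<Delta> \<omega>\<bar> + D * \<bar>W \<omega>\<bar> + D * \<bar>r\<bar>)"
      by (rule mult_left_mono) simp
    also have "\<bar>\<theta>\<bar> * (\<bar>\<Delta> \<omega>\<bar> + D * \<bar>W \<omega>\<bar> + D * \<bar>r\<bar>)
        = (\<bar>\<theta>\<bar> * \<bar>\<Delta> \<omega>\<bar> + \<bar>\<theta>\<bar> * D * \<bar>W \<omega>\<bar>) + \<bar>\<theta>\<bar> * (D * \<bar>r\<bar>)" by (simp add: algebra_simps)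
    finally have "min 2 (\<bar>\<theta>\<bar> * \<bar>D * ?X \<omega> - S \<omega>\<bar>)
        \<le> (\<bar>\<theta>\<bar> * \<bar>\<Delta> \<omega>\<bar> + \<bar>\<theta>\<bar> * D * \<bar>W \<omega>\<bar>) + min 2 (\<bar>\<theta>\<bar> * (D * \<bar>r\<bar>))"
      by (rule min_2_le_add) (use D in simp)
    also have "\<dots> \<le> F \<omega>" using r unfolding F_def by (rule add_left_mono)
    finally show "min 2 (\<bar>\<theta>\<bar> * \<bar>D * ?X \<omega> - S \<omega>\<bar>) \<le> F \<omega>" .
  qed
  also have "expectation F = \<bar>\<theta>\<bar> * expectation (\<lambda>\<omega>. \<bar>\<Delta> \<omega>\<bar>) + \<bar>\<theta>\<bar> * D * expectation (\<lambda>\<omega>. \<bar>W \<omega>\<bar>)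
      + (8 + 2 * \<bar>\<theta>\<bar> * D) * (2 * expectation (\<lambda>\<omega>. (W \<omega>)\<^sup>2) + 2 * expectation (\<lambda>\<omega>. (L \<omega>)\<^sup>2))"
    unfolding F_def using \<Delta>1(1) W1(1) W2(1) L2(1) by simp
  also have "\<dots> \<le> \<bar>\<theta>\<bar> * sqrt d + \<bar>\<theta>\<bar> * D * sqrt w + (8 + 2 * \<bar>\<theta>\<bar> * D) * (2 * w + 2 * (m ^ (2 * p) * (n * s)))"
    using \<Delta>1(2) W1(2) W2(2) L2(2) D by (intro add_mono mult_left_mono) auto
  finally show "cmod (char (distr M borel (\<lambda>\<omega>. D * ?X \<omega>)) \<theta>
        - char (distr M borel (\<lambda>\<omega>. \<Sum>is\<in>?I. \<phi> (g is \<omega>) / sqrt n)) \<theta>)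
      \<le> \<bar>\<theta>\<bar> * sqrt (\<integral>\<omega>. (\<psi> (J \<omega>) - \<phi> (J \<omega>))\<^sup>2 \<partial>P) + \<bar>\<theta>\<bar> * D * sqrt w
        + (8 + 2 * \<bar>\<theta>\<bar> * D) * (2 * w + 2 * (tanh h ^ (2 * p) * (n * s)))"
    unfolding S_def[abs_def] d_def m_def .
qed

section \<open>Symmetric disorder with four moments\<close>

lemma integral_odd_eq_0:
  fixes f :: "real \<Rightarrow> real"
  assumes [measurable]: "J \<in> borel_measurable P" "f \<in> borel_measurable borel"
    and sym: "distr P borel (\<lambda>\<omega>. - J \<omega>) = distr P borel J"
    and odd: "\<And>x. f (- x) = - f x"
  shows "(\<integral>\<omega>. f (J \<omega>) \<partial>P) = 0"
proof -
  have "(\<integral>\<omega>. f (J \<omega>) \<partial>P) = (\<integral>x. f x \<partial>distr P borel J)" by (subst integral_distr) auto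
  also have "\<dots> = (\<integral>\<omega>. f (- J \<omega>) \<partial>P)" unfolding sym[symmetric] by (subst integral_distr) auto
  also have "\<dots> = - (\<integral>\<omega>. f (J \<omega>) \<partial>P)" unfolding odd by simp
  finally show ?thesis by simp
qed

locale symmetric_disorder = prob_space P for P :: "'b measure" +
  fixes J :: "'b \<Rightarrow> real"
  assumes rv [measurable]: "J \<in> borel_measurable P"
    and symmetric: "distr P borel (\<lambda>\<omega>. - J \<omega>) = distr P borel J"
    and fourth_moment: "integrable P (\<lambda>\<omega>. (J \<omega>) ^ 4)"
    and mean_0: "expectation J = 0"
    and variance_1: "variance J = 1"
begin

lemma integrable_power: "k \<le> 4 \<Longrightarrow> integrable P (\<lambda>\<omega>. (J \<omega>) ^ k)"
proof (rule Bochner_Integration.integrable_bound)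
  show "integrable P (\<lambda>\<omega>. 1 + (J \<omega>) ^ 4)" using fourth_moment by simp
  assume k: "k \<le> 4"
  show "AE \<omega> in P. norm ((J \<omega>) ^ k) \<le> norm (1 + (J \<omega>) ^ 4)"
  proof (rule AE_I2)
    fix \<omega>
    have "\<bar>J \<omega>\<bar> ^ k \<le> 1 + \<bar>J \<omega>\<bar> ^ 4"
    proof (cases "\<bar>J \<omega>\<bar> \<le> 1")
      case True
      then have "\<bar>J \<omega>\<bar> ^ k \<le> 1" by (intro power_le_one) auto
      moreover have "0 \<le> \<bar>J \<omega>\<bar> ^ 4" by simp
      ultimately show ?thesis by linarith
    next
      case False
      then have "\<bar>J \<omega>\<bar> ^ k \<le> \<bar>J \<omega>\<bar> ^ 4" using k by (intro power_increasing) auto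
      then show ?thesis by linarith
    qed
    then show "norm ((J \<omega>) ^ k) \<le> norm (1 + (J \<omega>) ^ 4)" by (simp add: power_abs)
  qed
qed measurable

lemma second_moment: "expectation (\<lambda>\<omega>. (J \<omega>)\<^sup>2) = 1"
  using variance_1 mean_0 by simp

lemma third_moment: "expectation (\<lambda>\<omega>. (J \<omega>) ^ 3) = 0"
  by (rule integral_odd_eq_0[OF rv _ symmetric, of "\<lambda>x. x ^ 3"]) (auto simp: power3_eq_cube)

lemma expectation_tanh: "expectation (\<lambda>\<omega>. tanh (b * J \<omega>)) = 0"
  by (rule integral_odd_eq_0[OF rv _ symmetric, of "\<lambda>x. tanh (b * x)"]) auto

lemma integrable_tanh_square: "integrable P (\<lambda>\<omega>. (tanh (b * J \<omega>))\<^sup>2)"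
proof (rule integrable_const_bound[where B=1])
  show "AE \<omega> in P. norm ((tanh (b * J \<omega>))\<^sup>2) \<le> 1"
    using abs_tanh_less_1 by (auto simp: abs_square_le_1 less_imp_le)
qed measurable

lemma tanh_square_le: "expectation (\<lambda>\<omega>. (tanh (b * J \<omega>))\<^sup>2) \<le> b\<^sup>2"
proof -
  have "expectation (\<lambda>\<omega>. (tanh (b * J \<omega>))\<^sup>2) \<le> expectation (\<lambda>\<omega>. b\<^sup>2 * (J \<omega>)\<^sup>2)"
  proof (rule integral_mono)
    show "integrable P (\<lambda>\<omega>. b\<^sup>2 * (J \<omega>)\<^sup>2)" using integrable_power[of 2] by simp
    fix \<omega>
    have "\<bar>tanh (b * J \<omega>)\<bar>\<^sup>2 \<le> \<bar>b * J \<omega>\<bar>\<^sup>2" by (intro power_mono abs_tanh_le) simp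
    then show "(tanh (b * J \<omega>))\<^sup>2 \<le> b\<^sup>2 * (J \<omega>)\<^sup>2" by (simp add: power_mult_distrib)
  qed (rule integrable_tanh_square)
  then show ?thesis by (simp add: second_moment)
qed

lemma tanh_square_le_1: "expectation (\<lambda>\<omega>. (tanh (b * J \<omega>))\<^sup>2) \<le> 1"
proof -
  have "expectation (\<lambda>\<omega>. (tanh (b * J \<omega>))\<^sup>2) \<le> expectation (\<lambda>\<omega>. 1)"
    by (rule integral_mono[OF integrable_tanh_square])
      (use abs_tanh_less_1 in \<open>auto simp: abs_square_le_1 less_imp_le\<close>)
  then show ?thesis by (simp add: prob_space)
qed

lemma quadratic_statistic:
  defines "\<phi> \<equiv> \<lambda>A B x. A * (x\<^sup>2 - 1) + B * x"
  shows "integrable P (\<lambda>\<omega>. \<phi> A B (J \<omega>))" "integrable P (\<lambda>\<omega>. (\<phi> A B (J \<omega>))\<^sup>2)"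
    "expectation (\<lambda>\<omega>. \<phi> A B (J \<omega>)) = 0"
    "expectation (\<lambda>\<omega>. (\<phi> A B (J \<omega>))\<^sup>2) = A\<^sup>2 * variance (\<lambda>\<omega>. (J \<omega>)\<^sup>2) + B\<^sup>2"
proof -
  note i = integrable_power[of 1, simplified] integrable_power[of 2] integrable_power[of 3] fourth_moment
  show "integrable P (\<lambda>\<omega>. \<phi> A B (J \<omega>))" "expectation (\<lambda>\<omega>. \<phi> A B (J \<omega>)) = 0"
    unfolding \<phi>_def using i by (simp_all add: second_moment mean_0 prob_space)
  have sq: "(\<phi> A B x)\<^sup>2 = A\<^sup>2 * x ^ 4 + (2 * A * B) * x ^ 3 + (B\<^sup>2 - 2 * A\<^sup>2) * x\<^sup>2 + (- 2 * A * B) * x + A\<^sup>2" for x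
    by (simp add: \<phi>_def power2_eq_square power3_eq_cube eval_nat_numeral algebra_simps)
  show "integrable P (\<lambda>\<omega>. (\<phi> A B (J \<omega>))\<^sup>2)" unfolding sq using i by simp
  have "variance (\<lambda>\<omega>. (J \<omega>)\<^sup>2) = expectation (\<lambda>\<omega>. (J \<omega>) ^ 4) - 1"
    using i by (subst variance_eq) (simp_all add: second_moment flip: power_mult)
  moreover have "expectation (\<lambda>\<omega>. (\<phi> A B (J \<omega>))\<^sup>2)
      = A\<^sup>2 * expectation (\<lambda>\<omega>. (J \<omega>) ^ 4) + (B\<^sup>2 - 2 * A\<^sup>2) + A\<^sup>2"
    unfolding sq using i by (simp add: second_moment third_moment mean_0 prob_space)
  ultimately show "expectation (\<lambda>\<omega>. (\<phi> A B (J \<omega>))\<^sup>2) = A\<^sup>2 * variance (\<lambda>\<omega>. (J \<omega>)\<^sup>2) + B\<^sup>2"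
    by (simp only:) (simp add: right_diff_distrib)
qed

text \<open>
  Dominated convergence, with \<open>J\<^sup>4\<close> and \<open>J\<^sup>2\<close> as majorants: as \<open>b \<rightarrow> 0\<close>, \<open>ln cosh (b J)\<close> behaves like
  \<open>b\<^sup>2 J\<^sup>2 / 2\<close> and \<open>tanh (b J)\<close> like \<open>b J\<close>, and the prefactors \<open>k\<close> and \<open>l\<close> are tuned to these sizes.
\<close>

lemma linearisation_limit:
  fixes b k l :: "nat \<Rightarrow> real"
  assumes b: "filterlim b (at_right 0) sequentially" and b0: "\<And>N. 0 \<le> b N"
    and k0: "\<And>N. 0 \<le> k N" and l0: "\<And>N. 0 \<le> l N"
    and A: "(\<lambda>N. k N * (b N)\<^sup>2 / 2) \<longlonglongrightarrow> A" and B: "(\<lambda>N. l N * b N) \<longlonglongrightarrow> B"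
  defines "\<Delta> \<equiv> \<lambda>N \<omega>. k N * (ln (cosh (b N * J \<omega>)) - expectation (\<lambda>\<omega>. ln (cosh (b N * J \<omega>))))
      + l N * tanh (b N * J \<omega>) - (A * ((J \<omega>)\<^sup>2 - 1) + B * J \<omega>)"
  shows "integrable P (\<lambda>\<omega>. (\<Delta> N \<omega>)\<^sup>2)" "expectation (\<Delta> N) = 0"
    "(\<lambda>N. expectation (\<lambda>\<omega>. (\<Delta> N \<omega>)\<^sup>2)) \<longlonglongrightarrow> 0"
proof -
  note i = integrable_power[of 1, simplified] integrable_power[of 2] fourth_moment
  have bpos: "\<forall>\<^sub>F N in sequentially. 0 < b N"
    using b by (auto simp: filterlim_at elim: eventually_mono)
  \<comment> \<open>The centring of \<open>ln cosh\<close> turns the error of the quadratic part into a variance, so it suffices to bound the second moment of \<open>U\<close>.\<close>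
  define U where "U N \<omega> = k N * ln (cosh (b N * J \<omega>)) - A * (J \<omega>)\<^sup>2" for N \<omega>
  define T where "T N \<omega> = l N * tanh (b N * J \<omega>) - B * J \<omega>" for N \<omega>
  obtain KA where KA: "\<bar>k N * (b N)\<^sup>2 / 2\<bar> \<le> KA" for N
    using convergent_imp_Bseq[OF convergentI[OF A]] unfolding Bseq_def real_norm_def by blast
  obtain KB where KB: "\<bar>l N * b N\<bar> \<le> KB" for N
    using convergent_imp_Bseq[OF convergentI[OF B]] unfolding Bseq_def real_norm_def by blast
  have [measurable]: "U N \<in> borel_measurable P" "T N \<in> borel_measurable P" for N
    unfolding U_def[abs_def] T_def[abs_def] by measurable
  have Ub: "(U N \<omega>)\<^sup>2 \<le> (KA + \<bar>A\<bar>)\<^sup>2 * (J \<omega>) ^ 4" for N \<omega>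
  proof -
    have "\<bar>k N * ln (cosh (b N * J \<omega>))\<bar> = k N * ln (cosh (b N * J \<omega>))"
      using k0 ln_cosh_nonneg by simp
    also have "\<dots> \<le> k N * ((b N * J \<omega>)\<^sup>2 / 2)" by (intro mult_left_mono ln_cosh_le k0)
    also have "\<dots> = (k N * (b N)\<^sup>2 / 2) * (J \<omega>)\<^sup>2" by (simp add: power_mult_distrib)
    also have "\<dots> \<le> KA * (J \<omega>)\<^sup>2" using KA[of N] by (intro mult_right_mono) auto
    finally have "\<bar>U N \<omega>\<bar> \<le> KA * (J \<omega>)\<^sup>2 + \<bar>A * (J \<omega>)\<^sup>2\<bar>" unfolding U_def by linarith
    then have "\<bar>U N \<omega>\<bar> \<le> (KA + \<bar>A\<bar>) * (J \<omega>)\<^sup>2" by (simp add: abs_mult algebra_simps)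
    then have "\<bar>U N \<omega>\<bar>\<^sup>2 \<le> ((KA + \<bar>A\<bar>) * (J \<omega>)\<^sup>2)\<^sup>2" by (intro power_mono) auto
    then show ?thesis by (simp add: power_mult_distrib flip: power_mult)
  qed
  have Tb: "(T N \<omega>)\<^sup>2 \<le> (KB + \<bar>B\<bar>)\<^sup>2 * (J \<omega>)\<^sup>2" for N \<omega>
  proof -
    have "\<bar>l N * tanh (b N * J \<omega>)\<bar> \<le> l N * \<bar>b N * J \<omega>\<bar>"
    proof -
      have "l N * \<bar>tanh (b N * J \<omega>)\<bar> \<le> l N * \<bar>b N * J \<omega>\<bar>" by (intro mult_left_mono abs_tanh_le l0)
      then show ?thesis using l0[of N] by (simp only: abs_mult abs_of_nonneg)
    qed
    also have "\<dots> = (l N * b N) * \<bar>J \<omega>\<bar>" using b0 by (simp add: abs_mult)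
    also have "\<dots> \<le> KB * \<bar>J \<omega>\<bar>" using KB[of N] by (intro mult_right_mono) auto
    finally have "\<bar>T N \<omega>\<bar> \<le> KB * \<bar>J \<omega>\<bar> + \<bar>B * J \<omega>\<bar>" unfolding T_def by linarith
    then have "\<bar>T N \<omega>\<bar> \<le> (KB + \<bar>B\<bar>) * \<bar>J \<omega>\<bar>" by (simp add: abs_mult algebra_simps)
    then have "\<bar>T N \<omega>\<bar>\<^sup>2 \<le> ((KB + \<bar>B\<bar>) * \<bar>J \<omega>\<bar>)\<^sup>2" by (intro power_mono) auto
    then show ?thesis by (simp add: power_mult_distrib)
  qed
  let ?u = "\<lambda>N. expectation (\<lambda>\<omega>. (U N \<omega>)\<^sup>2)" and ?t = "\<lambda>N. expectation (\<lambda>\<omega>. (T N \<omega>)\<^sup>2)"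
  have U2: "integrable P (\<lambda>\<omega>. (U N \<omega>)\<^sup>2)" for N
    by (rule Bochner_Integration.integrable_bound[of _ "\<lambda>\<omega>. (KA + \<bar>A\<bar>)\<^sup>2 * (J \<omega>) ^ 4"])
      (use fourth_moment Ub in \<open>auto simp: abs_mult\<close>)
  have T2: "integrable P (\<lambda>\<omega>. (T N \<omega>)\<^sup>2)" for N
    by (rule Bochner_Integration.integrable_bound[of _ "\<lambda>\<omega>. (KB + \<bar>B\<bar>)\<^sup>2 * (J \<omega>)\<^sup>2"])
      (use integrable_power[of 2] Tb in \<open>auto simp: abs_mult\<close>)
  have U1: "integrable P (U N)" for N
    by (rule square_integrable_imp_integrable[OF _ U2]) measurable
  have T1: "integrable P (T N)" for N
    by (rule square_integrable_imp_integrable[OF _ T2]) measurable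
  have lnint: "integrable P (\<lambda>\<omega>. ln (cosh (b N * J \<omega>)))" for N
  proof (rule Bochner_Integration.integrable_bound[of _ "\<lambda>\<omega>. (b N)\<^sup>2 / 2 * (J \<omega>)\<^sup>2"])
    show "AE \<omega> in P. norm (ln (cosh (b N * J \<omega>))) \<le> norm ((b N)\<^sup>2 / 2 * (J \<omega>)\<^sup>2)"
      using ln_cosh_nonneg ln_cosh_le by (intro AE_I2) (simp add: power_mult_distrib[symmetric])
  qed (use integrable_power[of 2] in auto)
  have EU: "expectation (U N) = k N * expectation (\<lambda>\<omega>. ln (cosh (b N * J \<omega>))) - A" for N
    unfolding U_def[abs_def] using lnint i by (simp add: second_moment)
  have tint: "integrable P (\<lambda>\<omega>. tanh (b N * J \<omega>))" for N
    using square_integrable_imp_integrable[OF _ integrable_tanh_square[of "b N"]] by simp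
  have ET: "expectation (T N) = 0" for N
    unfolding T_def[abs_def] using tint i by (simp add: expectation_tanh mean_0)
  have \<Delta>: "\<Delta> N \<omega> = (U N \<omega> - expectation (U N)) + T N \<omega>" for N \<omega>
    unfolding EU by (simp add: \<Delta>_def U_def T_def algebra_simps)
  have V2: "integrable P (\<lambda>\<omega>. (U N \<omega> - expectation (U N))\<^sup>2)" for N
    unfolding power2_diff using U1 U2 by simp
  have VT: "integrable P (\<lambda>\<omega>. (U N \<omega> - expectation (U N)) * T N \<omega>)" for N
  proof (rule Bochner_Integration.integrable_bound[of _ "\<lambda>\<omega>. (U N \<omega> - expectation (U N))\<^sup>2 + (T N \<omega>)\<^sup>2"])
    have "\<bar>x * y\<bar> \<le> x\<^sup>2 + y\<^sup>2" for x y :: real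
    proof -
      have "0 \<le> (\<bar>x\<bar> - \<bar>y\<bar>)\<^sup>2 + x\<^sup>2 + y\<^sup>2" by simp
      then show ?thesis by (simp add: power2_diff abs_mult)
    qed
    then show "AE \<omega> in P. norm ((U N \<omega> - expectation (U N)) * T N \<omega>)
        \<le> norm ((U N \<omega> - expectation (U N))\<^sup>2 + (T N \<omega>)\<^sup>2)" by (intro AE_I2) simp
  qed (use V2 T2 in auto)
  show \<Delta>2: "integrable P (\<lambda>\<omega>. (\<Delta> N \<omega>)\<^sup>2)" for N
    unfolding \<Delta> power2_sum mult.assoc using V2 T2 VT by simp
  show "expectation (\<Delta> N) = 0"
    unfolding \<Delta>[abs_def] using U1 T1 ET by (simp add: prob_space)
  have EU2: "?u \<longlonglongrightarrow> expectation (\<lambda>\<omega>. 0)"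
  proof (rule integral_dominated_convergence[where w = "\<lambda>\<omega>. (KA + \<bar>A\<bar>)\<^sup>2 * (J \<omega>) ^ 4"])
    show "AE \<omega> in P. (\<lambda>N. (U N \<omega>)\<^sup>2) \<longlonglongrightarrow> 0"
    proof (rule AE_I2)
      fix \<omega>
      have "(\<lambda>N. ln (cosh (b N * J \<omega>)) / (b N)\<^sup>2) \<longlonglongrightarrow> (J \<omega>)\<^sup>2 / 2"
        by (rule filterlim_compose[OF tendsto_ln_cosh_quotient b])
      from tendsto_mult[OF tendsto_mult[OF A tendsto_const[of 2]] this]
      have "(\<lambda>N. k N * (b N)\<^sup>2 / 2 * 2 * (ln (cosh (b N * J \<omega>)) / (b N)\<^sup>2)) \<longlonglongrightarrow> A * (J \<omega>)\<^sup>2" by simp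
      moreover have "\<forall>\<^sub>F N in sequentially. k N * (b N)\<^sup>2 / 2 * 2 * (ln (cosh (b N * J \<omega>)) / (b N)\<^sup>2) = k N * ln (cosh (b N * J \<omega>))"
        using bpos by eventually_elim simp
      ultimately have "(\<lambda>N. k N * ln (cosh (b N * J \<omega>))) \<longlonglongrightarrow> A * (J \<omega>)\<^sup>2"
        by (rule Lim_transform_eventually)
      then have "(\<lambda>N. (U N \<omega>)\<^sup>2) \<longlonglongrightarrow> (A * (J \<omega>)\<^sup>2 - A * (J \<omega>)\<^sup>2)\<^sup>2"
        unfolding U_def by (intro tendsto_power tendsto_diff tendsto_const)
      then show "(\<lambda>N. (U N \<omega>)\<^sup>2) \<longlonglongrightarrow> 0" by simp
    qed
  qed (use fourth_moment Ub in auto)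
  have ET2: "?t \<longlonglongrightarrow> expectation (\<lambda>\<omega>. 0)"
  proof (rule integral_dominated_convergence[where w = "\<lambda>\<omega>. (KB + \<bar>B\<bar>)\<^sup>2 * (J \<omega>)\<^sup>2"])
    show "AE \<omega> in P. (\<lambda>N. (T N \<omega>)\<^sup>2) \<longlonglongrightarrow> 0"
    proof (rule AE_I2)
      fix \<omega>
      have "(\<lambda>N. tanh (b N * J \<omega>) / b N) \<longlonglongrightarrow> J \<omega>"
        by (rule filterlim_compose[OF tendsto_tanh_quotient b])
      from tendsto_mult[OF B this]
      have "(\<lambda>N. l N * b N * (tanh (b N * J \<omega>) / b N)) \<longlonglongrightarrow> B * J \<omega>" .
      moreover have "\<forall>\<^sub>F N in sequentially. l N * b N * (tanh (b N * J \<omega>) / b N) = l N * tanh (b N * J \<omega>)"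
        using bpos by eventually_elim simp
      ultimately have "(\<lambda>N. l N * tanh (b N * J \<omega>)) \<longlonglongrightarrow> B * J \<omega>"
        by (rule Lim_transform_eventually)
      then have "(\<lambda>N. (T N \<omega>)\<^sup>2) \<longlonglongrightarrow> (B * J \<omega> - B * J \<omega>)\<^sup>2"
        unfolding T_def by (intro tendsto_power tendsto_diff tendsto_const)
      then show "(\<lambda>N. (T N \<omega>)\<^sup>2) \<longlonglongrightarrow> 0" by simp
    qed
  qed (use integrable_power[of 2] Tb in auto)
  have upper: "expectation (\<lambda>\<omega>. (\<Delta> N \<omega>)\<^sup>2) \<le> 2 * ?u N + 2 * ?t N" for N
  proof -
    have "expectation (\<lambda>\<omega>. (\<Delta> N \<omega>)\<^sup>2)
        \<le> expectation (\<lambda>\<omega>. 2 * (U N \<omega> - expectation (U N))\<^sup>2 + 2 * (T N \<omega>)\<^sup>2)"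
    proof (rule integral_mono[OF \<Delta>2])
      fix \<omega>
      have "(x + y)\<^sup>2 \<le> 2 * x\<^sup>2 + 2 * y\<^sup>2" for x y :: real
        using zero_le_power2[of "x - y"] by (simp add: power2_sum power2_diff)
      then show "(\<Delta> N \<omega>)\<^sup>2 \<le> 2 * (U N \<omega> - expectation (U N))\<^sup>2 + 2 * (T N \<omega>)\<^sup>2" unfolding \<Delta> .
    qed (use V2 T2 in simp)
    also have "\<dots> = 2 * variance (U N) + 2 * ?t N" using V2 T2 by simp
    also have "\<dots> \<le> 2 * ?u N + 2 * ?t N"
      using variance_eq[OF U1 U2] by simp
    finally show ?thesis .
  qed
  have lim: "(\<lambda>N. 2 * ?u N + 2 * ?t N) \<longlonglongrightarrow> 0"
    using tendsto_add[OF tendsto_mult[OF tendsto_const[of 2] EU2] tendsto_mult[OF tendsto_const[of 2] ET2]] by simp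
  show "(\<lambda>N. expectation (\<lambda>\<omega>. (\<Delta> N \<omega>)\<^sup>2)) \<longlonglongrightarrow> 0"
  proof (rule tendsto_sandwich[OF _ _ tendsto_const lim])
    show "\<forall>\<^sub>F N in sequentially. 0 \<le> expectation (\<lambda>\<omega>. (\<Delta> N \<omega>)\<^sup>2)"
      by (intro always_eventually allI integral_nonneg_AE AE_I2 zero_le_power2)
    show "\<forall>\<^sub>F N in sequentially. expectation (\<lambda>\<omega>. (\<Delta> N \<omega>)\<^sup>2)
        \<le> 2 * ?u N + 2 * ?t N"
      by (intro always_eventually allI upper)
  qed
qed

end

section \<open>Fluctuations of the free energy\<close>

lemma sqrt_of_power_eq_powr: "1 \<le> N \<Longrightarrow> sqrt (real N ^ p) = real N powr (real p / 2)"
  by (simp add: powr_realpow[symmetric] powr_powr flip: powr_half_sqrt)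

lemma filterlim_at_right_0I:
  fixes f :: "nat \<Rightarrow> real"
  assumes "f \<longlonglongrightarrow> 0" "\<forall>\<^sub>F N in sequentially. 0 < f N"
  shows "filterlim f (at_right 0) sequentially"
  using assms by (auto simp: filterlim_at elim: eventually_mono)

text \<open>
  All three regimes at once. The natural exponents of the quadratic and of the linear statistic are
  \<open>(p - 2) / 2\<close> and \<open>\<alpha> p - 1 / 2\<close>; scaling by \<open>N\<close> to a smaller power \<open>\<gamma>\<close> removes a statistic from the
  limit, scaling by its own power keeps it. At \<open>\<alpha> = 1/4\<close> the remainder \<open>W\<close> is itself of order
  \<open>N^(1 - p/2)\<close>, whence the last assumption.
\<close>

lemma free_energy_clt:
  fixes P :: "'b measure" and J :: "'b \<Rightarrow> real"
    and M :: "nat \<Rightarrow> 'a measure" and g :: "nat \<Rightarrow> nat list \<Rightarrow> 'a \<Rightarrow> real"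
    and p :: nat and \<beta> \<rho> \<alpha> \<gamma> :: real and h :: "nat \<Rightarrow> real"
  assumes dis: "symmetric_disorder P J"
    and M: "\<And>N. prob_space (M N)"
    and ind: "\<And>N. prob_space.indep_vars (M N) (\<lambda>_. borel) (g N) (index_tuples N p)"
    and law: "\<And>N is. is \<in> index_tuples N p \<Longrightarrow> distr (M N) borel (g N is) = distr P borel J"
    and p: "p \<ge> 3" and \<beta>: "0 < \<beta>" "\<beta> < beta_f p"
    and \<rho>: "\<rho> > 0" and \<alpha>: "\<alpha> \<ge> 1/4"
    and h: "\<And>N. h N = \<rho> * real N powr (- \<alpha>)"
    and \<gamma>: "0 < \<gamma>" "\<gamma> \<le> (real p - 2) / 2" "\<gamma> \<le> \<alpha> * real p - 1 / 2"
    and sub: "1 / 4 < \<alpha> \<or> \<gamma> < (real p - 2) / 2"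
  shows "weak_conv_m
      (\<lambda>N. distr (M N) borel (\<lambda>\<omega>. real N powr \<gamma> * X_N P J p \<beta> (h N) N (\<lambda>is. g N is \<omega>)))
      (centered_normal (of_bool (\<gamma> = \<alpha> * real p - 1 / 2) * v1p_sq p \<beta> \<rho>
         + of_bool (\<gamma> = (real p - 2) / 2) * v1_sq P J p \<beta>))"
proof -
  interpret J: symmetric_disorder P J by (rule dis)
  define D where "D N = real N powr \<gamma>" for N
  define n where "n N = real (N choose p)" for N
  define b where "b N = \<beta> * real N powr (- ((real p - 1) / 2))" for N
  define m where "m N = tanh (h N)" for N
  define k where "k N = sqrt (n N) * D N" for N
  define l where "l N = sqrt (n N) * D N * m N ^ p" for N
  \<comment> \<open>\<open>e1\<close> and \<open>e2\<close> are the powers of \<open>N\<close> left over in the quadratic and in the linear statistic.\<close>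
  define e1 where "e1 = \<gamma> - (real p - 2) / 2"
  define e2 where "e2 = \<gamma> - (\<alpha> * real p - 1 / 2)"
  have e: "e1 \<le> 0" "e2 \<le> 0" using \<gamma> by (auto simp: e1_def e2_def)
  define A where "A = sqrt (1 / fact p) * (\<beta>\<^sup>2 / 2) * of_bool (e1 = 0)"
  define B where "B = sqrt (1 / fact p) * (\<beta> * \<rho> ^ p) * of_bool (e2 = 0)"
  have h0: "0 \<le> h N" for N using h \<rho> by simp
  have m0: "0 \<le> m N" "m N \<le> h N" "m N < 1" for N
    using h0[of N] tanh_le_self[OF h0[of N]] abs_tanh_less_1[of "h N"] by (auto simp: m_def)
  have b0: "0 \<le> b N" for N using \<beta> by (simp add: b_def)
  have D0: "0 \<le> D N" for N by (simp add: D_def)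
  have k0: "0 \<le> k N" and l0: "0 \<le> l N" for N
    using m0 D0 by (auto simp: k_def l_def n_def)
  have ratio: "(\<lambda>N. sqrt (n N / real N ^ p)) \<longlonglongrightarrow> sqrt (1 / fact p)"
    unfolding n_def by (intro tendsto_real_sqrt tendsto_binomial_ratio)
  have bpow: "(b N)\<^sup>2 = \<beta>\<^sup>2 * real N powr (- (real p - 1))" for N
  proof -
    have "real N powr (- ((real p - 1) / 2)) * real N powr (- ((real p - 1) / 2)) = real N powr (- (real p - 1))"
      unfolding powr_add[symmetric] by (rule arg_cong[where f="(powr) (real N)"]) simp
    then show ?thesis unfolding b_def power_mult_distrib by (simp only: power2_eq_square)
  qed
  have sn: "sqrt (n N) = sqrt (n N / real N ^ p) * real N powr (real p / 2)" if "1 \<le> N" for N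
    using that by (simp add: sqrt_of_power_eq_powr[symmetric] real_sqrt_divide)
  let ?r = "\<lambda>N. sqrt (n N / real N ^ p)" and ?hp = "- ((real p - 1) / 2)" and ?hq = "- ((real p - 2) / 2)"
  have limA: "(\<lambda>N. k N * (b N)\<^sup>2 / 2) \<longlonglongrightarrow> A"
  proof -
    have "(\<lambda>N. ?r N * (\<beta>\<^sup>2 / 2) * real N powr e1) \<longlonglongrightarrow> A"
      unfolding A_def by (intro tendsto_mult ratio tendsto_const tendsto_powr_nonpos e)
    moreover have "\<forall>\<^sub>F N in sequentially. ?r N * (\<beta>\<^sup>2 / 2) * real N powr e1 = k N * (b N)\<^sup>2 / 2"
    proof (rule eventually_sequentiallyI)
      fix N :: nat assume N: "1 \<le> N"
      have E: "real N powr (real p / 2) * real N powr \<gamma> * real N powr (- (real p - 1)) = real N powr e1"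
        unfolding powr_add[symmetric] e1_def by (rule arg_cong[where f="(powr) (real N)"]) (simp add: field_simps)
      show "?r N * (\<beta>\<^sup>2 / 2) * real N powr e1 = k N * (b N)\<^sup>2 / 2"
        unfolding k_def bpow sn[OF N] D_def E[symmetric]
        by (simp only: mult_ac times_divide_eq_left times_divide_eq_right)
    qed
    ultimately show ?thesis by (rule Lim_transform_eventually)
  qed
  have hpos: "\<forall>\<^sub>F N in sequentially. 0 < h N"
    by (rule eventually_sequentiallyI[of 1]) (use h \<rho> in simp)
  have hlim: "h \<longlonglongrightarrow> 0"
  proof -
    have "(\<lambda>N. \<rho> * real N powr (- \<alpha>)) \<longlonglongrightarrow> \<rho> * 0"
      using \<alpha> by (intro tendsto_mult tendsto_const tendsto_neg_powr filterlim_real_sequentially) auto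
    then show ?thesis unfolding h by simp
  qed
  have hright: "filterlim h (at_right 0) sequentially"
    by (rule filterlim_at_right_0I[OF hlim hpos])
  have mh: "(\<lambda>N. m N / h N) \<longlonglongrightarrow> 1"
    using filterlim_compose[OF tendsto_tanh_quotient[of 1] hright] by (simp add: m_def)
  have limB: "(\<lambda>N. l N * b N) \<longlonglongrightarrow> B"
  proof -
    have "(\<lambda>N. ?r N * (\<beta> * \<rho> ^ p) * real N powr e2 * (m N / h N) ^ p) \<longlonglongrightarrow> B * 1 ^ p"
      unfolding B_def by (intro tendsto_mult tendsto_power ratio tendsto_const tendsto_powr_nonpos e mh)
    moreover have "\<forall>\<^sub>F N in sequentially.
        ?r N * (\<beta> * \<rho> ^ p) * real N powr e2 * (m N / h N) ^ p = l N * b N"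
    proof (rule eventually_sequentiallyI)
      fix N :: nat assume N: "1 \<le> N"
      have hN: "h N \<noteq> 0" using N \<rho> by (simp add: h)
      have hp: "h N ^ p = \<rho> ^ p * real N powr (- (\<alpha> * real p))"
        using N by (simp add: h power_mult_distrib powr_power mult.commute)
      have E: "real N powr (real p / 2) * real N powr \<gamma> * real N powr (- (\<alpha> * real p)) * real N powr ?hp = real N powr e2"
        unfolding powr_add[symmetric] e2_def by (rule arg_cong[where f="(powr) (real N)"]) (simp add: field_simps)
      have "?r N * (\<beta> * \<rho> ^ p) * real N powr e2
          = ?r N * real N powr (real p / 2) * real N powr \<gamma>
              * (\<rho> ^ p * real N powr (- (\<alpha> * real p))) * (\<beta> * real N powr ?hp)"
        unfolding E[symmetric] by (simp only: mult_ac)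
      also have "\<dots> = sqrt (n N) * D N * h N ^ p * b N"
        unfolding sn[OF N] D_def hp b_def ..
      finally have "?r N * (\<beta> * \<rho> ^ p) * real N powr e2 = sqrt (n N) * D N * h N ^ p * b N" .
      then show "?r N * (\<beta> * \<rho> ^ p) * real N powr e2 * (m N / h N) ^ p = l N * b N"
        using hN by (simp add: l_def power_divide)
    qed
    ultimately have "(\<lambda>N. l N * b N) \<longlonglongrightarrow> B * 1 ^ p" by (rule Lim_transform_eventually)
    then show ?thesis by simp
  qed
  have bright: "filterlim b (at_right 0) sequentially"
  proof -
    have "b \<longlonglongrightarrow> \<beta> * 0"
      unfolding b_def[abs_def] using p
      by (intro tendsto_mult tendsto_const tendsto_neg_powr filterlim_real_sequentially) auto
    moreover have "\<forall>\<^sub>F N in sequentially. 0 < b N"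
      by (rule eventually_sequentiallyI[of 1]) (use \<beta> in \<open>simp add: b_def\<close>)
    ultimately show ?thesis by (intro filterlim_at_right_0I) simp_all
  qed
  define \<phi> where "\<phi> x = A * (x\<^sup>2 - 1) + B * x" for x
  have [measurable]: "\<phi> \<in> borel_measurable borel" unfolding \<phi>_def[abs_def] by measurable
  define \<psi> where "\<psi> N x = sqrt (n N) * D N * (ln (cosh (b N * x)) - (\<integral>\<omega>. ln (cosh (b N * J \<omega>)) \<partial>P)
      + tanh (h N) ^ p * tanh (b N * x))" for N x
  have \<psi>: "\<psi> N x - \<phi> x = k N * (ln (cosh (b N * x)) - (\<integral>\<omega>. ln (cosh (b N * J \<omega>)) \<partial>P))
      + l N * tanh (b N * x) - (A * (x\<^sup>2 - 1) + B * x)" for N x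
    by (simp add: \<psi>_def \<phi>_def k_def l_def m_def distrib_left mult.assoc)
  note lin = J.linearisation_limit[OF bright b0 k0 l0 limA limB, folded \<psi>]
  define d where "d N = (\<integral>\<omega>. (\<psi> N (J \<omega>) - \<phi> (J \<omega>))\<^sup>2 \<partial>P)" for N
  have dlim: "d \<longlonglongrightarrow> 0" unfolding d_def[abs_def] by (rule lin(3))
  define v where "v = A\<^sup>2 * J.variance (\<lambda>\<omega>. (J \<omega>)\<^sup>2) + B\<^sup>2"
  have v: "v = of_bool (\<gamma> = \<alpha> * real p - 1 / 2) * v1p_sq p \<beta> \<rho>
         + of_bool (\<gamma> = (real p - 2) / 2) * v1_sq P J p \<beta>"
  proof -
    have "A\<^sup>2 = of_bool (\<gamma> = (real p - 2) / 2) * (\<beta> ^ 4 / (4 * fact p))"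
      by (simp add: A_def e1_def power_mult_distrib power_divide flip: power_mult)
    moreover have "B\<^sup>2 = of_bool (\<gamma> = \<alpha> * real p - 1 / 2) * v1p_sq p \<beta> \<rho>"
      by (simp add: B_def e2_def v1p_sq_eq power_mult_distrib flip: power_mult) (simp add: mult.commute)
    ultimately show ?thesis by (simp add: v_def v1_sq_def)
  qed
  have v0: "0 \<le> v" unfolding v_def using J.variance_positive[of "\<lambda>\<omega>. (J \<omega>)\<^sup>2"] by simp
  have cardlim: "filterlim (\<lambda>N. card (index_tuples N p)) at_top sequentially"
  proof -
    have "filterlim (\<lambda>N. real N ^ p) at_top sequentially"
      using p by (intro filterlim_pow_at_top filterlim_real_sequentially) auto
    from filterlim_tendsto_pos_mult_at_top[OF tendsto_binomial_ratio[of p] _ this]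
    have "filterlim (\<lambda>N. real (N choose p) / real N ^ p * real N ^ p) at_top sequentially" by simp
    moreover have "\<forall>\<^sub>F N in sequentially. real (N choose p) / real N ^ p * real N ^ p = real (card (index_tuples N p))"
      by (rule eventually_sequentiallyI[of 1]) (simp add: card_index_tuples)
    ultimately show ?thesis
      unfolding filterlim_sequentially_iff_filterlim_real by (simp cong: filterlim_cong)
  qed
  have Slim: "(\<lambda>N. char (distr (M N) borel (\<lambda>\<omega>. (\<Sum>is\<in>index_tuples N p. \<phi> (g N is \<omega>) / sqrt (card (index_tuples N p))))) \<theta>)
     \<longlonglongrightarrow> complex_of_real (exp (- (\<theta>\<^sup>2 * v) / 2))" for \<theta>
    by (rule char_row_sum_limit[OF J.prob_space_axioms J.rv M ind law cardlim])
      (use J.quadratic_statistic[of A B] in \<open>simp_all add: \<phi>_def v_def\<close>)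
  obtain K where K: "0 \<le> K" "\<And>N s \<mu>. 1 \<le> N \<Longrightarrow> 0 \<le> s \<Longrightarrow> s \<le> 1 \<Longrightarrow> s \<le> \<beta>\<^sup>2 / real N ^ (p - 1) \<Longrightarrow>
      0 \<le> \<mu> \<Longrightarrow> \<mu> \<le> 1 \<Longrightarrow> \<mu> * sqrt N \<le> \<rho>\<^sup>2 \<Longrightarrow>
    overlap_remainder N p s \<mu>
      \<le> K * (1 / real N ^ (p - 2)) * (\<mu> * sqrt N + 1 / sqrt N ^ (p - 2))"
    by (rule overlap_estimate[OF \<beta>, of "\<rho>\<^sup>2"]) (use p in auto)
  define w where "w N = K * (1 / real N ^ (p - 2)) * ((m N)\<^sup>2 * sqrt N + 1 / sqrt N ^ (p - 2))" for N
  define s where "s N = (\<integral>\<omega>. (tanh (b N * J \<omega>))\<^sup>2 \<partial>P)" for N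
  have s: "0 \<le> s N" "s N \<le> 1" "s N \<le> (b N)\<^sup>2" for N
    unfolding s_def using J.tanh_square_le J.tanh_square_le_1 by (auto intro!: integral_nonneg_AE)
  have w0: "0 \<le> w N" for N using K(1) by (simp add: w_def)
  have \<mu>q: "(m N)\<^sup>2 * sqrt N \<le> \<rho>\<^sup>2 * real N powr (1 / 2 - 2 * \<alpha>)" if N: "1 \<le> N" for N
  proof -
    have "(m N)\<^sup>2 \<le> (h N)\<^sup>2" using m0 by (intro power_mono) auto
    then have "(m N)\<^sup>2 * sqrt N \<le> (h N)\<^sup>2 * sqrt N" by (intro mult_right_mono) auto
    also have "\<dots> = \<rho>\<^sup>2 * (real N powr (- 2 * \<alpha>) * real N powr (1 / 2))"
      using N by (simp add: h power_mult_distrib powr_power powr_half_sqrt)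
    also have "real N powr (- 2 * \<alpha>) * real N powr (1 / 2) = real N powr (1 / 2 - 2 * \<alpha>)"
      by (simp add: powr_add[symmetric])
    finally show ?thesis .
  qed
  have qp: "1 / real N ^ (p - 2) = real N powr (- (real p - 2))"
    "1 / sqrt N ^ (p - 2) = real N powr ?hq" if N: "1 \<le> N" for N
  proof -
    have r: "real (p - 2) = real p - 2" using p by simp
    show "1 / real N ^ (p - 2) = real N powr (- (real p - 2))"
      using N by (subst powr_minus) (simp add: powr_realpow[symmetric] r inverse_eq_divide)
    have "sqrt N ^ (p - 2) = sqrt (real N ^ (p - 2))" by (simp add: real_sqrt_power)
    then show "1 / sqrt N ^ (p - 2) = real N powr ?hq"
      using N by (subst powr_minus) (simp add: sqrt_of_power_eq_powr r inverse_eq_divide)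
  qed
  let ?up = "\<lambda>N. K * (real N powr e1)\<^sup>2 * (\<rho>\<^sup>2 * real N powr (1 / 2 - 2 * \<alpha>) + real N powr ?hq)"
  have Dw: "(\<lambda>N. (D N)\<^sup>2 * w N) \<longlonglongrightarrow> 0"
  proof (rule tendsto_sandwich[OF _ _ tendsto_const])
    show "\<forall>\<^sub>F N in sequentially. 0 \<le> (D N)\<^sup>2 * w N" using w0 by simp
    show "\<forall>\<^sub>F N in sequentially. (D N)\<^sup>2 * w N
        \<le> ?up N"
    proof (rule eventually_sequentiallyI)
      fix N :: nat assume N: "1 \<le> N"
      have x2: "(D N)\<^sup>2 * real N powr (- (real p - 2)) = (real N powr e1)\<^sup>2"
        unfolding D_def power2_eq_square powr_add[symmetric] e1_def
        by (rule arg_cong[where f="(powr) (real N)"]) (simp add: field_simps)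
      have "(D N)\<^sup>2 * w N = K * (real N powr e1)\<^sup>2 * ((m N)\<^sup>2 * sqrt N + real N powr ?hq)"
        unfolding w_def qp[OF N] x2[symmetric] by (simp only: mult_ac)
      also have "\<dots> \<le> ?up N"
        using K(1) \<mu>q[OF N] by (intro mult_left_mono add_right_mono) auto
      finally show "(D N)\<^sup>2 * w N \<le> \<dots>" .
    qed
    have "?up
       \<longlonglongrightarrow> K * (of_bool (e1 = 0))\<^sup>2 * (\<rho>\<^sup>2 * of_bool (1 / 2 - 2 * \<alpha> = 0) + of_bool (- ((real p - 2) / 2) = 0))"
      using \<alpha> p e by (intro tendsto_intros tendsto_powr_nonpos) auto
    moreover have "K * (of_bool (e1 = 0))\<^sup>2 * (\<rho>\<^sup>2 * of_bool (1 / 2 - 2 * \<alpha> = 0) + of_bool (- ((real p - 2) / 2) = 0)) = 0"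
      using sub p by (auto simp: e1_def)
    ultimately show "?up \<longlonglongrightarrow> 0"
      by (simp only:)
  qed
  have Dinf: "filterlim D at_top sequentially"
    unfolding D_def[abs_def] using \<gamma>(1) by real_asymp
  have Dinv: "(\<lambda>N. 1 / D N) \<longlonglongrightarrow> 0"
    by (intro tendsto_divide_0[OF tendsto_const] filterlim_at_top_imp_at_infinity Dinf)
  define err where "err \<theta> N = \<bar>\<theta>\<bar> * sqrt (d N) + \<bar>\<theta>\<bar> * sqrt ((D N)\<^sup>2 * w N)
     + (8 * (1 / D N)\<^sup>2 + 2 * \<bar>\<theta>\<bar> * (1 / D N)) * (2 * ((D N)\<^sup>2 * w N) + 2 * (l N * b N)\<^sup>2)" for \<theta> N
  have errlim: "err \<theta> \<longlonglongrightarrow> 0" for \<theta>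
  proof -
    have "err \<theta> \<longlonglongrightarrow> \<bar>\<theta>\<bar> * sqrt 0 + \<bar>\<theta>\<bar> * sqrt 0 + (8 * 0\<^sup>2 + 2 * \<bar>\<theta>\<bar> * 0) * (2 * 0 + 2 * B\<^sup>2)"
      unfolding err_def[abs_def] by (intro tendsto_intros dlim Dw Dinv limB)
    then show ?thesis by simp
  qed
  let ?X = "\<lambda>N \<omega>. X_N P J p \<beta> (h N) N (\<lambda>is. g N is \<omega>)"
  let ?S = "\<lambda>N \<omega>. (\<Sum>is\<in>index_tuples N p. \<phi> (g N is \<omega>) / sqrt (card (index_tuples N p)))"
  let ?gap = "\<lambda>N \<theta>. cmod (char (distr (M N) borel (\<lambda>\<omega>. D N * ?X N \<omega>)) \<theta> - char (distr (M N) borel (?S N)) \<theta>)"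
  have close: "\<forall>\<^sub>F N in sequentially.
     ?gap N \<theta> \<le> err \<theta> N" for \<theta>
  proof (rule eventually_sequentiallyI)
    fix N assume "max p 1 \<le> N"
    then have N: "p \<le> N" "1 \<le> N" by auto
    interpret MN: prob_space "M N" by (rule M)
    have Dpos: "0 < D N" using N by (simp add: D_def)
    have spow: "s N \<le> \<beta>\<^sup>2 / real N ^ (p - 1)"
    proof -
      have "real (p - 1) = real p - 1" using p by simp
      then have "real N powr (- (real p - 1)) = 1 / real N ^ (p - 1)"
        using N by (subst powr_minus) (simp add: powr_realpow[symmetric] inverse_eq_divide)
      then show ?thesis using s(3)[of N] unfolding bpow by simp
    qed
    have msq: "(m N)\<^sup>2 \<le> 1" using m0[of N] by (simp add: power_le_one)
    have \<mu>R: "(m N)\<^sup>2 * sqrt N \<le> \<rho>\<^sup>2"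
    proof -
      have "real N powr (1 / 2 - 2 * \<alpha>) \<le> real N powr 0" using N \<alpha> by (intro powr_mono) auto
      then have "\<rho>\<^sup>2 * real N powr (1 / 2 - 2 * \<alpha>) \<le> \<rho>\<^sup>2 * 1" using N by (intro mult_left_mono) auto
      then show ?thesis using \<mu>q[OF N(2)] by linarith
    qed
    have wN: "overlap_remainder N p (s N) ((m N)\<^sup>2) \<le> w N"
      unfolding w_def by (rule K(2)[OF N(2) s(1,2) spow _ msq \<mu>R]) simp
    have "?gap N \<theta>
       \<le> \<bar>\<theta>\<bar> * sqrt (d N) + \<bar>\<theta>\<bar> * D N * sqrt (w N)
         + (8 + 2 * \<bar>\<theta>\<bar> * D N) * (2 * w N + 2 * (m N ^ (2 * p) * (n N * s N)))"
      unfolding card_index_tuples d_def s_def \<psi>_def n_def b_def m_def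
    proof (rule MN.free_energy_char_error[where g="g N" and P=P and J=J and \<beta>=\<beta> and D="D N" and h="h N"
            and \<theta>=\<theta> and w="w N" and N=N and p=p and \<phi>=\<phi>])
      show "prob_space P" "J \<in> borel_measurable P" by (rule J.prob_space_axioms, rule J.rv)
      show "MN.indep_vars (\<lambda>_. borel) (g N) (index_tuples N p)" by (rule ind)
      show "0 \<le> D N" "p \<le> N" by (rule D0, rule N(1))
      show "\<phi> \<in> borel_measurable borel" by measurable
    qed (fact law J.expectation_tanh wN[unfolded s_def b_def m_def]
        lin(1)[of N, unfolded \<psi>_def n_def b_def] lin(2)[of N, unfolded \<psi>_def n_def b_def])+
    also have "\<dots> \<le> err \<theta> N"
    proof -
      have "\<bar>\<theta>\<bar> * D N * sqrt (w N) = \<bar>\<theta>\<bar> * sqrt ((D N)\<^sup>2 * w N)"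
        using D0 by (simp add: real_sqrt_mult)
      moreover have "m N ^ (2 * p) * (n N * s N) \<le> (l N * b N)\<^sup>2 / (D N)\<^sup>2"
      proof -
        have "m N ^ (2 * p) * (n N * s N) \<le> m N ^ (2 * p) * (n N * (b N)\<^sup>2)"
          using s(3) by (intro mult_left_mono) (auto simp: n_def)
        also have "\<dots> = (l N * b N)\<^sup>2 / (D N)\<^sup>2"
          using Dpos by (simp add: l_def power_mult_distrib n_def power_mult[symmetric] mult.commute)
        finally show ?thesis .
      qed
      then have "(8 + 2 * \<bar>\<theta>\<bar> * D N) * (2 * w N + 2 * (m N ^ (2 * p) * (n N * s N)))
          \<le> (8 + 2 * \<bar>\<theta>\<bar> * D N) * (2 * w N + 2 * ((l N * b N)\<^sup>2 / (D N)\<^sup>2))"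
        using D0 by (intro mult_left_mono) auto
      moreover have "\<dots> = (8 * (1 / D N)\<^sup>2 + 2 * \<bar>\<theta>\<bar> * (1 / D N)) * (2 * ((D N)\<^sup>2 * w N) + 2 * (l N * b N)\<^sup>2)"
        using Dpos by (simp add: field_simps power2_eq_square)
      ultimately show ?thesis unfolding err_def by linarith
    qed
    finally show "?gap N \<theta> \<le> err \<theta> N" .
  qed
  show ?thesis
    unfolding v[symmetric]
  proof (rule levy_continuity)
    show "real_distribution (centered_normal v)" by (rule real_distribution_centered_normal)
    show "real_distribution (distr (M N) borel (\<lambda>\<omega>. real N powr \<gamma> * ?X N \<omega>))" for N
    proof -
      interpret MN: prob_space "M N" by (rule M)
      have "?X N \<in> borel_measurable (M N)"
        by (rule borel_measurable_X_N) (use ind[of N] in \<open>auto simp: MN.indep_vars_def\<close>)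
      then show ?thesis by (intro MN.real_distribution_distr) measurable
    qed
    fix \<theta>
    have "(\<lambda>N. char (distr (M N) borel (\<lambda>\<omega>. D N * ?X N \<omega>)) \<theta>) \<longlonglongrightarrow> complex_of_real (exp (- (\<theta>\<^sup>2 * v) / 2))"
      by (rule Lim_transform[OF Slim[of \<theta>] Lim_null_comparison[OF close[of \<theta>] errlim[of \<theta>]]])
    then show "(\<lambda>N. char (distr (M N) borel (\<lambda>\<omega>. real N powr \<gamma> * ?X N \<omega>)) \<theta>) \<longlonglongrightarrow> char (centered_normal v) \<theta>"
      unfolding char_centered_normal[OF v0] D_def .
  qed
qed

theorem corollary1p14:
  fixes P :: "'b measure" and J :: "'b \<Rightarrow> real"
    and M :: "nat \<Rightarrow> 'a measure" and g :: "nat \<Rightarrow> nat list \<Rightarrow> 'a \<Rightarrow> real"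
    and p :: nat and \<beta> \<rho> \<alpha> :: real and h :: "nat \<Rightarrow> real"
  assumes "prob_space P" and "J \<in> borel_measurable P"
    and "distr P borel (\<lambda>\<omega>. - J \<omega>) = distr P borel J"
    and "integrable P (\<lambda>\<omega>. (J \<omega>) ^ 4)"
    and "prob_space.expectation P J = 0"
    and "prob_space.variance P J = 1"
    and "\<And>N. prob_space (M N)"
    and "\<And>N. prob_space.indep_vars (M N) (\<lambda>_. borel) (g N) (index_tuples N p)"
    and "\<And>N is. is \<in> index_tuples N p \<Longrightarrow> distr (M N) borel (g N is) = distr P borel J"
    and "p \<ge> 3" and "0 < \<beta>" and "\<beta> < beta_f p"
    and "\<rho> > 0" and "\<alpha> \<ge> 1/4"
    and "\<And>N. h N = \<rho> * real N powr (- \<alpha>)"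
  defines "X \<equiv> \<lambda>N \<omega>. X_N P J p \<beta> (h N) N (\<lambda>is. g N is \<omega>)"
  shows
    "(\<alpha> > (real p - 1) / (2 * real p) \<longrightarrow>
        weak_conv_m
          (\<lambda>N. distr (M N) borel (\<lambda>\<omega>. real N powr ((real p - 2) / 2) * X N \<omega>))
          (centered_normal (v1_sq P J p \<beta>))) \<and>
     (\<alpha> = (real p - 1) / (2 * real p) \<longrightarrow>
        weak_conv_m
          (\<lambda>N. distr (M N) borel (\<lambda>\<omega>. real N powr ((real p - 2) / 2) * X N \<omega>))
          (centered_normal (v1p_sq p \<beta> \<rho> + v1_sq P J p \<beta>))) \<and>
     (\<alpha> < (real p - 1) / (2 * real p) \<longrightarrow>
        weak_conv_m
          (\<lambda>N. distr (M N) borel (\<lambda>\<omega>. real N powr ((2 * \<alpha> * real p - 1) / 2) * X N \<omega>))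
          (centered_normal (v1p_sq p \<beta> \<rho>)))"
proof -
  have dis: "symmetric_disorder P J"
    using assms(1-6) by (simp add: symmetric_disorder_def symmetric_disorder_axioms_def)
  have p3: "real p \<ge> 3" using assms(10) by simp
  note clt = free_energy_clt[where h = h, OF dis assms(7-15)]
  have quarter: "1 / 4 < (real p - 1) / (2 * real p)" using p3 by (simp add: field_simps)
  have crit: "(real p - 1) / (2 * real p) < \<alpha> \<longleftrightarrow> (real p - 2) / 2 < \<alpha> * real p - 1 / 2"
    "\<alpha> = (real p - 1) / (2 * real p) \<longleftrightarrow> (real p - 2) / 2 = \<alpha> * real p - 1 / 2"
  proof -
    have pos: "0 < 2 * real p" and dbl: "\<alpha> * (2 * real p) = 2 * (\<alpha> * real p)" using p3 by auto
    have scale: "c - 1 < 2 * a \<longleftrightarrow> (c - 2) / 2 < a - 1 / 2" "2 * a = c - 1 \<longleftrightarrow> (c - 2) / 2 = a - 1 / 2" for a c :: real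
      by (auto simp: field_simps)
    show "(real p - 1) / (2 * real p) < \<alpha> \<longleftrightarrow> (real p - 2) / 2 < \<alpha> * real p - 1 / 2"
      unfolding pos_divide_less_eq[OF pos] dbl by (rule scale)
    have "\<alpha> = (real p - 1) / (2 * real p) \<longleftrightarrow> \<alpha> * (2 * real p) = real p - 1"
      using pos by (simp only: eq_divide_eq) simp
    also have "\<dots> \<longleftrightarrow> (real p - 2) / 2 = \<alpha> * real p - 1 / 2"
      unfolding dbl by (rule scale)
    finally show "\<alpha> = (real p - 1) / (2 * real p) \<longleftrightarrow> (real p - 2) / 2 = \<alpha> * real p - 1 / 2" .
  qed
  have lower: "\<alpha> * real p \<ge> 1 / 4 * 3"
    using assms(14) p3 by (intro mult_mono) auto
  have expo: "(2 * \<alpha> * real p - 1) / 2 = \<alpha> * real p - 1 / 2" by (simp add: field_simps)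
  show ?thesis
    unfolding X_def expo
  proof (intro conjI impI)
    assume *: "\<alpha> > (real p - 1) / (2 * real p)"
    have "(real p - 2) / 2 < \<alpha> * real p - 1 / 2" "1 / 4 < \<alpha>"
      using * crit(1) by blast (rule less_trans[OF quarter *])
    then show "weak_conv_m
        (\<lambda>N. distr (M N) borel (\<lambda>\<omega>. real N powr ((real p - 2) / 2) * X_N P J p \<beta> (h N) N (\<lambda>is. g N is \<omega>)))
        (centered_normal (v1_sq P J p \<beta>))"
      using clt[of "(real p - 2) / 2"] p3 by simp
  next
    assume "\<alpha> = (real p - 1) / (2 * real p)"
    then have "(real p - 2) / 2 = \<alpha> * real p - 1 / 2" "1 / 4 < \<alpha>" using crit(2) quarter by auto
    then show "weak_conv_m
        (\<lambda>N. distr (M N) borel (\<lambda>\<omega>. real N powr ((real p - 2) / 2) * X_N P J p \<beta> (h N) N (\<lambda>is. g N is \<omega>)))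
        (centered_normal (v1p_sq p \<beta> \<rho> + v1_sq P J p \<beta>))"
      using clt[of "(real p - 2) / 2"] p3 by simp
  next
    assume "\<alpha> < (real p - 1) / (2 * real p)"
    then have "\<alpha> * real p - 1 / 2 < (real p - 2) / 2" using crit by linarith
    then show "weak_conv_m
        (\<lambda>N. distr (M N) borel (\<lambda>\<omega>. real N powr (\<alpha> * real p - 1 / 2) * X_N P J p \<beta> (h N) N (\<lambda>is. g N is \<omega>)))
        (centered_normal (v1p_sq p \<beta> \<rho>))"
      using clt[of "\<alpha> * real p - 1 / 2"] lower by simp
  qed
qed

end
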